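(* Assume that $r_1,\dots,r_k$ are bounded and Riemann integrable, that $\lim_{N\to\infty}(N\varepsilon_N)^{-1}(\log N)^{\xi}=0$ for some fixed $\xi>8$, and that $\lim_{N\to\infty}\varepsilon_N=\varepsilon_\infty$ for some $\varepsilon_\infty\ge 0$. Then, for every $i\in\mathcal I$, as $N\to\infty$, $$\lambda_i(A_N)=\mathrm{E}\left(\lambda_i(A_N)\right)+\frac{N\theta_i\varepsilon_N}{\lambda_i(A_N)}\,e_i^\prime W_N e_i+o_p\left(\sqrt{\varepsilon_N}\right).$$
   Context: Setting. Let $k\ge 1$, let $\theta_1\ge\dots\ge\theta_k>0$, and let $r_1,\dots,r_k:[0,1]\to\mathbb{R}$ be an orthonormal set in $L^2[0,1]$ such that $f(x,y):=\sum_{i=1}^k\theta_i r_i(x)r_i(y)\ge 0$ for all $(x,y)\in[0,1]^2$. Let $(\varepsilon_N)_{N\ge1}$ be a real sequence with $0<\varepsilon_N\le\left[\sup_{0\le x,y\le 1}f(x,y)\right]^{-1}$. For each $N\ge 1$, $A_N$ is the $N\times N$ random symmetric matrix whose entries $\{A_N(i,j):1\le i\le j\le N\}$ are independent with $A_N(i,j)\sim\mathrm{Bernoulli}(\varepsilon_N f(i/N,j/N))$ (self-loops allowed). $W_N:=A_N-\mathrm{E}(A_N)$, with entrywise expectation. For a real symmetric matrix $M$, $\lambda_1(M)\ge\lambda_2(M)\ge\cdots$ denote its eigenvalues. With $\theta_0=\infty$ and $\theta_{k+1}=-\infty$, $\mathcal I:=\{1\le i\le k:\theta_{i-1}>\theta_i>\theta_{i+1}\}$.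 For $1\le i\le k$, $e_i$ (depending on $N$) is the $N\times1$ vector with entries $e_i(m)=N^{-1/2}r_i(m/N)$, $1\le m\le N$; a prime denotes transpose. Notation. For random variables $Y_N,Z_N$, $Y_N=o_p(Z_N)$ means $\lim_{N\to\infty}P(|Y_N|>\delta|Z_N|)=0$ for all $\delta>0$. Under the assumptions, $\lambda_i(A_N)$ is non-zero with probability tending to $1$, so the division makes sense on events of probability tending to $1$. *)

theory Defs
  imports "HOL-Probability.Probability" "Jordan_Normal_Form.Char_Poly"
begin

(* The condition is on the mesh, not on a gauge: this is the Riemann integral, as opposed
   to the Henstock-Kurzweil integral denoted by integrable_on. *)
definition riemann_integrable_on :: "(real \<Rightarrow> real) \<Rightarrow> real \<Rightarrow> real \<Rightarrow> bool" where
  "riemann_integrable_on g a b \<longleftrightarrow>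
     (\<exists>I. \<forall>\<epsilon>>0. \<exists>\<delta>>0. \<forall>D. D tagged_division_of {a..b} \<and> (\<forall>(x, K)\<in>D. measure lborel K < \<delta>) \<longrightarrow>
        \<bar>(\<Sum>(x, K)\<in>D. measure lborel K * g x) - I\<bar> < \<epsilon>)"

definition orthonormal_L2 :: "(nat \<Rightarrow> real \<Rightarrow> real) \<Rightarrow> nat set \<Rightarrow> bool" where
  "orthonormal_L2 r S \<longleftrightarrow>
     (\<forall>i\<in>S. r i \<in> borel_measurable (lebesgue_on {0..1}) \<and>
            integrable (lebesgue_on {0..1}) (\<lambda>x. (r i x)\<^sup>2)) \<and>
     (\<forall>i\<in>S. \<forall>j\<in>S. (\<integral>x. r i x * r j x \<partial>lebesgue_on {0..1}) = (if i = j then 1 else 0))"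

definition edge_kernel :: "nat \<Rightarrow> (nat \<Rightarrow> real) \<Rightarrow> (nat \<Rightarrow> real \<Rightarrow> real) \<Rightarrow> real \<Rightarrow> real \<Rightarrow> real" where
  "edge_kernel k \<theta> r x y = (\<Sum>i=1..k. \<theta> i * r i x * r i y)"

definition theta_ext :: "nat \<Rightarrow> (nat \<Rightarrow> real) \<Rightarrow> nat \<Rightarrow> ereal" where
  "theta_ext k \<theta> i = (if i = 0 then \<infinity> else if i = k + 1 then -\<infinity> else ereal (\<theta> i))"

definition simple_indices :: "nat \<Rightarrow> (nat \<Rightarrow> real) \<Rightarrow> nat set" where
  "simple_indices k \<theta> =
     {i. 1 \<le> i \<and> i \<le> k \<and> theta_ext k \<theta> (i - 1) > theta_ext k \<theta> i \<and>
         theta_ext k \<theta> i > theta_ext k \<theta> (i + 1)}"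

(* Eigenvalues repeated according to multiplicity, in decreasing order, numbered from 1.
   A real symmetric N x N matrix has N of them; indices outside 1..N are meaningless. *)
definition eigval :: "nat \<Rightarrow> real Matrix.mat \<Rightarrow> real" where
  "eigval i B = rev (sorted_list_of_multiset (proots (char_poly B))) ! (i - 1)"

(* Matrix and vector positions are numbered from 0 in the library: position a stands
   for row, column or coordinate Suc a of the usual numbering from 1. *)

definition bernoulli_symmetric_mat ::
  "'a measure \<Rightarrow> nat \<Rightarrow> (nat \<Rightarrow> nat \<Rightarrow> real) \<Rightarrow> ('a \<Rightarrow> real Matrix.mat) \<Rightarrow> bool" where
  "bernoulli_symmetric_mat M N p X \<longleftrightarrow>
     (\<forall>\<omega>\<in>space M. X \<omega> \<in> carrier_mat N N \<and> transpose_mat (X \<omega>) = X \<omega>) \<and>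
     prob_space.indep_vars M (\<lambda>_. borel) (\<lambda>(a, b) \<omega>. X \<omega> $$ (a, b)) {(a, b). a \<le> b \<and> b < N} \<and>
     (\<forall>a b. a \<le> b \<and> b < N \<longrightarrow>
        distr M borel (\<lambda>\<omega>. X \<omega> $$ (a, b)) =
        distr (measure_pmf (bernoulli_pmf (p (Suc a) (Suc b)))) borel of_bool)"

definition expectation_mat :: "'a measure \<Rightarrow> nat \<Rightarrow> ('a \<Rightarrow> real Matrix.mat) \<Rightarrow> real Matrix.mat" where
  "expectation_mat M N X = Matrix.mat N N (\<lambda>(a, b). \<integral>\<omega>. X \<omega> $$ (a, b) \<partial>M)"

definition evec :: "(nat \<Rightarrow> real \<Rightarrow> real) \<Rightarrow> nat \<Rightarrow> nat \<Rightarrow> real Matrix.vec" where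
  "evec r N i = Matrix.vec N (\<lambda>a. r i (real (Suc a) / real N) / sqrt (real N))"

(* Y N and Z N live on M N; the spaces for different N need not be related. *)
definition little_op ::
  "(nat \<Rightarrow> 'a measure) \<Rightarrow> (nat \<Rightarrow> 'a \<Rightarrow> real) \<Rightarrow> (nat \<Rightarrow> 'a \<Rightarrow> real) \<Rightarrow> bool" where
  "little_op M Y Z \<longleftrightarrow>
     (\<forall>\<delta>>0. (\<lambda>N. measure (M N) {\<omega> \<in> space (M N). \<bar>Y N \<omega>\<bar> > \<delta> * \<bar>Z N \<omega>\<bar>}) \<longlonglongrightarrow> 0)"

end

theory Submission
  imports Defs
begin

text \<open>Write \<tau> = N \<epsilon>(N) for the scale of the eigenvalues outside the bulk, W for the
centred matrix and quad = \<open>e_i' A e_i\<close>. The expectation of A is \<open>\<tau> \<Sum>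
\<theta>_l e_l e_l'\<close> exactly, and the vectors e_l are almost orthonormal because their Gram
matrix consists of Riemann sums which converge to the inner products of the r_l.

The eigenvalue \<open>\<lambda>_i(A)\<close> is a function of independent Bernoulli variables, one
for each edge {a, b}. Flipping an edge changes it by 2 v(a) v(b) to first order, where v is the
unit eigenvector, and changes quad by 2 e_i(a) e_i(b), both halved if a = b. If v is close to e_i
up to sign, then G = \<open>\<lambda>_i(A)\<close> - quad depends very little on any single entry,
and the Efron-Stein inequality gives \<open>Var G \<lesssim> \<epsilon> E \<parallel>v v' - e_i
e_i'\<parallel>^2 + (second-order terms) = o(\<epsilon>)\<close>. By Chebyshev,
\<open>\<lambda>_i(A) = E \<lambda>_i(A) + e_i' W e_i + o_p(\<surd>\<epsilon>)\<close>. Since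
\<open>e_i' W e_i\<close> has variance of order \<epsilon> and \<open>\<tau> \<theta>_i /
\<lambda>_i(A)\<close> tends to 1 in probability, this factor can be put in front of it.

Two properties of the random matrix make this quantitative. The first is that
\<open>\<parallel>W\<parallel> \<le> d \<tau>\<close> for every fixed d > 0 outside an event of
probability O(N^(-3)): on it \<open>\<lambda>_i(A)\<close> is close to \<open>\<tau>
\<theta>_i\<close>, is separated from the other eigenvalues by a multiple of \<tau>, and v is
close to e_i up to sign (locales spiked_matrix and simple_spike). The exceptional event is so rare
that the crude bound 1 for the effect of an edge on an eigenvalue suffices there. The second is
delocalization. The second-order term for an edge is \<open>O((v(a)^2 + v(b)^2) / \<tau>)\<close>,
by second_order_perturbation, and after squaring and summing over all edges it is negligible as
soon as \<open>\<Sum>_a v(a)^4\<close> is much smaller than \<open>\<tau>^2 / N\<close>; in fact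
its expectation on the good event is at most a power of log N divided by N
(expected_fourth_norm_of_eigvec).

Both properties follow from one estimate, noise_power_fourth_moment, of the fourth moment of
\<open>(W^n c)(a)\<close> for a bounded vector c and n of order log N, obtained by counting
quadruples of walks from a. With c an indicator it bounds the entries of W^n, hence the norm of W.
With c = e_l it controls the Neumann series which expresses v through the vectors e_l.

At fixed N only finitely many edge sets occur, so all probability is done with finite weighted
sums (bexp); the locale bernoulli_matrix carries the results over to the given probability spaces.
The parameter d stays fixed while N tends to infinity: the error bound then tends to a multiple of
d^2, and d is arbitrary.\<close>

section \<open>Spectral theorem and min-max bounds for real symmetric matrices\<close>

text \<open>Vectors are functions on the natural numbers of which only the values below N matter, and matrices
are treated alike, because N varies in the limit theorem.\<close>

definition dotp :: "nat \<Rightarrow> (nat \<Rightarrow> real) \<Rightarrow> (nat \<Rightarrow> real) \<Rightarrow> real" where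
  "dotp N x y = (\<Sum>a<N. x a * y a)"

definition vnorm :: "nat \<Rightarrow> (nat \<Rightarrow> real) \<Rightarrow> real" where
  "vnorm N x = sqrt (dotp N x x)"

definition mvec :: "nat \<Rightarrow> (nat \<Rightarrow> nat \<Rightarrow> real) \<Rightarrow> (nat \<Rightarrow> real) \<Rightarrow> nat \<Rightarrow> real" where
  "mvec N H x a = (\<Sum>b<N. H a b * x b)"

definition symm :: "nat \<Rightarrow> (nat \<Rightarrow> nat \<Rightarrow> real) \<Rightarrow> bool" where
  "symm N H \<longleftrightarrow> (\<forall>a<N. \<forall>b<N. H a b = H b a)"

lemma symmI: "(\<And>a b. a < N \<Longrightarrow> b < N \<Longrightarrow> H a b = H b a) \<Longrightarrow> symm N H"
  by (auto simp: symm_def)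

lemma dotp_cong: "(\<And>a. a < N \<Longrightarrow> x a = x' a) \<Longrightarrow> (\<And>a. a < N \<Longrightarrow> y a = y' a) \<Longrightarrow> dotp N x y = dotp N x' y'"
  unfolding dotp_def by (intro sum.cong) auto

lemma dotp_commute: "dotp N x y = dotp N y x"
  by (simp add: dotp_def mult.commute)

lemma dotp_add_left: "dotp N (\<lambda>a. x a + y a) z = dotp N x z + dotp N y z"
  by (simp add: dotp_def algebra_simps sum.distrib)

lemma dotp_add_right: "dotp N z (\<lambda>a. x a + y a) = dotp N z x + dotp N z y"
  by (simp add: dotp_def algebra_simps sum.distrib)

lemma dotp_diff_left: "dotp N (\<lambda>a. x a - y a) z = dotp N x z - dotp N y z"
  by (simp add: dotp_def algebra_simps sum_subtractf)

lemma dotp_diff_right: "dotp N z (\<lambda>a. x a - y a) = dotp N z x - dotp N z y"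
  by (simp add: dotp_def algebra_simps sum_subtractf)

lemma dotp_scale_left: "dotp N (\<lambda>a. c * x a) z = c * dotp N x z"
  by (simp add: dotp_def sum_distrib_left mult.assoc)

lemma dotp_scale_right: "dotp N z (\<lambda>a. c * x a) = c * dotp N z x"
  by (simp add: dotp_def sum_distrib_left algebra_simps)

lemma dotp_sum_left: "dotp N (\<lambda>a. \<Sum>j\<in>J. f j a) z = (\<Sum>j\<in>J. dotp N (f j) z)"
  unfolding dotp_def sum_distrib_right by (rule sum.swap)

lemma dotp_sum_right: "dotp N z (\<lambda>a. \<Sum>j\<in>J. f j a) = (\<Sum>j\<in>J. dotp N z (f j))"
  by (subst (1 2) dotp_commute) (rule dotp_sum_left)

lemmas dotp_linear = dotp_add_left dotp_add_right dotp_diff_left dotp_diff_right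
  dotp_scale_left dotp_scale_right dotp_sum_left dotp_sum_right

lemma dotp_nonneg: "0 \<le> dotp N x x"
  by (simp add: dotp_def sum_nonneg)

lemma dotp_self_eq_0_iff: "dotp N x x = 0 \<longleftrightarrow> (\<forall>a<N. x a = 0)"
  by (auto simp: dotp_def sum_nonneg_eq_0_iff)

lemma vnorm_L2_set: "vnorm N x = L2_set x {..<N}"
  by (simp add: vnorm_def L2_set_def dotp_def power2_eq_square)

lemma vnorm_nonneg [simp]: "0 \<le> vnorm N x"
  by (simp add: vnorm_def dotp_nonneg)

lemma vnorm_square: "(vnorm N x)\<^sup>2 = dotp N x x"
  by (simp add: vnorm_def dotp_nonneg)

lemma vnorm_triangle: "vnorm N (\<lambda>a. x a + y a) \<le> vnorm N x + vnorm N y"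
  by (simp add: vnorm_L2_set L2_set_triangle_ineq)

lemma vnorm_scale: "vnorm N (\<lambda>a. c * x a) = \<bar>c\<bar> * vnorm N x"
proof -
  have "dotp N (\<lambda>a. c * x a) (\<lambda>a. c * x a) = c\<^sup>2 * dotp N x x"
    by (simp add: dotp_linear power2_eq_square)
  then show ?thesis by (simp add: vnorm_def real_sqrt_mult)
qed

lemma vnorm_triangle_diff: "vnorm N (\<lambda>a. x a - y a) \<le> vnorm N x + vnorm N y"
  using vnorm_triangle[of N x "\<lambda>a. - 1 * y a"] vnorm_scale[of N "-1" y] by simp

lemma vnorm_sum: "finite J \<Longrightarrow> vnorm N (\<lambda>a. \<Sum>j\<in>J. f j a) \<le> (\<Sum>j\<in>J. vnorm N (f j))"
proof (induction J rule: finite_induct)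
  case empty
  then show ?case by (simp add: vnorm_def dotp_def)
next
  case (insert x F)
  then show ?case using vnorm_triangle[of N "f x" "\<lambda>a. \<Sum>j\<in>F. f j a"] by simp
qed

lemma dotp_Cauchy_Schwarz: "\<bar>dotp N x y\<bar> \<le> vnorm N x * vnorm N y"
proof -
  have "\<bar>dotp N x y\<bar> \<le> (\<Sum>a<N. \<bar>x a\<bar> * \<bar>y a\<bar>)"
    unfolding dotp_def by (rule order_trans[OF sum_abs]) (simp add: abs_mult)
  then show ?thesis using L2_set_mult_ineq[of x y "{..<N}"] by (simp add: vnorm_L2_set)
qed

lemma vnorm_cong: "(\<And>a. a < N \<Longrightarrow> x a = x' a) \<Longrightarrow> vnorm N x = vnorm N x'"
  unfolding vnorm_def by (metis dotp_cong)

lemma mvec_cong: "(\<And>a. a < N \<Longrightarrow> x a = x' a) \<Longrightarrow> mvec N H x = mvec N H x'"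
  unfolding mvec_def by (auto intro!: ext sum.cong)

lemma mvec_add: "mvec N H (\<lambda>a. x a + y a) = (\<lambda>a. mvec N H x a + mvec N H y a)"
  by (simp add: mvec_def algebra_simps sum.distrib fun_eq_iff)

lemma mvec_diff: "mvec N H (\<lambda>a. x a - y a) = (\<lambda>a. mvec N H x a - mvec N H y a)"
  by (simp add: mvec_def algebra_simps sum_subtractf fun_eq_iff)

lemma mvec_scale: "mvec N H (\<lambda>a. c * x a) = (\<lambda>a. c * mvec N H x a)"
  by (simp add: mvec_def algebra_simps sum_distrib_left fun_eq_iff)

lemma mvec_sum: "mvec N H (\<lambda>a. \<Sum>j\<in>J. f j a) = (\<lambda>a. \<Sum>j\<in>J. mvec N H (f j) a)"
  unfolding mvec_def sum_distrib_left by (rule ext, rule sum.swap)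

lemmas mvec_linear = mvec_add mvec_diff mvec_scale mvec_sum

lemma dotp_mvec_symm:
  assumes "symm N H"
  shows "dotp N (mvec N H x) y = dotp N x (mvec N H y)"
proof -
  have "dotp N (mvec N H x) y = (\<Sum>a<N. \<Sum>b<N. H a b * x b * y a)"
    by (simp add: dotp_def mvec_def sum_distrib_right)
  also have "\<dots> = (\<Sum>b<N. \<Sum>a<N. H a b * x b * y a)" by (rule sum.swap)
  also have "\<dots> = (\<Sum>b<N. \<Sum>a<N. x b * (H b a * y a))"
    using assms by (intro sum.cong refl) (auto simp: symm_def)
  finally show ?thesis by (simp add: dotp_def mvec_def sum_distrib_left)
qed

text \<open>Padding the m < n equations with zero rows gives a singular square matrix.\<close>

lemma homogeneous_system_nontrivial:
  fixes C :: "nat \<Rightarrow> nat \<Rightarrow> real"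
  assumes "m < n"
  shows "\<exists>c. (\<exists>j<n. c j \<noteq> 0) \<and> (\<forall>l<m. (\<Sum>j<n. C l j * c j) = 0)"
proof -
  let ?r = "\<lambda>i. if i = m then 0\<^sub>v n else Matrix.vec n (\<lambda>j. if i < m then C i j else 0)"
  define B where "B = mat\<^sub>r n n ?r"
  have B: "B \<in> carrier_mat n n" unfolding B_def by simp
  have "det B = 0" unfolding B_def by (rule det_row_0[OF assms]) auto
  then obtain v where v: "v \<in> carrier_vec n" "v \<noteq> 0\<^sub>v n" "B *\<^sub>v v = 0\<^sub>v n"
    using det_0_iff_vec_prod_zero[OF B] by blast
  have "\<exists>j<n. v $ j \<noteq> 0"
    using v(1,2) by (metis carrier_vecD eq_vecI index_zero_vec(1) index_zero_vec(2))
  moreover have "(\<Sum>j<n. C l j * v $ j) = 0" if "l < m" for l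
  proof -
    have ln: "l < n" using that assms by simp
    have "(B *\<^sub>v v) $ l = 0" using v(3) ln by simp
    moreover have "(B *\<^sub>v v) $ l = (\<Sum>j<n. C l j * v $ j)"
      using ln that B v(1)
      by (simp add: scalar_prod_def B_def lessThan_atLeast0)
    ultimately show ?thesis by simp
  qed
  ultimately show ?thesis by (intro exI[of _ "\<lambda>j. v $ j"]) auto
qed

text \<open>The first-order condition at a maximum: for small t of the same sign as p the linear term would
win.\<close>

lemma quadratic_le_imp_linear_zero:
  fixes p q :: real
  assumes "\<And>t. 2 * t * p + t\<^sup>2 * q \<le> 0"
  shows "p = 0"
proof (rule ccontr)
  assume p: "p \<noteq> 0"
  \<comment> \<open>The denominator makes the quadratic term smaller than the linear one, also for q = 0.\<close>
  define t where "t = p / (\<bar>q\<bar> + 1)"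
  have q1: "\<bar>q\<bar> + 1 > 0" by linarith
  have pt: "p = t * (\<bar>q\<bar> + 1)" using q1 by (simp add: t_def)
  have eq: "2 * t * p + t\<^sup>2 * q = t\<^sup>2 * (2 * (\<bar>q\<bar> + 1) + q)"
    by (subst pt) (simp add: algebra_simps power2_eq_square)
  have "t \<noteq> 0" using p q1 by (simp add: t_def)
  then have "t\<^sup>2 * (2 * (\<bar>q\<bar> + 1) + q) > 0"
    by (intro mult_pos_pos) (auto simp: abs_if)
  then show False using assms[of t] eq by linarith
qed

text \<open>Freezing the coordinates from N on at 0 turns the constraint set into a closed subset of a product
of compact intervals. It is nonempty because fewer than N linear conditions are imposed.\<close>

lemma constrained_maximizer:
  fixes v :: "nat \<Rightarrow> nat \<Rightarrow> real"
  assumes "m < N"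
  shows "\<exists>x. dotp N x x = 1 \<and> (\<forall>j<m. dotp N x (v j) = 0) \<and>
    (\<forall>y. dotp N y y = 1 \<longrightarrow> (\<forall>j<m. dotp N y (v j) = 0) \<longrightarrow>
       dotp N y (mvec N H y) \<le> dotp N x (mvec N H x))"
proof -
  define B where "B = PiE UNIV (\<lambda>a. if a < N then {-1..1::real} else {0})"
  define S where "S = B \<inter> {x. dotp N x x = 1} \<inter> (\<Inter>j\<in>{..<m}. {x. dotp N x (v j) = 0})"
  have coord: "continuous_on UNIV (\<lambda>x::nat \<Rightarrow> real. x a)" for a
    by (rule continuous_on_product_coordinates)
  have cd: "continuous_on UNIV (\<lambda>x. dotp N x x)" "\<And>j. continuous_on UNIV (\<lambda>x. dotp N x (v j))"
    "continuous_on UNIV (\<lambda>x. dotp N x (mvec N H x))"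
    unfolding dotp_def mvec_def by (intro continuous_intros coord)+
  have "compactin euclidean B"
    unfolding B_def euclidean_product_topology[symmetric]
    by (subst compactin_PiE) (auto simp: compactin_euclidean_iff)
  then have "compact B" by (simp add: compactin_euclidean_iff)
  moreover have "closed {x. dotp N x x = 1}"
    by (rule closed_Collect_eq[OF cd(1) continuous_on_const])
  moreover have "closed (\<Inter>j\<in>{..<m}. {x. dotp N x (v j) = 0})"
    by (intro closed_INT ballI closed_Collect_eq[OF cd(2) continuous_on_const])
  ultimately have cS: "compact S" unfolding S_def by (intro compact_Int_closed)
  have inS: "(\<lambda>a. if a < N then y a else 0) \<in> S"
    if y: "dotp N y y = 1" "\<forall>j<m. dotp N y (v j) = 0" for y
  proof -
    have "\<bar>y a\<bar> \<le> 1" if "a < N" for a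
    proof -
      have "(y a)\<^sup>2 \<le> (\<Sum>a<N. (y a)\<^sup>2)" using that by (intro member_le_sum) auto
      then have "(y a)\<^sup>2 \<le> 1" using y(1) by (simp add: dotp_def power2_eq_square)
      then show ?thesis by (simp add: abs_square_le_1)
    qed
    moreover have "dotp N (\<lambda>a. if a < N then y a else 0) (\<lambda>a. if a < N then y a else 0) = 1"
      by (subst dotp_cong[of N _ y _ y]) (auto simp: y)
    moreover have "dotp N (\<lambda>a. if a < N then y a else 0) (v j) = 0" if "j < m" for j
      by (subst dotp_cong[of N _ y _ "v j"]) (auto simp: y that)
    ultimately show ?thesis by (auto simp: S_def B_def abs_le_iff minus_le_iff)
  qed
  obtain c where c: "\<exists>j<N. c j \<noteq> 0" "\<forall>l<m. (\<Sum>j<N. v l j * c j) = 0"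
    using homogeneous_system_nontrivial[OF assms, of v] by blast
  define n where "n = vnorm N c"
  have n: "n > 0" using c(1) unfolding n_def vnorm_def
    by (metis dotp_nonneg dotp_self_eq_0_iff less_eq_real_def real_sqrt_gt_zero)
  have "dotp N (\<lambda>a. inverse n * c a) (\<lambda>a. inverse n * c a) = 1"
    unfolding dotp_linear vnorm_square[symmetric] n_def[symmetric]
    using n by (simp add: power2_eq_square field_simps)
  moreover have "\<forall>j<m. dotp N (\<lambda>a. inverse n * c a) (v j) = 0"
    using c(2) by (simp only: dotp_linear) (simp add: dotp_def mult.commute)
  ultimately have "S \<noteq> {}" using inS by blast
  then obtain x where x: "x \<in> S" "\<forall>y\<in>S. dotp N y (mvec N H y) \<le> dotp N x (mvec N H x)"
    using continuous_attains_sup[OF cS _ continuous_on_subset[OF cd(3)]] by blast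
  show ?thesis
  proof (intro exI[of _ x] conjI allI impI)
    show "dotp N x x = 1" using x by (auto simp: S_def)
    show "dotp N x (v j) = 0" if "j < m" for j using x that by (auto simp: S_def)
    fix y assume y: "dotp N y y = 1" "\<forall>j<m. dotp N y (v j) = 0"
    let ?y = "\<lambda>a. if a < N then y a else 0"
    have "dotp N ?y (mvec N H ?y) \<le> dotp N x (mvec N H x)" using x(2) inS[OF y] by blast
    moreover have "mvec N H ?y = mvec N H y" by (rule mvec_cong) auto
    moreover have "dotp N ?y (mvec N H y) = dotp N y (mvec N H y)" by (rule dotp_cong) auto
    ultimately show "dotp N y (mvec N H y) \<le> dotp N x (mvec N H x)" by simp
  qed
qed

text \<open>By stationarity of the Rayleigh quotient, H x is orthogonal to every vector that is orthogonal to
x and to all v j. The residual z = H x - l x, where l is the maximum, is such a vector: it is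
orthogonal to the v j because they are eigenvectors of a symmetric matrix, and to x by the choice
of l. Hence z is orthogonal to H x and to x, and so to itself.\<close>

lemma constrained_maximizer_eigenvector:
  assumes H: "symm N H"
    and eig: "\<And>j. j < m \<Longrightarrow> \<forall>a<N. mvec N H (v j) a = lam j * v j a"
    and x: "dotp N x x = 1" "\<And>j. j < m \<Longrightarrow> dotp N x (v j) = 0"
    and max: "\<And>y. dotp N y y = 1 \<Longrightarrow> (\<forall>j<m. dotp N y (v j) = 0) \<Longrightarrow>
       dotp N y (mvec N H y) \<le> dotp N x (mvec N H x)"
  shows "\<forall>a<N. mvec N H x a = dotp N x (mvec N H x) * x a"
proof -
  define l where "l = dotp N x (mvec N H x)"
  have maxg: "dotp N y (mvec N H y) \<le> l * dotp N y y" if y: "\<forall>j<m. dotp N y (v j) = 0" for y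
  proof (cases "dotp N y y = 0")
    case True
    then have "dotp N y (mvec N H y) = 0" by (simp add: dotp_self_eq_0_iff) (simp add: dotp_def)
    then show ?thesis using True by simp
  next
    case False
    define n where "n = vnorm N y"
    have n: "n > 0" "n\<^sup>2 = dotp N y y" using False
      by (auto simp: n_def vnorm_square) (metis False dotp_nonneg less_eq_real_def real_sqrt_gt_zero vnorm_def)
    let ?y = "\<lambda>a. inverse n * y a"
    have "dotp N ?y ?y = 1" unfolding dotp_linear n(2)[symmetric] using n(1) by (simp add: power2_eq_square field_simps)
    moreover have "\<forall>j<m. dotp N ?y (v j) = 0" using y by (simp add: dotp_linear)
    ultimately have "dotp N ?y (mvec N H ?y) \<le> l" using max unfolding l_def by blast
    then have "inverse n * inverse n * dotp N y (mvec N H y) \<le> l"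
      by (simp only: dotp_linear mvec_linear mult.assoc)
    then show ?thesis unfolding n(2)[symmetric] using n(1) by (simp add: field_simps power2_eq_square)
  qed
  have orth: "dotp N y (mvec N H x) = 0" if y: "\<forall>j<m. dotp N y (v j) = 0" "dotp N y x = 0" for y
  proof (rule quadratic_le_imp_linear_zero)
    fix t :: real
    let ?z = "\<lambda>a. x a + t * y a"
    have "dotp N ?z (mvec N H ?z) \<le> l * dotp N ?z ?z"
      by (rule maxg) (use x y in \<open>simp add: dotp_linear\<close>)
    moreover have "dotp N ?z ?z = 1 + t\<^sup>2 * dotp N y y"
      using x y by (simp add: dotp_linear dotp_commute[of N x y] power2_eq_square)
    moreover have "dotp N ?z (mvec N H ?z) =
      l + 2 * t * dotp N y (mvec N H x) + t\<^sup>2 * dotp N y (mvec N H y)"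
      using dotp_mvec_symm[OF H, of x y]
      by (simp add: dotp_linear mvec_linear l_def power2_eq_square dotp_commute[of N "mvec N H x" y] algebra_simps)
    ultimately show "2 * t * dotp N y (mvec N H x) + t\<^sup>2 * (dotp N y (mvec N H y) - l * dotp N y y) \<le> 0"
      by (simp add: algebra_simps)
  qed
  define z where "z = (\<lambda>a. mvec N H x a - l * x a)"
  have zv: "dotp N z (v j) = 0" if "j < m" for j
  proof -
    have "dotp N (mvec N H x) (v j) = dotp N x (mvec N H (v j))" by (rule dotp_mvec_symm[OF H])
    also have "\<dots> = dotp N x (\<lambda>a. lam j * v j a)" using eig[OF that] by (intro dotp_cong) auto
    also have "\<dots> = 0" using x(2)[OF that] by (simp add: dotp_linear)
    finally show ?thesis using x(2)[OF that] by (simp add: z_def dotp_linear)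
  qed
  have zx: "dotp N z x = 0"
    using x(1) by (simp add: z_def dotp_linear l_def dotp_commute[of N "mvec N H x" x])
  have "dotp N z z = dotp N z (mvec N H x) - l * dotp N z x"
    by (subst (2) z_def) (simp add: dotp_linear)
  also have "\<dots> = 0" using orth[of z] zv zx by simp
  finally show ?thesis by (simp add: dotp_self_eq_0_iff z_def l_def)
qed

text \<open>The length m may be smaller than N: an eigenbasis is built one vector at a time, from the largest
eigenvalue down.\<close>

definition eigenbasis :: "nat \<Rightarrow> (nat \<Rightarrow> nat \<Rightarrow> real) \<Rightarrow> nat \<Rightarrow> (nat \<Rightarrow> real) \<Rightarrow> (nat \<Rightarrow> nat \<Rightarrow> real) \<Rightarrow> bool" where
  "eigenbasis N H m lam v \<longleftrightarrow>
     (\<forall>i<m. \<forall>j<m. dotp N (v i) (v j) = (if i = j then 1 else 0)) \<and>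
     (\<forall>j<m. \<forall>a<N. mvec N H (v j) a = lam j * v j a) \<and>
     (\<forall>i<m. \<forall>j<m. i \<le> j \<longrightarrow> lam j \<le> lam i)"

text \<open>Each new eigenvalue is a maximum of the Rayleigh quotient over a smaller set than the one before,
so the eigenvalues come out in decreasing order.\<close>

lemma eigenbasis_exists:
  assumes H: "symm N H"
  shows "\<exists>lam v. eigenbasis N H N lam v"
proof -
  have "\<exists>lam v. eigenbasis N H m lam v \<and>
     (\<forall>y. dotp N y y = 1 \<longrightarrow> (\<forall>j<m-1. dotp N y (v j) = 0) \<longrightarrow> m > 0 \<longrightarrow>
        dotp N y (mvec N H y) \<le> lam (m-1))" if "m \<le> N" for m
    using that
  proof (induction m)
    case 0
    then show ?case by (auto simp: eigenbasis_def)
  next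
    case (Suc m)
    then obtain lam v where E: "eigenbasis N H m lam v"
      and M: "\<And>y. dotp N y y = 1 \<Longrightarrow> \<forall>j<m-1. dotp N y (v j) = 0 \<Longrightarrow> m > 0 \<Longrightarrow>
        dotp N y (mvec N H y) \<le> lam (m-1)" by auto
    obtain x where x: "dotp N x x = 1" "\<And>j. j < m \<Longrightarrow> dotp N x (v j) = 0"
      and mx: "\<And>y. dotp N y y = 1 \<Longrightarrow> (\<forall>j<m. dotp N y (v j) = 0) \<Longrightarrow>
       dotp N y (mvec N H y) \<le> dotp N x (mvec N H x)"
      using constrained_maximizer[of m N v H] Suc.prems by auto
    define l where "l = dotp N x (mvec N H x)"
    have eig: "\<forall>a<N. mvec N H x a = l * x a" unfolding l_def
      by (rule constrained_maximizer_eigenvector[OF H _ x mx]) (use E in \<open>auto simp: eigenbasis_def\<close>)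
    have lm: "l \<le> lam i" if "i < m" for i
    proof -
      have "l \<le> lam (m-1)" unfolding l_def using x that by (intro M) auto
      also have "\<dots> \<le> lam i" using E that by (auto simp: eigenbasis_def)
      finally show ?thesis .
    qed
    have "eigenbasis N H (Suc m) (lam(m := l)) (v(m := x))"
      using E eig x lm by (auto simp: eigenbasis_def less_Suc_eq dotp_commute[of N "v _" x])
    moreover have "dotp N y (mvec N H y) \<le> (lam(m := l)) (Suc m - 1)"
      if "dotp N y y = 1" "\<forall>j<Suc m-1. dotp N y ((v(m := x)) j) = 0" for y
      using mx[of y] that by (auto simp: l_def)
    ultimately show ?case by blast
  qed
  from this[of N] show ?thesis by blast
qed

definition eig :: "nat \<Rightarrow> (nat \<Rightarrow> nat \<Rightarrow> real) \<Rightarrow> nat \<Rightarrow> real" where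
  "eig N H i = eigval i (Matrix.mat N N (\<lambda>(a, b). H a b))"

lemma eigenbasis_similar:
  assumes E: "eigenbasis N H N lam v"
  defines "V \<equiv> Matrix.mat N N (\<lambda>(a, j). v j a)"
    and "D \<equiv> Matrix.mat N N (\<lambda>(a, b). if a = b then lam a else 0)"
    and "B \<equiv> Matrix.mat N N (\<lambda>(a, b). H a b)"
  shows "V\<^sup>T * V = 1\<^sub>m N" "V * V\<^sup>T = 1\<^sub>m N" "B = V * D * V\<^sup>T"
proof -
  have [simp]: "V \<in> carrier_mat N N" "D \<in> carrier_mat N N" "B \<in> carrier_mat N N"
    "V\<^sup>T \<in> carrier_mat N N"
    by (auto simp: V_def D_def B_def)
  show VV: "V\<^sup>T * V = 1\<^sub>m N"
    by (rule eq_matI) (use E in \<open>auto simp: V_def scalar_prod_def eigenbasis_def dotp_def lessThan_atLeast0\<close>)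
  show VV': "V * V\<^sup>T = 1\<^sub>m N"
    by (rule mat_mult_left_right_inverse[OF _ _ VV]) auto
  have BV: "B * V = V * D"
  proof (rule eq_matI)
    fix a j assume aj: "a < dim_row (V * D)" "j < dim_col (V * D)"
    then have aj': "a < N" "j < N" by (auto simp: V_def D_def)
    have "(B * V) $$ (a, j) = mvec N H (v j) a"
      using aj' by (simp add: B_def V_def scalar_prod_def mvec_def lessThan_atLeast0)
    also have "\<dots> = lam j * v j a" using E aj' by (auto simp: eigenbasis_def)
    also have "\<dots> = (V * D) $$ (a, j)"
      using aj' by (simp add: V_def D_def scalar_prod_def if_distrib cong: if_cong)
    finally show "(B * V) $$ (a, j) = (V * D) $$ (a, j)" .
  qed (auto simp: B_def V_def D_def)
  have "B = B * (V * V\<^sup>T)" unfolding VV' by (rule right_mult_one_mat[symmetric, of _ N]) simp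
  also have "\<dots> = B * V * V\<^sup>T" by (rule assoc_mult_mat[symmetric, of _ N N _ N _ N]) auto
  finally show "B = V * D * V\<^sup>T" by (simp add: BV)
qed

text \<open>The eigenvectors conjugate H to the diagonal matrix with entries lam, so lam lists the roots of
the characteristic polynomial with multiplicity, and in the order that eigval uses.\<close>

lemma eig_eigenbasis:
  assumes E: "eigenbasis N H N lam v" and i: "1 \<le> i" "i \<le> N"
  shows "eig N H i = lam (i - 1)"
proof -
  define V where "V = Matrix.mat N N (\<lambda>(a, j). v j a)"
  define D where "D = Matrix.mat N N (\<lambda>(a, b). if a = b then lam a else 0)"
  define B where "B = Matrix.mat N N (\<lambda>(a, b). H a b)"
  note sim = eigenbasis_similar[OF E, folded V_def D_def B_def]
  have "similar_mat_wit B D V V\<^sup>T"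
    unfolding similar_mat_wit_def Let_def using sim by (auto simp: V_def D_def B_def)
  then have "similar_mat B D" unfolding similar_mat_def by blast
  then have "char_poly B = char_poly D" by (rule char_poly_similar)
  also have "\<dots> = (\<Prod>a \<leftarrow> diag_mat D. [:- a, 1:])"
    by (rule char_poly_upper_triangular[of _ N]) (auto simp: D_def upper_triangular_def)
  also have "diag_mat D = map lam [0..<N]"
    by (auto simp: diag_mat_def D_def)
  finally have cp: "char_poly B = (\<Prod>a \<leftarrow> map lam [0..<N]. [:- a, 1:])" .
  have "proots (\<Prod>a \<leftarrow> xs. [:- a, 1:]) = mset xs" for xs :: "real list"
  proof (induction xs)
    case (Cons a xs)
    have "(\<Prod>a \<leftarrow> xs. [:- a, 1:]) \<noteq> (0 :: real poly)" by (auto simp: prod_list_zero_iff)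
    then have "proots ([:- a, 1:] * (\<Prod>a \<leftarrow> xs. [:- a, 1:])) = proots [:- a, 1:] + proots (\<Prod>a \<leftarrow> xs. [:- a, 1:])"
      by (intro proots_mult) auto
    then show ?case using Cons by simp
  qed simp
  then have "proots (char_poly B) = mset (map lam [0..<N])" unfolding cp by blast
  also have "\<dots> = mset (rev (map lam [0..<N]))" by simp
  finally have pr: "proots (char_poly B) = mset (rev (map lam [0..<N]))" .
  have "sorted_wrt (\<ge>) (map lam [0..<N])"
    unfolding sorted_wrt_iff_nth_less using E by (auto simp: eigenbasis_def)
  then have "sorted (rev (map lam [0..<N]))" by (simp add: sorted_wrt_rev)
  then have "sorted_list_of_multiset (proots (char_poly B)) = rev (map lam [0..<N])"
    by (simp only: pr sorted_list_of_multiset_mset sorted_sort_id)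
  then show ?thesis using i unfolding eig_def eigval_def B_def[symmetric] by simp
qed

text \<open>A right inverse of a square matrix is a left inverse, so orthonormality of the columns passes to
the rows.\<close>

lemma eigenbasis_complete:
  assumes E: "eigenbasis N H N lam v" and ab: "a < N" "b < N"
  shows "(\<Sum>j<N. v j a * v j b) = (if a = b then 1 else 0)"
proof -
  define V where "V = Matrix.mat N N (\<lambda>(a, j). v j a)"
  have "(V * V\<^sup>T) $$ (a, b) = (1\<^sub>m N) $$ (a, b)"
    unfolding V_def using eigenbasis_similar(2)[OF E] by simp
  then show ?thesis using ab by (simp add: V_def scalar_prod_def lessThan_atLeast0)
qed

lemma eigenbasis_expand:
  assumes E: "eigenbasis N H N lam v" and a: "a < N"
  shows "x a = (\<Sum>j<N. dotp N (v j) x * v j a)"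
proof -
  have "(\<Sum>j<N. dotp N (v j) x * v j a) = (\<Sum>j<N. \<Sum>b<N. v j b * x b * v j a)"
    by (simp add: dotp_def sum_distrib_right)
  also have "\<dots> = (\<Sum>b<N. x b * (\<Sum>j<N. v j a * v j b))"
    by (subst sum.swap) (simp add: sum_distrib_left algebra_simps)
  also have "\<dots> = (\<Sum>b<N. x b * (if a = b then 1 else 0))"
    using eigenbasis_complete[OF E a] by (intro sum.cong) auto
  also have "\<dots> = x a" using a by (simp add: if_distrib cong: if_cong)
  finally show ?thesis by simp
qed

lemma eigenbasis_parseval:
  assumes E: "eigenbasis N H N lam v"
  shows "dotp N x y = (\<Sum>j<N. dotp N (v j) x * dotp N (v j) y)"
proof -
  have "dotp N x y = dotp N (\<lambda>a. \<Sum>j<N. dotp N (v j) x * v j a) y"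
    by (rule dotp_cong) (auto simp: eigenbasis_expand[OF E, symmetric])
  then show ?thesis by (simp add: dotp_linear)
qed

lemma eigenbasis_coeff_mvec:
  assumes H: "symm N H" and E: "eigenbasis N H N lam v" and "j < N"
  shows "dotp N (v j) (mvec N H x) = lam j * dotp N (v j) x"
proof -
  have "dotp N (v j) (mvec N H x) = dotp N (mvec N H (v j)) x" by (rule dotp_mvec_symm[OF H, symmetric])
  also have "\<dots> = dotp N (\<lambda>a. lam j * v j a) x" using E assms(3) by (intro dotp_cong) (auto simp: eigenbasis_def)
  finally show ?thesis by (simp add: dotp_linear)
qed

text \<open>Upper half of the min-max principle: i - 1 linear conditions cannot exclude every nonzero
combination of the i leading eigenvectors, and the Rayleigh quotient of such a combination is at
least the i-th eigenvalue.\<close>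

lemma eig_le:
  assumes H: "symm N H" and i: "1 \<le> i" "i \<le> N"
    and w: "\<And>x. (\<forall>j<i-1. dotp N (w j) x = 0) \<Longrightarrow> dotp N x (mvec N H x) \<le> t * dotp N x x"
  shows "eig N H i \<le> t"
proof -
  obtain lam v where E: "eigenbasis N H N lam v" using eigenbasis_exists[OF H] by blast
  have orth: "dotp N (v p) (v q) = (if p = q then 1 else 0)" if "p < N" "q < N" for p q
    using E that by (auto simp: eigenbasis_def)
  obtain c where c: "\<exists>j<i. c j \<noteq> 0" "\<forall>l<i-1. (\<Sum>j<i. dotp N (w l) (v j) * c j) = 0"
    using homogeneous_system_nontrivial[of "i-1" i "\<lambda>l j. dotp N (w l) (v j)"] i by auto
  define x where "x = (\<lambda>a. \<Sum>j<i. c j * v j a)"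
  have "\<forall>l<i-1. dotp N (w l) x = 0" using c(2) by (simp add: x_def dotp_linear mult.commute)
  then have upper: "dotp N x (mvec N H x) \<le> t * dotp N x x" by (rule w)
  have cf: "dotp N (v j) x = (if j < i then c j else 0)" if "j < N" for j
  proof -
    have "dotp N (v j) x = (\<Sum>l<i. c l * (if j = l then 1 else 0))"
      unfolding x_def dotp_linear using that i by (intro sum.cong) (auto simp: orth)
    then show ?thesis by (simp add: if_distrib cong: if_cong)
  qed
  have sub: "(\<Sum>j<N. (if j < i then f j else 0)) = (\<Sum>j<i. f j)" for f :: "nat \<Rightarrow> real"
  proof -
    have "(\<Sum>j<N. (if j < i then f j else 0)) = (\<Sum>j\<in>{..<N} \<inter> {j. j < i}. f j)"
      by (simp add: sum.inter_restrict)
    also have "{..<N} \<inter> {j. j < i} = {..<i}" using i by auto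
    finally show ?thesis .
  qed
  have xx: "dotp N x x = (\<Sum>j<i. (c j)\<^sup>2)"
    unfolding eigenbasis_parseval[OF E, of x x] sub[symmetric]
    by (intro sum.cong) (auto simp: cf power2_eq_square)
  have "dotp N x (mvec N H x) = (\<Sum>j<i. lam j * (c j)\<^sup>2)"
    unfolding eigenbasis_parseval[OF E, of x "mvec N H x"] sub[symmetric]
    by (intro sum.cong) (auto simp: cf power2_eq_square eigenbasis_coeff_mvec[OF H E])
  also have "\<dots> \<ge> (\<Sum>j<i. lam (i-1) * (c j)\<^sup>2)"
    using E i by (intro sum_mono mult_right_mono) (auto simp: eigenbasis_def)
  finally have lower: "dotp N x (mvec N H x) \<ge> lam (i-1) * dotp N x x"
    by (simp only: xx sum_distrib_left)
  have "dotp N x x > 0"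
  proof -
    obtain j where "j < i" "c j \<noteq> 0" using c(1) by blast
    then show ?thesis unfolding xx by (intro sum_pos2[of "{..<i}" j]) auto
  qed
  moreover have "lam (i-1) * dotp N x x \<le> t * dotp N x x" using upper lower by linarith
  ultimately have "lam (i-1) \<le> t" by (rule mult_right_le_imp_le[rotated])
  then show ?thesis using eig_eigenbasis[OF E i] by simp
qed

lemma eigenbasis_rayleigh_le:
  assumes H: "symm N H" and E: "eigenbasis N H N lam v" and i: "1 \<le> i" "i \<le> N"
    and vx: "\<And>l. l < i - 1 \<Longrightarrow> dotp N (v l) x = 0"
  shows "dotp N x (mvec N H x) \<le> lam (i-1) * dotp N x x"
proof -
  have "dotp N x (mvec N H x) = (\<Sum>j<N. lam j * (dotp N (v j) x)\<^sup>2)"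
    unfolding eigenbasis_parseval[OF E, of x "mvec N H x"]
    by (intro sum.cong) (auto simp: power2_eq_square eigenbasis_coeff_mvec[OF H E])
  also have "\<dots> \<le> (\<Sum>j<N. lam (i-1) * (dotp N (v j) x)\<^sup>2)"
  proof (rule sum_mono)
    fix j assume j: "j \<in> {..<N}"
    show "lam j * (dotp N (v j) x)\<^sup>2 \<le> lam (i-1) * (dotp N (v j) x)\<^sup>2"
    proof (cases "j < i - 1")
      case True
      then show ?thesis by (simp add: vx)
    next
      case False
      then have "lam j \<le> lam (i-1)" using E i j by (auto simp: eigenbasis_def)
      then show ?thesis by (intro mult_right_mono) auto
    qed
  qed
  also have "\<dots> = lam (i-1) * dotp N x x"
    by (simp add: eigenbasis_parseval[OF E, of x x] sum_distrib_left power2_eq_square)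
  finally show ?thesis .
qed

text \<open>Lower half of the min-max principle: an i-dimensional span contains a nonzero vector orthogonal to
the i - 1 leading eigenvectors, where the Rayleigh quotient is at most the i-th eigenvalue.\<close>

lemma eig_ge:
  assumes H: "symm N H" and i: "1 \<le> i" "i \<le> N"
    and u: "\<And>c. dotp N (\<lambda>a. \<Sum>j<i. c j * u j a) (mvec N H (\<lambda>a. \<Sum>j<i. c j * u j a)) \<ge>
               t * dotp N (\<lambda>a. \<Sum>j<i. c j * u j a) (\<lambda>a. \<Sum>j<i. c j * u j a)"
    and indep: "\<And>c. dotp N (\<lambda>a. \<Sum>j<i. c j * u j a) (\<lambda>a. \<Sum>j<i. c j * u j a) = 0 \<Longrightarrow> \<forall>j<i. c j = 0"
  shows "t \<le> eig N H i"
proof -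
  obtain lam v where E: "eigenbasis N H N lam v" using eigenbasis_exists[OF H] by blast
  obtain c where c: "\<exists>j<i. c j \<noteq> 0" "\<forall>l<i-1. (\<Sum>j<i. dotp N (v l) (u j) * c j) = 0"
    using homogeneous_system_nontrivial[of "i-1" i "\<lambda>l j. dotp N (v l) (u j)"] i by auto
  define x where "x = (\<lambda>a. \<Sum>j<i. c j * u j a)"
  have vx: "dotp N (v l) x = 0" if "l < i-1" for l
  proof -
    have "dotp N (v l) x = (\<Sum>j<i. dotp N (v l) (u j) * c j)"
      by (simp only: x_def dotp_sum_right dotp_scale_right mult.commute)
    then show ?thesis using c(2) that by simp
  qed
  have "dotp N x (mvec N H x) \<le> lam (i-1) * dotp N x x"
    using vx i by (intro eigenbasis_rayleigh_le[OF H E]) auto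
  then have "t * dotp N x x \<le> lam (i-1) * dotp N x x" using u[of c, folded x_def] by (rule order_trans[rotated])
  moreover have "dotp N x x > 0"
  proof -
    have "dotp N x x \<noteq> 0" using indep[of c, folded x_def] c(1) by blast
    then show ?thesis using dotp_nonneg[of N x] by linarith
  qed
  ultimately have "t \<le> lam (i-1)" by (rule mult_right_le_imp_le)
  then show ?thesis using eig_eigenbasis[OF E i] by simp
qed

lemma eig_le_eig_add:
  assumes H: "symm N H" and H': "symm N H'" and i: "1 \<le> i" "i \<le> N"
    and D: "\<And>x. dotp N x (mvec N H' x) \<le> dotp N x (mvec N H x) + s * dotp N x x"
  shows "eig N H' i \<le> eig N H i + s"
proof -
  obtain lam v where E: "eigenbasis N H N lam v" using eigenbasis_exists[OF H] by blast
  show ?thesis unfolding eig_eigenbasis[OF E i]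
  proof (rule eig_le[OF H' i, of v])
    fix x assume "\<forall>j<i - 1. dotp N (v j) x = 0"
    then have "dotp N x (mvec N H x) \<le> lam (i-1) * dotp N x x"
      by (intro eigenbasis_rayleigh_le[OF H E i]) auto
    then show "dotp N x (mvec N H' x) \<le> (lam (i-1) + s) * dotp N x x"
      using D[of x] by (simp add: algebra_simps)
  qed
qed

section \<open>Perturbation of a simple eigenvalue\<close>

lemma mvec_matrix_add:
  assumes "\<And>a b. a < N \<Longrightarrow> b < N \<Longrightarrow> H' a b = H a b + D a b" "a < N"
  shows "mvec N H' x a = mvec N H x a + mvec N D x a"
  using assms by (simp add: mvec_def algebra_simps sum.distrib flip: sum.distrib)

lemma dotp_le_vnorm_bound:
  assumes "vnorm N (mvec N D x) \<le> s * vnorm N x"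
  shows "\<bar>dotp N x (mvec N D x)\<bar> \<le> s * dotp N x x"
proof -
  have "\<bar>dotp N x (mvec N D x)\<bar> \<le> vnorm N x * vnorm N (mvec N D x)" by (rule dotp_Cauchy_Schwarz)
  also have "\<dots> \<le> vnorm N x * (s * vnorm N x)" using assms by (intro mult_left_mono) auto
  also have "\<dots> = s * dotp N x x" by (simp add: vnorm_square[symmetric] power2_eq_square)
  finally show ?thesis .
qed

lemma dotp_mvec_matrix_add:
  assumes "\<And>a b. a < N \<Longrightarrow> b < N \<Longrightarrow> H' a b = H a b + D a b"
  shows "dotp N y (mvec N H' x) = dotp N y (mvec N H x) + dotp N y (mvec N D x)"
proof -
  have "dotp N y (mvec N H' x) = dotp N y (\<lambda>a. mvec N H x a + mvec N D x a)"
    using mvec_matrix_add[OF assms] by (intro dotp_cong) auto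
  then show ?thesis by (simp add: dotp_linear)
qed

text \<open>By the min-max principle, an eigenvalue moves no more than the quadratic form does.\<close>

lemma weyl_perturbation:
  assumes H: "symm N H" and H': "symm N H'" and i: "1 \<le> i" "i \<le> N"
    and D: "\<And>a b. a < N \<Longrightarrow> b < N \<Longrightarrow> H' a b = H a b + D a b"
    and s: "\<And>x. vnorm N (mvec N D x) \<le> s * vnorm N x"
  shows "\<bar>eig N H' i - eig N H i\<bar> \<le> s"
proof -
  have b: "\<bar>dotp N x (mvec N D x)\<bar> \<le> s * dotp N x x" for x
    by (rule dotp_le_vnorm_bound[OF s])
  have b': "dotp N x (mvec N H' x) \<le> dotp N x (mvec N H x) + s * dotp N x x"
    "dotp N x (mvec N H x) \<le> dotp N x (mvec N H' x) + s * dotp N x x" for x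
    using b[of x] by (simp_all add: dotp_mvec_matrix_add[OF D])
  show ?thesis
    using eig_le_eig_add[OF H H' i b'(1)] eig_le_eig_add[OF H' H i b'(2)] by linarith
qed

definition unit_eigvec :: "nat \<Rightarrow> (nat \<Rightarrow> nat \<Rightarrow> real) \<Rightarrow> real \<Rightarrow> (nat \<Rightarrow> real) \<Rightarrow> bool" where
  "unit_eigvec N H l v \<longleftrightarrow> dotp N v v = 1 \<and> (\<forall>a<N. mvec N H v a = l * v a)"

lemma unit_eigvec_exists:
  assumes "symm N H" "1 \<le> i" "i \<le> N"
  shows "\<exists>v. unit_eigvec N H (eig N H i) v"
proof -
  obtain lam v where E: "eigenbasis N H N lam v" using eigenbasis_exists[OF assms(1)] by blast
  then have "unit_eigvec N H (eig N H i) (v (i - 1))"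
    using assms eig_eigenbasis[OF E assms(2,3)] by (auto simp: unit_eigvec_def eigenbasis_def)
  then show ?thesis by blast
qed

text \<open>Pairing (H + D) w = l' w with v gives l' - l = <v, D w> / <v, w>. Write w = c v + x with x
orthogonal to v. Then the first-order term <v, D v> is met up to the error <D v, x> / c, and the
gap of H, applied to the equation that x satisfies, yields (G - 2) |x| \<le> |c| |D v|. The 2 lost
from the gap consists of |l' - l| \<le> 1 and |D| \<le> 1.\<close>

lemma second_order_perturbation:
  assumes H: "symm N H" and H': "symm N H'" and i: "1 \<le> i" "i \<le> N"
    and D: "\<And>a b. a < N \<Longrightarrow> b < N \<Longrightarrow> H' a b = H a b + D a b"
    and D1: "\<And>x. vnorm N (mvec N D x) \<le> vnorm N x"
    and v: "unit_eigvec N H (eig N H i) v"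
    and gap: "\<And>x. dotp N v x = 0 \<Longrightarrow> G * vnorm N x \<le> vnorm N (\<lambda>a. mvec N H x a - eig N H i * x a)"
    and G: "G > 2"
  shows "\<bar>eig N H' i - eig N H i - dotp N v (mvec N D v)\<bar> \<le> dotp N (mvec N D v) (mvec N D v) / (G - 2)"
proof -
  define l l' where "l = eig N H i" and "l' = eig N H' i"
  obtain w where w: "unit_eigvec N H' l' w" using unit_eigvec_exists[OF H' i] unfolding l'_def by blast
  define c where "c = dotp N v w"
  define x where "x = (\<lambda>a. w a - c * v a)"
  have vv: "dotp N v v = 1" and Hv: "\<And>a. a < N \<Longrightarrow> mvec N H v a = l * v a"
    using v by (auto simp: unit_eigvec_def l_def)
  have ww: "dotp N w w = 1" and Hw: "\<And>a. a < N \<Longrightarrow> mvec N H' w a = l' * w a"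
    using w by (auto simp: unit_eigvec_def)
  have nv: "vnorm N v = 1" "vnorm N w = 1" using vv ww by (simp_all add: vnorm_def)
  have vx: "dotp N v x = 0" by (simp add: x_def dotp_linear vv c_def)
  have w_eq: "w = (\<lambda>a. c * v a + x a)" by (simp add: x_def)
  have ll: "\<bar>l' - l\<bar> \<le> 1"
    unfolding l_def l'_def by (rule weyl_perturbation[OF H H' i D]) (use D1 in auto)
  define Dv where "Dv = mvec N D v"
  define Dw where "Dw = mvec N D w"
  have eqw: "mvec N H w a + Dw a = l' * w a" if "a < N" for a
    using Hw[OF that] mvec_matrix_add[OF D that, where x = w] by (simp add: Dw_def)
  have Dw: "Dw a = c * Dv a + mvec N D x a" for a
    unfolding Dw_def Dv_def by (subst w_eq) (simp add: mvec_linear)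
  have Hx: "mvec N H x a - l * x a = (l' - l) * w a - Dw a" if "a < N" for a
    using eqw[OF that] Hv[OF that] by (simp add: x_def mvec_linear algebra_simps)
  define z where "z = (\<lambda>a. mvec N H x a - l * x a)"
  have vz: "dotp N v z = 0"
  proof -
    have "dotp N v (mvec N H x) = dotp N (mvec N H v) x" by (rule dotp_mvec_symm[OF H, symmetric])
    also have "\<dots> = dotp N (\<lambda>a. l * v a) x" using Hv by (intro dotp_cong) auto
    finally show ?thesis by (simp add: z_def dotp_linear vx)
  qed
  have z_eq: "z a = c * ((l' - l) * v a - Dv a) + ((l' - l) * x a - mvec N D x a)" if "a < N" for a
    unfolding z_def Hx[OF that] by (simp add: Dw w_eq algebra_simps)
  have zz: "dotp N z z = dotp N z (\<lambda>a. ((l' - l) * x a - c * Dv a) - mvec N D x a)"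
  proof -
    have "dotp N z z = dotp N z (\<lambda>a. c * (l' - l) * v a + (((l' - l) * x a - c * Dv a) - mvec N D x a))"
      by (intro dotp_cong) (simp_all add: z_eq algebra_simps)
    then show ?thesis by (simp add: dotp_linear dotp_commute[of N z v] vz)
  qed
  \<comment> \<open>By zz only the part of z orthogonal to v counts, which removes the term (l' - l) v.\<close>
  have nz: "vnorm N z \<le> 2 * vnorm N x + \<bar>c\<bar> * vnorm N Dv"
  proof -
    let ?y = "\<lambda>a. ((l' - l) * x a - c * Dv a) - mvec N D x a"
    have "vnorm N z * vnorm N z \<le> vnorm N z * vnorm N ?y"
      using dotp_Cauchy_Schwarz[of N z ?y] zz vnorm_square[of N z] by (simp add: power2_eq_square)
    then have "vnorm N z \<le> vnorm N ?y"
      using vnorm_nonneg[of N z] vnorm_nonneg[of N ?y] by (cases "vnorm N z = 0") auto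
    also have "\<dots> \<le> vnorm N (\<lambda>a. (l' - l) * x a - c * Dv a) + vnorm N (mvec N D x)"
      by (rule vnorm_triangle_diff)
    also have "vnorm N (\<lambda>a. (l' - l) * x a - c * Dv a) \<le> \<bar>l' - l\<bar> * vnorm N x + \<bar>c\<bar> * vnorm N Dv"
      using vnorm_triangle_diff[of N "\<lambda>a. (l' - l) * x a" "\<lambda>a. c * Dv a"] by (simp add: vnorm_scale)
    also have "\<bar>l' - l\<bar> * vnorm N x \<le> 1 * vnorm N x" using ll by (intro mult_right_mono) auto
    finally show ?thesis using D1[of x] by simp
  qed
  have "G * vnorm N x \<le> vnorm N z" unfolding z_def l_def by (rule gap[OF vx])
  with nz have nx: "(G - 2) * vnorm N x \<le> \<bar>c\<bar> * vnorm N Dv" by (simp add: algebra_simps)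
  \<comment> \<open>If w were orthogonal to v, it would be x, and nx would force x = 0.\<close>
  have c0: "c \<noteq> 0"
  proof
    assume "c = 0"
    then have "(G - 2) * vnorm N x \<le> 0" using nx by simp
    moreover have "vnorm N x = 1" using \<open>c = 0\<close> nv by (simp add: x_def)
    ultimately show False using G by simp
  qed
  have "dotp N v (\<lambda>a. mvec N H w a + Dw a) = dotp N v (\<lambda>a. l' * w a)"
    using eqw by (intro dotp_cong) auto
  moreover have "dotp N v (mvec N H w) = l * c"
  proof -
    have "dotp N v (mvec N H w) = dotp N (mvec N H v) w" by (rule dotp_mvec_symm[OF H, symmetric])
    also have "\<dots> = dotp N (\<lambda>a. l * v a) w" using Hv by (intro dotp_cong) auto
    finally show ?thesis by (simp add: dotp_linear c_def)
  qed
  moreover have "dotp N v Dw = c * dotp N v Dv + dotp N Dv x"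
  proof -
    have symD: "symm N D"
    proof (rule symmI)
      fix a b assume "a < N" "b < N"
      then show "D a b = D b a" using D[of a b] D[of b a] H H' by (auto simp: symm_def)
    qed
    have "dotp N v (mvec N D x) = dotp N Dv x" unfolding Dv_def by (rule dotp_mvec_symm[OF symD, symmetric])
    moreover have "dotp N v Dw = dotp N v (\<lambda>a. c * Dv a + mvec N D x a)" by (intro dotp_cong) (auto simp: Dw)
    ultimately show ?thesis by (simp add: dotp_linear)
  qed
  ultimately have "(l' - l - dotp N v Dv) * c = dotp N Dv x"
    by (simp add: dotp_linear c_def algebra_simps)
  then have "\<bar>l' - l - dotp N v Dv\<bar> * \<bar>c\<bar> = \<bar>dotp N Dv x\<bar>" by (simp flip: abs_mult)
  also have "\<dots> \<le> vnorm N Dv * vnorm N x" by (rule dotp_Cauchy_Schwarz)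
  also have "\<dots> \<le> vnorm N Dv * (\<bar>c\<bar> * vnorm N Dv / (G - 2))"
    using nx G by (intro mult_left_mono) (auto simp: field_simps)
  also have "\<dots> = (dotp N Dv Dv / (G - 2)) * \<bar>c\<bar>"
    by (simp add: vnorm_square[symmetric] power2_eq_square)
  finally have "\<bar>l' - l - dotp N v Dv\<bar> \<le> dotp N Dv Dv / (G - 2)"
    by (rule mult_right_le_imp_le) (use c0 in simp)
  then show ?thesis by (simp add: l_def l'_def Dv_def)
qed

section \<open>Low-rank spikes plus a small perturbation\<close>

text \<open>A matrix whose entries are at most d has norm at most d times its size; here it is the Gram matrix
minus the identity.\<close>

lemma gram_combination:
  assumes "finite J" and g: "\<And>l m. l \<in> J \<Longrightarrow> m \<in> J \<Longrightarrow> \<bar>dotp N (e l) (e m) - (if l = m then 1 else 0)\<bar> \<le> d"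
  shows "\<bar>dotp N (\<lambda>a. \<Sum>l\<in>J. c l * e l a) (\<lambda>a. \<Sum>l\<in>J. c l * e l a) - (\<Sum>l\<in>J. (c l)\<^sup>2)\<bar>
    \<le> d * card J * (\<Sum>l\<in>J. (c l)\<^sup>2)"
proof (cases "J = {}")
  case True
  then show ?thesis by (simp add: dotp_def)
next
  case False
  then obtain j where "j \<in> J" by blast
  then have d: "0 \<le> d" using g[of j j] by linarith
  let ?D = "\<lambda>l m. dotp N (e l) (e m) - (if l = m then 1 else 0)"
  have "dotp N (\<lambda>a. \<Sum>l\<in>J. c l * e l a) (\<lambda>a. \<Sum>l\<in>J. c l * e l a)
      = (\<Sum>l\<in>J. \<Sum>m\<in>J. c l * c m * dotp N (e l) (e m))"
    by (simp add: dotp_linear sum_distrib_left algebra_simps)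
  moreover have "(\<Sum>l\<in>J. (c l)\<^sup>2) = (\<Sum>l\<in>J. \<Sum>m\<in>J. c l * c m * (if l = m then 1 else 0))"
    using assms(1) by (simp add: power2_eq_square if_distrib[of "(*) _"] cong: if_cong)
  ultimately have "dotp N (\<lambda>a. \<Sum>l\<in>J. c l * e l a) (\<lambda>a. \<Sum>l\<in>J. c l * e l a) - (\<Sum>l\<in>J. (c l)\<^sup>2)
      = (\<Sum>l\<in>J. \<Sum>m\<in>J. c l * c m * ?D l m)"
    by (simp only: right_diff_distrib sum_subtractf)
  also have "\<bar>\<dots>\<bar> \<le> (\<Sum>l\<in>J. \<Sum>m\<in>J. \<bar>c l\<bar> * \<bar>c m\<bar> * d)"
  proof (intro order_trans[OF sum_abs] sum_mono)
    fix l m assume "l \<in> J" "m \<in> J"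
    then show "\<bar>c l * c m * ?D l m\<bar> \<le> \<bar>c l\<bar> * \<bar>c m\<bar> * d"
      unfolding abs_mult by (intro mult_left_mono g) auto
  qed
  also have "\<dots> = d * (\<Sum>l\<in>J. \<bar>c l\<bar>)\<^sup>2"
    by (simp add: power2_eq_square sum_product sum_distrib_left mult_ac)
  also have "\<dots> \<le> d * ((\<Sum>l\<in>J. \<bar>c l\<bar>\<^sup>2) * card J)"
    using assms(1) d by (intro mult_left_mono sum_squared_le_sum_of_squares) auto
  finally show ?thesis by (simp add: mult_ac)
qed

text \<open>Test x against y, the combination of the e l with coefficients <e l, x>, whose norm is known from
gram_combination, and apply the Cauchy-Schwarz inequality.\<close>

lemma almost_bessel:
  assumes "finite J" and g: "\<And>l m. l \<in> J \<Longrightarrow> m \<in> J \<Longrightarrow> \<bar>dotp N (e l) (e m) - (if l = m then 1 else 0)\<bar> \<le> d"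
  shows "(\<Sum>l\<in>J. (dotp N (e l) x)\<^sup>2) \<le> (1 + d * card J) * dotp N x x"
proof -
  define s where "s = (\<Sum>l\<in>J. (dotp N (e l) x)\<^sup>2)"
  define y where "y = (\<lambda>a. \<Sum>l\<in>J. dotp N (e l) x * e l a)"
  have s0: "0 \<le> s" by (simp add: s_def sum_nonneg)
  have yx: "dotp N y x = s" by (simp add: y_def dotp_linear s_def power2_eq_square)
  have yy: "dotp N y y \<le> (1 + d * card J) * s"
    using gram_combination[OF assms, where c = "\<lambda>l. dotp N (e l) x"]
    by (simp add: y_def s_def abs_le_iff algebra_simps)
  have "s\<^sup>2 \<le> dotp N y y * dotp N x x"
  proof -
    have "s \<le> vnorm N y * vnorm N x" using dotp_Cauchy_Schwarz[of N y x] yx by simp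
    then have "s\<^sup>2 \<le> (vnorm N y * vnorm N x)\<^sup>2" using s0 by (intro power_mono) auto
    then show ?thesis by (simp add: power_mult_distrib vnorm_square)
  qed
  also have "\<dots> \<le> (1 + d * card J) * s * dotp N x x"
    using yy by (intro mult_right_mono) (auto simp: dotp_nonneg)
  finally have le: "s * s \<le> ((1 + d * card J) * dotp N x x) * s" by (simp add: power2_eq_square mult_ac)
  show ?thesis
  proof (cases "s = 0")
    case True
    have "J = {} \<or> 0 \<le> d" using g by (metis abs_ge_zero all_not_in_conv order_trans)
    then have "0 \<le> d * card J" by auto
    then show ?thesis using True dotp_nonneg[of N x] unfolding s_def[symmetric] by simp
  next
    case False
    then show ?thesis using le s0 unfolding s_def[symmetric] by (intro mult_right_le_imp_le[OF le]) auto
  qed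
qed

text \<open>On the span of the e l Bessel's inequality can be reversed: <x, x> is a combination of the <e l,
x> with the coefficients of x, whose norm is comparable to that of x.\<close>

lemma almost_bessel_reverse:
  assumes "finite J" and g: "\<And>l m. l \<in> J \<Longrightarrow> m \<in> J \<Longrightarrow> \<bar>dotp N (e l) (e m) - (if l = m then 1 else 0)\<bar> \<le> d"
  defines "x \<equiv> (\<lambda>c a. \<Sum>l\<in>J. c l * e l a)"
  shows "(1 - d * card J) * dotp N (x c) (x c) \<le> (\<Sum>l\<in>J. (dotp N (e l) (x c))\<^sup>2)"
proof -
  define s where "s = (\<Sum>l\<in>J. (dotp N (e l) (x c))\<^sup>2)"
  define t where "t = (\<Sum>l\<in>J. (c l)\<^sup>2)"
  define X where "X = dotp N (x c) (x c)"
  have st: "0 \<le> s" "0 \<le> t" "0 \<le> X" by (simp_all add: s_def t_def X_def sum_nonneg dotp_nonneg)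
  have "X = (\<Sum>l\<in>J. c l * dotp N (e l) (x c))"
    unfolding X_def by (subst (1) x_def) (simp add: dotp_linear)
  also have "\<dots> \<le> L2_set c J * L2_set (\<lambda>l. dotp N (e l) (x c)) J"
    by (rule order_trans[OF sum_mono L2_set_mult_ineq]) (simp flip: abs_mult)
  finally have "X\<^sup>2 \<le> (L2_set c J * L2_set (\<lambda>l. dotp N (e l) (x c)) J)\<^sup>2" using st by (intro power_mono) auto
  then have Xts: "X * X \<le> t * s" using st by (simp add: power_mult_distrib L2_set_def s_def t_def power2_eq_square[of X])
  have "X - t \<ge> - (d * card J * t)"
    using gram_combination[OF assms(1) g, where c = c] by (simp add: x_def X_def t_def abs_le_iff)
  then have tX: "(1 - d * card J) * t \<le> X" by (simp add: algebra_simps)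
  show ?thesis
  proof (cases "1 - d * card J \<le> 0 \<or> X = 0")
    case True
    then have "(1 - d * card J) * X \<le> 0" using st by (auto simp: mult_le_0_iff)
    then show ?thesis using st unfolding s_def[symmetric] X_def[symmetric] by linarith
  next
    case False
    have "(1 - d * card J) * X * X \<le> (1 - d * card J) * (t * s)"
      using Xts False by (simp add: mult.assoc)
    also have "\<dots> \<le> X * s" using tX st mult_right_mono[of "(1 - d * card J) * t" X s] by (simp add: mult.assoc)
    finally have "((1 - d * card J) * X) * X \<le> s * X" by (simp add: mult_ac)
    then have "(1 - d * card J) * X \<le> s" by (rule mult_right_le_imp_le) (use False st in auto)
    then show ?thesis by (simp add: s_def X_def)
  qed
qed

text \<open>The deterministic part of the argument. One parameter d measures both the defect of orthonormality
and the size of the noise relative to \<tau>, so that every conclusion is an error linear in d.\<close>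

locale spiked_matrix =
  fixes N k :: nat and \<theta> :: "nat \<Rightarrow> real" and e :: "nat \<Rightarrow> nat \<Rightarrow> real"
    and \<tau> d :: real and W H :: "nat \<Rightarrow> nat \<Rightarrow> real"
  assumes tau: "0 < \<tau>" and kN: "k < N"
    and theta_mono: "\<And>l m. 1 \<le> l \<Longrightarrow> l \<le> m \<Longrightarrow> m \<le> k \<Longrightarrow> \<theta> m \<le> \<theta> l"
    and theta_pos: "\<And>l. 1 \<le> l \<Longrightarrow> l \<le> k \<Longrightarrow> 0 < \<theta> l"
    and gram: "\<And>l m. l \<in> {1..k} \<Longrightarrow> m \<in> {1..k} \<Longrightarrow> \<bar>dotp N (e l) (e m) - (if l = m then 1 else 0)\<bar> \<le> d"
    and symW: "symm N W"
    and Wsmall: "\<And>x. vnorm N (mvec N W x) \<le> d * \<tau> * vnorm N x"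
    and H: "\<And>a b. a < N \<Longrightarrow> b < N \<Longrightarrow> H a b = \<tau> * (\<Sum>l=1..k. \<theta> l * e l a * e l b) + W a b"
    and d0: "0 \<le> d" and kd: "real k * d \<le> 1 / 2"
begin

lemma symH: "symm N H"
  using symW by (auto simp: symm_def H mult_ac)

lemma mvecH:
  assumes "a < N"
  shows "mvec N H x a = \<tau> * (\<Sum>l=1..k. \<theta> l * dotp N (e l) x * e l a) + mvec N W x a"
proof -
  have "mvec N H x a = (\<Sum>b<N. \<Sum>l=1..k. \<tau> * (\<theta> l * e l a * (e l b * x b))) + mvec N W x a"
    using assms by (simp add: mvec_def H algebra_simps sum.distrib sum_distrib_left)
  also have "(\<Sum>b<N. \<Sum>l=1..k. \<tau> * (\<theta> l * e l a * (e l b * x b))) = (\<Sum>l=1..k. \<Sum>b<N. \<tau> * (\<theta> l * e l a * (e l b * x b)))"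
    by (rule sum.swap)
  also have "\<dots> = \<tau> * (\<Sum>l=1..k. \<theta> l * dotp N (e l) x * e l a)"
    unfolding dotp_def by (simp add: sum_distrib_left sum_distrib_right mult_ac)
  finally show ?thesis .
qed

lemma dotp_mvecH:
  "dotp N y (mvec N H x) = \<tau> * (\<Sum>l=1..k. \<theta> l * dotp N (e l) x * dotp N y (e l)) + dotp N y (mvec N W x)"
proof -
  have "dotp N y (mvec N H x) = dotp N y (\<lambda>a. \<tau> * (\<Sum>l=1..k. \<theta> l * dotp N (e l) x * e l a) + mvec N W x a)"
    by (intro dotp_cong) (auto simp: mvecH)
  then show ?thesis by (simp add: dotp_linear)
qed

lemma quadratic_form:
  "\<bar>dotp N x (mvec N H x) - \<tau> * (\<Sum>l=1..k. \<theta> l * (dotp N (e l) x)\<^sup>2)\<bar> \<le> d * \<tau> * dotp N x x"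
  using dotp_le_vnorm_bound[OF Wsmall, of x]
  by (simp add: dotp_mvecH dotp_commute[of N x "e _"] power2_eq_square mult.assoc)

text \<open>The test space is the orthogonal complement of the first i - 1 spikes. The case i = k + 1 bounds
the whole bulk.\<close>

lemma eig_upper:
  assumes i: "1 \<le> i" "i \<le> k + 1"
  shows "eig N H i \<le> \<tau> * ((if i \<le> k then \<theta> i * (1 + k * d) else 0) + d)"
proof (rule eig_le[OF symH i(1), of "\<lambda>j. e (Suc j)"])
  show "i \<le> N" using i kN by simp
  fix x assume "\<forall>j<i-1. dotp N (e (Suc j)) x = 0"
  then have z: "dotp N (e l) x = 0" if "l \<in> {1..k}" "l < i" for l
    using that by (cases l) auto
  have "(\<Sum>l=1..k. \<theta> l * (dotp N (e l) x)\<^sup>2) \<le> (if i \<le> k then \<theta> i * (1 + k * d) else 0) * dotp N x x"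
  proof (cases "i \<le> k")
    case True
    have "(\<Sum>l=1..k. \<theta> l * (dotp N (e l) x)\<^sup>2) \<le> (\<Sum>l=1..k. \<theta> i * (dotp N (e l) x)\<^sup>2)"
    proof (rule sum_mono)
      fix l assume l: "l \<in> {1..k}"
      show "\<theta> l * (dotp N (e l) x)\<^sup>2 \<le> \<theta> i * (dotp N (e l) x)\<^sup>2"
        using z[OF l] theta_mono[of i l] i l by (cases "l < i") (auto intro!: mult_right_mono)
    qed
    also have "\<dots> = \<theta> i * (\<Sum>l=1..k. (dotp N (e l) x)\<^sup>2)" by (simp add: sum_distrib_left)
    also have "\<dots> \<le> \<theta> i * ((1 + d * card {1..k}) * dotp N x x)"
      using theta_pos[of i] i True gram by (intro mult_left_mono almost_bessel) auto
    finally show ?thesis using True by (simp add: mult_ac)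
  next
    case False
    then have "(\<Sum>l=1..k. \<theta> l * (dotp N (e l) x)\<^sup>2) = 0" using z i by (intro sum.neutral) auto
    then show ?thesis using False by simp
  qed
  then have "\<tau> * (\<Sum>l=1..k. \<theta> l * (dotp N (e l) x)\<^sup>2) \<le> \<tau> * ((if i \<le> k then \<theta> i * (1 + k * d) else 0) * dotp N x x)"
    using tau by (intro mult_left_mono) auto
  then show "dotp N x (mvec N H x) \<le> \<tau> * ((if i \<le> k then \<theta> i * (1 + k * d) else 0) + d) * dotp N x x"
    using quadratic_form[of x] by (simp add: algebra_simps abs_le_iff)
qed

text \<open>The test space is the span of the first i spikes.\<close>

lemma eig_lower:
  assumes i: "1 \<le> i" "i \<le> k"
  shows "\<tau> * (\<theta> i * (1 - k * d) - d) \<le> eig N H i"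
proof (rule eig_ge[OF symH i(1), of _ "\<lambda>j. e (Suc j)"])
  show "i \<le> N" using i kN by simp
  have g: "\<bar>dotp N (e (Suc l)) (e (Suc m)) - (if l = m then 1 else 0)\<bar> \<le> d" if "l \<in> {..<i}" "m \<in> {..<i}" for l m
    using gram[of "Suc l" "Suc m"] that i by simp
  have "real i * d \<le> real k * d" using i d0 by (intro mult_right_mono) auto
  then have id: "d * real i \<le> real k * d" by (simp add: mult.commute)
  fix c :: "nat \<Rightarrow> real"
  let ?x = "\<lambda>a. \<Sum>j<i. c j * e (Suc j) a"
  have "(1 - k * d) * dotp N ?x ?x \<le> (1 - d * card {..<i}) * dotp N ?x ?x"
    using id by (intro mult_right_mono) (auto simp: dotp_nonneg)
  also have "\<dots> \<le> (\<Sum>l<i. (dotp N (e (Suc l)) ?x)\<^sup>2)"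
    by (rule almost_bessel_reverse) (use g in auto)
  finally have "\<theta> i * ((1 - k * d) * dotp N ?x ?x) \<le> \<theta> i * (\<Sum>l<i. (dotp N (e (Suc l)) ?x)\<^sup>2)"
    using theta_pos[of i] i by (intro mult_left_mono) auto
  also have "\<dots> = (\<Sum>l\<in>{1..i}. \<theta> i * (dotp N (e l) ?x)\<^sup>2)"
  proof -
    have "{1..i} = Suc ` {..<i}" by (simp only: image_Suc_lessThan)
    then show ?thesis by (simp only: sum.reindex[OF inj_Suc] sum_distrib_left comp_def)
  qed
  also have "\<dots> \<le> (\<Sum>l\<in>{1..i}. \<theta> l * (dotp N (e l) ?x)\<^sup>2)"
    using theta_mono i by (intro sum_mono mult_right_mono) auto
  also have "\<dots> \<le> (\<Sum>l\<in>{1..k}. \<theta> l * (dotp N (e l) ?x)\<^sup>2)"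
  proof (rule sum_mono2)
    fix l assume "l \<in> {1..k} - {1..i}"
    then have "0 < \<theta> l" by (intro theta_pos) auto
    then show "0 \<le> \<theta> l * (dotp N (e l) ?x)\<^sup>2" by simp
  qed (use i in auto)
  finally have "\<tau> * (\<theta> i * ((1 - k * d) * dotp N ?x ?x)) \<le> \<tau> * (\<Sum>l\<in>{1..k}. \<theta> l * (dotp N (e l) ?x)\<^sup>2)"
    using tau by (intro mult_left_mono) auto
  then show "\<tau> * (\<theta> i * (1 - k * d) - d) * dotp N ?x ?x \<le> dotp N ?x (mvec N H ?x)"
    using quadratic_form[of ?x] by (simp add: algebra_simps abs_le_iff)
  assume 0: "dotp N ?x ?x = 0"
  have "\<bar>dotp N ?x ?x - (\<Sum>l<i. (c l)\<^sup>2)\<bar> \<le> d * card {..<i} * (\<Sum>l<i. (c l)\<^sup>2)"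
    by (rule gram_combination) (use g in auto)
  also have "\<dots> \<le> 1 / 2 * (\<Sum>l<i. (c l)\<^sup>2)" using id kd by (intro mult_right_mono sum_nonneg) auto
  finally have "(\<Sum>l<i. (c l)\<^sup>2) \<le> 0" using 0 by (simp add: sum_nonneg)
  then have "(\<Sum>l<i. (c l)\<^sup>2) = 0" by (simp add: sum_nonneg order_antisym)
  then show "\<forall>j<i. c j = 0" by (simp add: sum_nonneg_eq_0_iff)
qed

definition \<kappa> :: real where "\<kappa> = (k * \<theta> 1 + 1) * d"

lemma theta_d_le: "1 \<le> l \<Longrightarrow> l \<le> k \<Longrightarrow> \<theta> l * (real k * d) + d \<le> \<kappa>"
proof -
  assume l: "1 \<le> l" "l \<le> k"
  have "\<theta> l * (real k * d) \<le> \<theta> 1 * (real k * d)"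
    using theta_mono[of 1 l] l d0 by (intro mult_right_mono) auto
  then show ?thesis by (simp add: \<kappa>_def algebra_simps)
qed

lemma kappa_nonneg: "k \<ge> 1 \<Longrightarrow> d \<le> \<kappa>"
proof -
  assume k: "k \<ge> 1"
  have "0 \<le> \<theta> 1 * (real k * d)" using theta_pos[of 1] k d0 by simp
  then show ?thesis using theta_d_le[of 1] k by simp
qed

lemma eig_near:
  assumes "1 \<le> i" "i \<le> k"
  shows "\<bar>eig N H i - \<tau> * \<theta> i\<bar> \<le> \<tau> * \<kappa>"
proof -
  have "eig N H i \<le> \<tau> * (\<theta> i + \<kappa>)"
  proof -
    have "eig N H i \<le> \<tau> * (\<theta> i * (1 + k * d) + d)" using eig_upper[of i] assms by simp
    also have "\<dots> \<le> \<tau> * (\<theta> i + \<kappa>)"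
      using theta_d_le[OF assms] tau by (intro mult_left_mono) (auto simp: algebra_simps)
    finally show ?thesis .
  qed
  moreover have "\<tau> * (\<theta> i - \<kappa>) \<le> eig N H i"
  proof -
    have "\<tau> * (\<theta> i - \<kappa>) \<le> \<tau> * (\<theta> i * (1 - k * d) - d)"
      using theta_d_le[OF assms] tau by (intro mult_left_mono) (auto simp: algebra_simps)
    then show ?thesis using eig_lower[OF assms] by linarith
  qed
  ultimately show ?thesis by (simp add: abs_le_iff algebra_simps)
qed

end

text \<open>The number g bounds the distance of \<open>\<theta> i\<close> from the other spikes and from 0,
where the bulk lies on the scale \<tau>. The bound on \<kappa> keeps the window of the i-th
eigenvalue apart from the windows of the others.\<close>

locale simple_spike = spiked_matrix +
  fixes i :: nat and g :: real
  assumes i: "1 \<le> i" "i \<le> k" and g0: "0 < g"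
    and theta_gap: "\<And>m. 1 \<le> m \<Longrightarrow> m \<le> k \<Longrightarrow> m \<noteq> i \<Longrightarrow> g \<le> \<bar>\<theta> m - \<theta> i\<bar>" and theta_i: "g \<le> \<theta> i"
    and kappa_small: "\<kappa> \<le> g / 4"
begin

lemma i_le_N: "i \<le> N" using i kN by simp

abbreviation l :: real where "l \<equiv> eig N H i"

lemma l_lower: "\<tau> * (3 * g / 4) \<le> l"
proof -
  have "\<tau> * (3 * g / 4) \<le> \<tau> * (\<theta> i - \<kappa>)" using theta_i kappa_small tau by (intro mult_left_mono) auto
  then show ?thesis using eig_near[OF i] by (simp add: abs_le_iff algebra_simps)
qed

lemma l_pos: "0 < l"
proof -
  have "0 < \<tau> * (3 * g / 4)" using tau g0 by simp
  then show ?thesis using l_lower by linarith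
qed

lemma l_theta_gap:
  assumes m: "1 \<le> m" "m \<le> k" "m \<noteq> i"
  shows "\<tau> * (g / 2) \<le> \<bar>l - \<tau> * \<theta> m\<bar>"
proof -
  have "\<tau> * g \<le> \<tau> * \<bar>\<theta> m - \<theta> i\<bar>" using theta_gap[OF m] tau by (intro mult_left_mono) auto
  also have "\<dots> = \<bar>\<tau> * \<theta> m - \<tau> * \<theta> i\<bar>" using tau by (simp flip: right_diff_distrib add: abs_mult)
  finally have "\<tau> * g \<le> \<bar>\<tau> * \<theta> m - \<tau> * \<theta> i\<bar>" .
  moreover have "\<tau> * \<kappa> \<le> \<tau> * (g / 4)" using kappa_small tau by (intro mult_left_mono) auto
  moreover have "0 < \<tau> * g" using tau g0 by simp
  ultimately show ?thesis using eig_near[OF i] by (simp add: abs_if split: if_splits)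
qed

text \<open>The neighbours i - 1 and i + 1 in the ordering are the critical ones. If i = k, the right
neighbour belongs to the bulk.\<close>

lemma other_eigenvalues_far:
  assumes j: "1 \<le> j" "j \<le> N" "j \<noteq> i" and E: "eigenbasis N H N lam v"
  shows "\<tau> * (g / 2) \<le> \<bar>lam (j - 1) - l\<bar>"
proof -
  have tk: "\<tau> * \<kappa> \<le> \<tau> * (g / 4)" using kappa_small tau by (intro mult_left_mono) auto
  have mono: "lam q \<le> lam p" if "p \<le> q" "q < N" for p q using E that by (auto simp: eigenbasis_def)
  show ?thesis
  proof (cases "j < i")
    case True
    then have i1: "1 \<le> i - 1" "i - 1 \<le> k" "i - 1 \<noteq> i" using i j by auto
    have "\<tau> * g \<le> \<tau> * (\<theta> (i - 1) - \<theta> i)"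
      using theta_gap[OF i1] theta_mono[of "i - 1" i] i1 i tau by (intro mult_left_mono) auto
    moreover have "lam (i - 1 - 1) \<le> lam (j - 1)" using True i_le_N j by (intro mono) auto
    moreover have "eig N H (i - 1) = lam (i - 1 - 1)" using i1 i_le_N by (intro eig_eigenbasis[OF E]) auto
    ultimately show ?thesis using eig_near[OF i] eig_near[OF i1(1,2)] tk
      by (simp add: abs_le_iff algebra_simps)
  next
    case False
    then have ij: "i < j" using j by auto
    have up: "eig N H (i + 1) \<le> \<tau> * (\<theta> i - g + \<kappa>)"
    proof (cases "i + 1 \<le> k")
      case True
      have "g \<le> \<theta> i - \<theta> (i + 1)" using theta_gap[of "i + 1"] theta_mono[of i "i + 1"] True i by auto
      then have "\<tau> * (\<theta> (i + 1) + \<kappa>) \<le> \<tau> * (\<theta> i - g + \<kappa>)" using tau by (intro mult_left_mono) auto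
      moreover have "eig N H (i + 1) \<le> \<tau> * (\<theta> (i + 1) + \<kappa>)"
        using eig_near[of "i + 1"] True i by (simp add: abs_le_iff algebra_simps)
      ultimately show ?thesis by linarith
    next
      case False
      have "d \<le> \<kappa>" using kappa_nonneg i by simp
      then have "\<tau> * d \<le> \<tau> * (\<theta> i - g + \<kappa>)" using theta_i tau by (intro mult_left_mono) auto
      then show ?thesis using eig_upper[of "i + 1"] False i by simp
    qed
    have "lam (j - 1) \<le> lam (i + 1 - 1)" using ij j by (intro mono) auto
    also have "\<dots> = eig N H (i + 1)" using ij j by (intro eig_eigenbasis[OF E, symmetric]) auto
    finally show ?thesis using up eig_near[OF i] tk
      by (simp add: abs_le_iff algebra_simps)
  qed
qed

text \<open>Eigenvectors for different eigenvalues of a symmetric matrix are orthogonal.\<close>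

lemma eigvec_orthogonal_to_others:
  assumes v: "unit_eigvec N H l v" and E: "eigenbasis N H N lam u" and j: "j < N" "j \<noteq> i - 1"
  shows "dotp N (u j) v = 0"
proof -
  have "dotp N (u j) (mvec N H v) = lam j * dotp N (u j) v" by (rule eigenbasis_coeff_mvec[OF symH E j(1)])
  moreover have "dotp N (u j) (mvec N H v) = dotp N (u j) (\<lambda>a. l * v a)"
    using v by (intro dotp_cong) (auto simp: unit_eigvec_def)
  ultimately have "(lam j - l) * dotp N (u j) v = 0" by (auto simp: dotp_scale_right left_diff_distrib)
  moreover have "lam j - l \<noteq> 0"
  proof -
    have "\<tau> * (g / 2) \<le> \<bar>lam (Suc j - 1) - l\<bar>"
      using j i by (intro other_eigenvalues_far[OF _ _ _ E]) auto
    moreover have "0 < \<tau> * (g / 2)" using tau g0 by simp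
    ultimately show ?thesis by auto
  qed
  ultimately show ?thesis by simp
qed

text \<open>In eigenbasis coordinates H - l is diagonal, with entries of modulus at least \<tau> g / 2 except
at the position of v, where x has no component.\<close>

lemma spectral_gap:
  assumes v: "unit_eigvec N H l v" and x: "dotp N v x = 0"
  shows "(\<tau> * g / 2) * vnorm N x \<le> vnorm N (\<lambda>a. mvec N H x a - l * x a)"
proof -
  obtain lam u where E: "eigenbasis N H N lam u" using eigenbasis_exists[OF symH] by blast
  let ?z = "\<lambda>a. mvec N H x a - l * x a"
  have iN: "i - 1 < N" using i i_le_N by simp
  have sgl: "(\<Sum>j<N. dotp N (u j) v * dotp N (u j) y) = dotp N (u (i-1)) v * dotp N (u (i-1)) y" for y
  proof -
    have "(\<Sum>j<N. dotp N (u j) v * dotp N (u j) y) =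
        (\<Sum>j\<in>{i-1}. dotp N (u j) v * dotp N (u j) y)"
      using iN eigvec_orthogonal_to_others[OF v E] by (intro sum.mono_neutral_right) auto
    then show ?thesis by simp
  qed
  have "dotp N (u (i-1)) v * dotp N (u (i-1)) v = 1"
    using v eigenbasis_parseval[OF E, of v v] sgl[of v] by (simp add: unit_eigvec_def)
  moreover have "dotp N (u (i-1)) v * dotp N (u (i-1)) x = 0"
    using x eigenbasis_parseval[OF E, of v x] sgl[of x] by simp
  ultimately have ux: "dotp N (u (i-1)) x = 0" by auto
  have zc: "dotp N (u j) ?z = (lam j - l) * dotp N (u j) x" if "j < N" for j
    using eigenbasis_coeff_mvec[OF symH E that, of x]
    by (simp add: dotp_diff_right dotp_scale_right left_diff_distrib)
  have "(\<tau> * g / 2)\<^sup>2 * dotp N x x = (\<Sum>j<N. (\<tau> * g / 2)\<^sup>2 * (dotp N (u j) x)\<^sup>2)"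
    by (simp add: eigenbasis_parseval[OF E, of x x] sum_distrib_left power2_eq_square)
  also have "\<dots> \<le> (\<Sum>j<N. (lam j - l)\<^sup>2 * (dotp N (u j) x)\<^sup>2)"
  proof (rule sum_mono)
    fix j assume "j \<in> {..<N}"
    then have j: "j < N" by simp
    show "(\<tau> * g / 2)\<^sup>2 * (dotp N (u j) x)\<^sup>2 \<le> (lam j - l)\<^sup>2 * (dotp N (u j) x)\<^sup>2"
    proof (cases "j = i - 1")
      case False
      have "\<tau> * (g / 2) \<le> \<bar>lam (Suc j - 1) - l\<bar>"
        using j False i by (intro other_eigenvalues_far[OF _ _ _ E]) auto
      then have "(\<tau> * g / 2)\<^sup>2 \<le> \<bar>lam j - l\<bar>\<^sup>2" using tau g0 by (intro power_mono) auto
      then show ?thesis by (intro mult_right_mono) auto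
    qed (use ux in simp)
  qed
  also have "\<dots> = dotp N ?z ?z"
    unfolding eigenbasis_parseval[OF E, of ?z ?z]
    by (intro sum.cong refl, subst (1 2) zc) (auto simp: power2_eq_square)
  finally have "(\<tau> * g / 2 * vnorm N x)\<^sup>2 \<le> (vnorm N ?z)\<^sup>2"
    by (simp only: power_mult_distrib[of "\<tau> * g / 2"] vnorm_square)
  then show ?thesis by (rule power2_le_imp_le) simp
qed

lemma e_norm: "m \<in> {1..k} \<Longrightarrow> \<bar>vnorm N (e m) - 1\<bar> \<le> d \<and> vnorm N (e m) \<le> 2"
proof -
  assume m: "m \<in> {1..k}"
  define n where "n = vnorm N (e m)"
  have n0: "0 \<le> n" by (simp add: n_def)
  have "\<bar>n\<^sup>2 - 1\<bar> \<le> d" using gram[OF m m] by (simp add: n_def vnorm_square)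
  moreover have "\<bar>n\<^sup>2 - 1\<bar> = \<bar>n - 1\<bar> * (n + 1)"
  proof -
    have "n\<^sup>2 - 1 = (n - 1) * (n + 1)" by (simp add: algebra_simps power2_eq_square)
    then show ?thesis using n0 by (simp add: abs_mult)
  qed
  moreover have "\<bar>n - 1\<bar> * 1 \<le> \<bar>n - 1\<bar> * (n + 1)" using n0 by (intro mult_left_mono) auto
  ultimately have n1: "\<bar>n - 1\<bar> \<le> d" by simp
  have "1 * d \<le> real k * d" using i d0 by (intro mult_right_mono) auto
  then have "d \<le> 1" using kd by linarith
  then show ?thesis using n1 by (simp add: n_def abs_le_iff)
qed

lemma e_dotp_le: "m \<in> {1..k} \<Longrightarrow> dotp N v v = 1 \<Longrightarrow> \<bar>dotp N (e m) v\<bar> \<le> 2"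
  using dotp_Cauchy_Schwarz[of N "e m" v] e_norm[of m] by (simp add: vnorm_def[of N v])

lemma eigvec_expansion:
  assumes v: "unit_eigvec N H l v" and a: "a < N"
  shows "v a = (\<Sum>m=1..k. (\<tau> * \<theta> m * dotp N (e m) v / l) * e m a) + mvec N W v a / l"
proof -
  have "l * v a = \<tau> * (\<Sum>m=1..k. \<theta> m * dotp N (e m) v * e m a) + mvec N W v a"
    using v a mvecH[OF a, of v] by (simp add: unit_eigvec_def)
  then have "v a = (\<tau> * (\<Sum>m=1..k. \<theta> m * dotp N (e m) v * e m a) + mvec N W v a) / l"
    using l_pos by (simp add: field_simps)
  then show ?thesis by (simp add: add_divide_distrib sum_distrib_left sum_divide_distrib mult_ac)
qed

lemma eigvec_coeff_le:
  assumes v: "unit_eigvec N H l v" and m: "m \<in> {1..k}"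
  shows "\<bar>\<tau> * \<theta> m * dotp N (e m) v / l\<bar> \<le> 4 * \<theta> 1 / g"
proof -
  have th: "0 < \<theta> m" "\<theta> m \<le> \<theta> 1" using m theta_pos[of m] theta_mono[of 1 m] by auto
  have "\<bar>\<tau> * \<theta> m * dotp N (e m) v\<bar> \<le> \<tau> * \<theta> 1 * 2"
    using v m th tau e_dotp_le[OF m, of v] unfolding abs_mult
    by (intro mult_mono) (auto simp: unit_eigvec_def)
  then have "\<bar>\<tau> * \<theta> m * dotp N (e m) v / l\<bar> \<le> \<tau> * \<theta> 1 * 2 / l"
    using l_pos by (simp add: divide_right_mono)
  also have "\<dots> \<le> \<tau> * \<theta> 1 * 2 / (\<tau> * (g / 2))"
  proof (intro divide_left_mono)
    have "\<tau> * (g / 2) \<le> \<tau> * (3 * g / 4)" using tau g0 by simp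
    then show "\<tau> * (g / 2) \<le> l" using l_lower by linarith
  qed (use tau g0 th l_pos in auto)
  also have "\<dots> = 4 * \<theta> 1 / g" using tau g0 by (simp add: field_simps)
  finally show ?thesis .
qed

text \<open>The constants of the estimates dotp_other_small and eigvec_close depend on k, \<open>\<theta>
1\<close> and g only.\<close>

definition C0 :: real where "C0 = 2 * (2 * k * \<theta> 1 + 2) / g"
definition C1 :: real where "C1 = (2 / g) * (2 * k * \<theta> 1 * C0 + 1)"

text \<open>Pair H v = l v with e m. All terms other than (l - \<tau> \<theta> m) <e m, v> come from the
defect of orthonormality or from the noise, while the factor l - \<tau> \<theta> m is of order
\<tau>.\<close>

lemma dotp_other_small:
  assumes v: "unit_eigvec N H l v" and m: "m \<in> {1..k}" "m \<noteq> i"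
  shows "\<bar>dotp N (e m) v\<bar> \<le> C0 * d"
proof -
  have vv: "dotp N v v = 1" using v by (simp add: unit_eigvec_def)
  let ?u = "\<lambda>m. dotp N (e m) v"
  let ?D = "\<lambda>p. dotp N (e m) (e p) - (if p = m then 1 else 0)"
  have "dotp N (e m) (mvec N H v) = dotp N (e m) (\<lambda>a. l * v a)"
    using v by (intro dotp_cong) (auto simp: unit_eigvec_def)
  then have "l * ?u m = \<tau> * (\<Sum>p=1..k. \<theta> p * ?u p * dotp N (e m) (e p)) + dotp N (e m) (mvec N W v)"
    by (simp add: dotp_mvecH dotp_linear)
  moreover have "(\<Sum>p=1..k. \<theta> p * ?u p * dotp N (e m) (e p)) = \<theta> m * ?u m + (\<Sum>p=1..k. \<theta> p * ?u p * ?D p)"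
    using m by (simp add: algebra_simps sum_subtractf if_distrib[of "(*) _"] cong: if_cong)
  ultimately have eq: "(l - \<tau> * \<theta> m) * ?u m = \<tau> * (\<Sum>p=1..k. \<theta> p * ?u p * ?D p) + dotp N (e m) (mvec N W v)"
    by (simp add: algebra_simps)
  have th1: "0 < \<theta> 1" using theta_pos[of 1] i by simp
  have "\<bar>\<Sum>p=1..k. \<theta> p * ?u p * ?D p\<bar> \<le> (\<Sum>p=1..k. \<theta> 1 * 2 * d)"
  proof (intro order_trans[OF sum_abs] sum_mono)
    fix p assume p: "p \<in> {1..k}"
    have "\<bar>\<theta> p\<bar> \<le> \<theta> 1" using p theta_pos[of p] theta_mono[of 1 p] by auto
    moreover have "\<bar>?D p\<bar> \<le> d" using gram[OF m(1) p] by (simp add: eq_commute[of p m])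
    ultimately show "\<bar>\<theta> p * ?u p * ?D p\<bar> \<le> \<theta> 1 * 2 * d"
      using e_dotp_le[OF p vv] th1 unfolding abs_mult by (intro mult_mono) auto
  qed
  then have "\<bar>\<tau> * (\<Sum>p=1..k. \<theta> p * ?u p * ?D p)\<bar> \<le> \<tau> * (k * (\<theta> 1 * 2 * d))"
    using tau by (simp add: abs_mult)
  moreover have "\<bar>dotp N (e m) (mvec N W v)\<bar> \<le> 2 * (d * \<tau>)"
  proof -
    have "\<bar>dotp N (e m) (mvec N W v)\<bar> \<le> vnorm N (e m) * vnorm N (mvec N W v)" by (rule dotp_Cauchy_Schwarz)
    also have "\<dots> \<le> 2 * (d * \<tau>)"
      using e_norm[OF m(1)] Wsmall[of v] vv by (intro mult_mono) (auto simp: vnorm_def[of N v])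
    finally show ?thesis .
  qed
  ultimately have "\<bar>(l - \<tau> * \<theta> m) * ?u m\<bar> \<le> \<tau> * ((2 * k * \<theta> 1 + 2) * d)"
    unfolding eq by (simp add: algebra_simps)
  moreover have "\<tau> * (g / 2) * \<bar>?u m\<bar> \<le> \<bar>(l - \<tau> * \<theta> m) * ?u m\<bar>"
    unfolding abs_mult using l_theta_gap[of m] m by (intro mult_right_mono) auto
  ultimately have "\<tau> * (g / 2 * \<bar>?u m\<bar>) \<le> \<tau> * ((2 * k * \<theta> 1 + 2) * d)" by simp
  then have "g / 2 * \<bar>?u m\<bar> \<le> (2 * k * \<theta> 1 + 2) * d" using tau by (simp add: mult_le_cancel_left)
  then show ?thesis using g0 by (simp add: C0_def field_simps)
qed

text \<open>In eigvec_expansion all coefficients but the i-th are small, so v is close to a multiple c e i.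
Comparing norms shows that |c| is close to 1, and s is the sign of c.\<close>

lemma eigvec_close:
  assumes v: "unit_eigvec N H l v"
  shows "\<exists>s. \<bar>s\<bar> = 1 \<and> vnorm N (\<lambda>a. v a - s * e i a) \<le> (2 * C1 + 1) * d"
proof -
  have vv: "dotp N v v = 1" "vnorm N v = 1" using v by (simp_all add: unit_eigvec_def vnorm_def)
  let ?u = "\<lambda>m. dotp N (e m) v"
  define c where "c = \<tau> * \<theta> i * ?u i / l"
  have th1: "0 < \<theta> 1" using theta_pos[of 1] i by simp
  have C0: "0 \<le> C0" using th1 g0 by (simp add: C0_def)
  have l2: "\<tau> * (g / 2) \<le> l"
  proof -
    have "\<tau> * (g / 2) \<le> \<tau> * (3 * g / 4)" using tau g0 by simp
    then show ?thesis using l_lower by linarith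
  qed
  have tl: "\<tau> / l \<le> 2 / g" using l2 l_pos g0 by (simp add: field_simps)
  have iK: "i \<in> {1..k}" using i by simp
  have "v a - c * e i a = (\<Sum>m\<in>{1..k} - {i}. (\<tau> * \<theta> m * ?u m / l) * e m a) + (1 / l) * mvec N W v a" if "a < N" for a
    unfolding eigvec_expansion[OF v that] c_def by (subst sum.remove[OF _ iK]) auto
  then have "vnorm N (\<lambda>a. v a - c * e i a) =
     vnorm N (\<lambda>a. (\<Sum>m\<in>{1..k} - {i}. (\<tau> * \<theta> m * ?u m / l) * e m a) + (1 / l) * mvec N W v a)"
    by (intro vnorm_cong) auto
  also have "\<dots> \<le> vnorm N (\<lambda>a. \<Sum>m\<in>{1..k} - {i}. (\<tau> * \<theta> m * ?u m / l) * e m a) + vnorm N (\<lambda>a. (1 / l) * mvec N W v a)"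
    by (rule vnorm_triangle)
  also have "vnorm N (\<lambda>a. \<Sum>m\<in>{1..k} - {i}. (\<tau> * \<theta> m * ?u m / l) * e m a)
      \<le> (\<Sum>m\<in>{1..k} - {i}. vnorm N (\<lambda>a. (\<tau> * \<theta> m * ?u m / l) * e m a))"
    by (rule vnorm_sum) auto
  also have "\<dots> \<le> (\<Sum>m\<in>{1..k} - {i}. (2 / g) * \<theta> 1 * (C0 * d) * 2)"
  proof (rule sum_mono)
    fix m assume m: "m \<in> {1..k} - {i}"
    have "\<bar>\<theta> m\<bar> \<le> \<theta> 1" using m theta_pos[of m] theta_mono[of 1 m] by auto
    moreover have "\<bar>\<tau> / l\<bar> \<le> 2 / g" using tl tau l_pos by simp
    moreover have "\<bar>?u m\<bar> \<le> C0 * d" using dotp_other_small[OF v] m by auto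
    moreover have "vnorm N (e m) \<le> 2" using e_norm m by auto
    ultimately have "\<bar>\<tau> / l\<bar> * \<bar>\<theta> m\<bar> * \<bar>?u m\<bar> * vnorm N (e m) \<le> (2 / g) * \<theta> 1 * (C0 * d) * 2"
      using g0 th1 C0 d0 by (intro mult_mono) auto
    moreover have "vnorm N (\<lambda>a. (\<tau> * \<theta> m * ?u m / l) * e m a) = \<bar>\<tau> / l\<bar> * \<bar>\<theta> m\<bar> * \<bar>?u m\<bar> * vnorm N (e m)"
      by (simp only: vnorm_scale) (simp add: abs_mult)
    ultimately show "vnorm N (\<lambda>a. (\<tau> * \<theta> m * ?u m / l) * e m a) \<le> (2 / g) * \<theta> 1 * (C0 * d) * 2"
      by simp
  qed
  also have "\<dots> \<le> (2 / g) * (2 * k * \<theta> 1 * C0 * d)"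
  proof -
    have "real (card ({1..k} - {i})) \<le> real k" by (simp add: card_Diff_singleton_if)
    then have "real (card ({1..k} - {i})) * ((2 / g) * \<theta> 1 * (C0 * d) * 2) \<le> real k * ((2 / g) * \<theta> 1 * (C0 * d) * 2)"
      using g0 th1 C0 d0 by (intro mult_right_mono) auto
    then show ?thesis by (simp add: mult_ac)
  qed
  also have "vnorm N (\<lambda>a. (1 / l) * mvec N W v a) \<le> (2 / g) * d"
  proof -
    have "vnorm N (\<lambda>a. (1 / l) * mvec N W v a) = (1 / l) * vnorm N (mvec N W v)"
      using l_pos by (subst vnorm_scale) simp
    also have "\<dots> \<le> (1 / l) * (d * \<tau>)" using Wsmall[of v] vv l_pos by (intro mult_left_mono) auto
    also have "\<dots> = (\<tau> / l) * d" by simp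
    also have "\<dots> \<le> (2 / g) * d" using tl d0 by (intro mult_right_mono) auto
    finally show ?thesis .
  qed
  finally have z: "vnorm N (\<lambda>a. v a - c * e i a) \<le> C1 * d" by (simp add: C1_def algebra_simps)
  define s where "s = (if 0 \<le> c then 1 else - 1 :: real)"
  have s: "\<bar>s\<bar> = 1" "\<bar>c - s\<bar> = \<bar>\<bar>c\<bar> - 1\<bar>" by (auto simp: s_def)
  have cn: "\<bar>\<bar>c\<bar> * vnorm N (e i) - 1\<bar> \<le> C1 * d"
  proof -
    have "vnorm N v \<le> vnorm N (\<lambda>a. v a - c * e i a) + vnorm N (\<lambda>a. c * e i a)"
      using vnorm_triangle[of N "\<lambda>a. v a - c * e i a" "\<lambda>a. c * e i a"] by simp
    moreover have "vnorm N (\<lambda>a. c * e i a) \<le> vnorm N (\<lambda>a. v a - c * e i a) + vnorm N v"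
      using vnorm_triangle_diff[of N v "\<lambda>a. v a - c * e i a"] by (simp add: add.commute)
    ultimately show ?thesis using z vv by (simp add: vnorm_scale abs_le_iff)
  qed
  have "vnorm N (\<lambda>a. v a - s * e i a) = vnorm N (\<lambda>a. (v a - c * e i a) + (c - s) * e i a)"
    by (simp add: algebra_simps)
  also have "\<dots> \<le> vnorm N (\<lambda>a. v a - c * e i a) + \<bar>c - s\<bar> * vnorm N (e i)"
    using vnorm_triangle[of N "\<lambda>a. v a - c * e i a" "\<lambda>a. (c - s) * e i a"] by (simp add: vnorm_scale)
  also have "\<bar>c - s\<bar> * vnorm N (e i) = \<bar>\<bar>c\<bar> * vnorm N (e i) - vnorm N (e i)\<bar>"
  proof -
    have "\<bar>c\<bar> * vnorm N (e i) - vnorm N (e i) = (\<bar>c\<bar> - 1) * vnorm N (e i)" by (simp add: algebra_simps)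
    then show ?thesis by (simp add: s abs_mult)
  qed
  also have "\<dots> \<le> C1 * d + d" using cn e_norm[OF iK] by (auto simp: abs_le_iff)
  finally show ?thesis using z s by (intro exI[of _ s]) (simp add: algebra_simps)
qed

text \<open>The sign ambiguity of the eigenvector disappears in the rank-one projection, which is what the
derivative of the eigenvalue depends on.\<close>

lemma projection_close:
  assumes v: "unit_eigvec N H l v"
  shows "(\<Sum>a<N. \<Sum>b<N. (v a * v b - e i a * e i b)\<^sup>2) \<le> 10 * ((2 * C1 + 1) * d)\<^sup>2"
proof -
  obtain s where s: "\<bar>s\<bar> = 1" and close: "vnorm N (\<lambda>a. v a - s * e i a) \<le> (2 * C1 + 1) * d"
    using eigvec_close[OF v] by blast
  let ?w = "\<lambda>a. v a - s * e i a"
  have ss: "s * s = 1" using s by (metis abs_mult_self_eq mult_1)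
  have vv: "dotp N v v = 1" using v by (simp add: unit_eigvec_def)
  have sq: "(v a * v b - e i a * e i b)\<^sup>2 \<le> 2 * (?w a)\<^sup>2 * (v b)\<^sup>2 + 2 * (e i a)\<^sup>2 * (?w b)\<^sup>2" for a b
  proof -
    define p q where "p = ?w a * v b" and "q = s * e i a * ?w b"
    have "v a * v b - e i a * e i b = v a * v b - s * s * (e i a * e i b)" by (simp add: ss)
    then have "v a * v b - e i a * e i b = p + q" by (simp add: p_def q_def algebra_simps)
    moreover have "(p + q)\<^sup>2 \<le> 2 * p\<^sup>2 + 2 * q\<^sup>2"
    proof -
      have "2 * p\<^sup>2 + 2 * q\<^sup>2 - (p + q)\<^sup>2 = (p - q)\<^sup>2" by (simp add: power2_eq_square algebra_simps)
      then show ?thesis by (metis diff_ge_0_iff_ge zero_le_power2)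
    qed
    moreover have "q\<^sup>2 = (s * s) * (e i a)\<^sup>2 * (?w b)\<^sup>2" by (simp add: q_def power2_eq_square mult_ac)
    ultimately show ?thesis by (simp add: p_def ss power_mult_distrib mult.assoc)
  qed
  have "(\<Sum>a<N. \<Sum>b<N. (v a * v b - e i a * e i b)\<^sup>2)
     \<le> (\<Sum>a<N. \<Sum>b<N. 2 * (?w a)\<^sup>2 * (v b)\<^sup>2 + 2 * (e i a)\<^sup>2 * (?w b)\<^sup>2)"
    by (intro sum_mono sq)
  also have "\<dots> = 2 * (dotp N ?w ?w * dotp N v v) + 2 * (dotp N (e i) (e i) * dotp N ?w ?w)"
  proof -
    have "dotp N x x * dotp N y y = (\<Sum>a<N. \<Sum>b<N. (x a)\<^sup>2 * (y b)\<^sup>2)" for x y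
      by (simp add: dotp_def sum_product power2_eq_square)
    then show ?thesis by (simp only: sum.distrib sum_distrib_left mult.assoc)
  qed
  also have "\<dots> = (2 + 2 * (vnorm N (e i))\<^sup>2) * (vnorm N ?w)\<^sup>2"
    by (simp add: vv vnorm_square algebra_simps)
  also have "\<dots> \<le> 10 * ((2 * C1 + 1) * d)\<^sup>2"
  proof (intro mult_mono)
    have "(vnorm N (e i))\<^sup>2 \<le> 2\<^sup>2" using e_norm[of i] i by (intro power_mono) auto
    then show "2 + 2 * (vnorm N (e i))\<^sup>2 \<le> 10" by simp
    show "(vnorm N ?w)\<^sup>2 \<le> ((2 * C1 + 1) * d)\<^sup>2" using close by (intro power_mono) auto
  qed auto
  finally show ?thesis .
qed

end

section \<open>Independent Bernoulli variables and the Efron-Stein inequality\<close>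

text \<open>The expectation of g at a random subset of P that contains each e independently with probability p
e.\<close>

definition bexp :: "'e set \<Rightarrow> ('e \<Rightarrow> real) \<Rightarrow> ('e set \<Rightarrow> real) \<Rightarrow> real" where
  "bexp P p g = (\<Sum>S\<in>Pow P. (\<Prod>e\<in>P. if e \<in> S then p e else 1 - p e) * g S)"

lemma bexp_empty [simp]: "bexp {} p g = g {}"
  by (simp add: bexp_def)

text \<open>Conditioning on whether x belongs to the random set.\<close>

lemma bexp_insert:
  assumes "finite P" "x \<notin> P"
  shows "bexp (insert x P) p g = p x * bexp P p (\<lambda>S. g (insert x S)) + (1 - p x) * bexp P p g"
proof -
  let ?w = "\<lambda>P S. \<Prod>e\<in>P. if e \<in> S then p e else 1 - p e"
  have disj: "Pow P \<inter> insert x ` Pow P = {}" using assms by auto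
  have inj: "inj_on (insert x) (Pow P)" using assms by (auto simp: inj_on_def)
  have w1: "?w (insert x P) (insert x S) = p x * ?w P S" if "S \<subseteq> P" for S
  proof -
    have "?w P (insert x S) = ?w P S" using assms by (intro prod.cong) auto
    then show ?thesis using assms by simp
  qed
  have w0: "?w (insert x P) S = (1 - p x) * ?w P S" if "S \<subseteq> P" for S
    using assms that by auto
  have "bexp (insert x P) p g = (\<Sum>S\<in>Pow P. ?w (insert x P) S * g S) +
      (\<Sum>S\<in>Pow P. ?w (insert x P) (insert x S) * g (insert x S))"
    unfolding bexp_def Pow_insert
    by (subst sum.union_disjoint) (use assms disj inj in \<open>auto simp: sum.reindex\<close>)
  also have "(\<Sum>S\<in>Pow P. ?w (insert x P) S * g S) = (1 - p x) * bexp P p g"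
    unfolding bexp_def sum_distrib_left by (intro sum.cong refl, subst w0) auto
  also have "(\<Sum>S\<in>Pow P. ?w (insert x P) (insert x S) * g (insert x S)) = p x * bexp P p (\<lambda>S. g (insert x S))"
    unfolding bexp_def sum_distrib_left by (intro sum.cong refl, subst w1) auto
  finally show ?thesis by simp
qed

lemma bexp_add: "bexp P p (\<lambda>S. g S + h S) = bexp P p g + bexp P p h"
  by (simp add: bexp_def algebra_simps sum.distrib)

lemma bexp_diff: "bexp P p (\<lambda>S. g S - h S) = bexp P p g - bexp P p h"
  by (simp add: bexp_def algebra_simps sum_subtractf)

lemma bexp_cmult: "bexp P p (\<lambda>S. c * g S) = c * bexp P p g"
  by (simp add: bexp_def sum_distrib_left algebra_simps)

lemma bexp_sum: "bexp P p (\<lambda>S. \<Sum>j\<in>J. g j S) = (\<Sum>j\<in>J. bexp P p (g j))"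
  unfolding bexp_def sum_distrib_left by (rule sum.swap)

lemma bexp_cong: "(\<And>S. S \<subseteq> P \<Longrightarrow> g S = h S) \<Longrightarrow> bexp P p g = bexp P p h"
  unfolding bexp_def by (intro sum.cong) auto

lemma bexp_mono:
  assumes "\<And>e. e \<in> P \<Longrightarrow> 0 \<le> p e \<and> p e \<le> 1" "\<And>S. S \<subseteq> P \<Longrightarrow> g S \<le> h S"
  shows "bexp P p g \<le> bexp P p h"
  unfolding bexp_def using assms by (intro sum_mono mult_left_mono prod_nonneg) auto

lemma bexp_prod:
  assumes "finite P"
  shows "bexp P p (\<lambda>S. \<Prod>e\<in>P. h e (e \<in> S)) = (\<Prod>e\<in>P. p e * h e True + (1 - p e) * h e False)"
  using assms
proof (induction P rule: finite_induct)
  case (insert x P)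
  have x: "e \<noteq> x" if "e \<in> P" for e using that insert by auto
  have [simp]: "(\<Prod>e\<in>P. h e (e = x \<or> e \<in> S)) = (\<Prod>e\<in>P. h e (e \<in> S))" for S
    by (intro prod.cong refl) (simp add: x)
  have xS: "x \<notin> S" if "S \<subseteq> P" for S using that x by blast
  have "bexp P p (\<lambda>S. h x (x \<in> S) * (\<Prod>e\<in>P. h e (e \<in> S))) = bexp P p (\<lambda>S. h x False * (\<Prod>e\<in>P. h e (e \<in> S)))"
    by (intro bexp_cong) (simp add: xS)
  then show ?case using insert by (simp add: bexp_insert bexp_cmult algebra_simps)
qed simp

lemma bexp_const:
  assumes "finite P"
  shows "bexp P p (\<lambda>S. c) = c"
  using bexp_prod[OF assms, of p "\<lambda>_ _. 1"] bexp_cmult[of P p c "\<lambda>_. 1"] by simp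

lemma bexp_nonneg:
  assumes "finite P" "\<And>e. e \<in> P \<Longrightarrow> 0 \<le> p e \<and> p e \<le> 1" "\<And>S. S \<subseteq> P \<Longrightarrow> 0 \<le> g S"
  shows "0 \<le> bexp P p g"
  using bexp_mono[of P p "\<lambda>_. 0" g] assms bexp_const[of P p 0] by simp

text \<open>Induction on the ground set. Conditioning on the new coordinate splits the variance into the mean
of the conditional variance and the variance of the conditional mean h. The former is the new
summand: a Bernoulli coordinate has conditional variance p (1 - p) times the squared increment,
and the factor 1 - p is the probability that the coordinate is absent, which is why the sum runs
over P - S. For the latter, increments of h are averages of increments of g, and squaring is
convex.\<close>

lemma efron_stein:
  assumes "finite P" "\<And>e. e \<in> P \<Longrightarrow> 0 \<le> p e \<and> p e \<le> 1"
  shows "bexp P p (\<lambda>S. (g S - bexp P p g)\<^sup>2)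
    \<le> bexp P p (\<lambda>S. \<Sum>e\<in>P - S. p e * (g (insert e S) - g S)\<^sup>2)"
proof -
  have "bexp P p (\<lambda>S. (g S)\<^sup>2) - (bexp P p g)\<^sup>2
    \<le> (\<Sum>e\<in>P. p e * bexp P p (\<lambda>S. if e \<in> S then 0 else (g (insert e S) - g S)\<^sup>2))"
    using assms
  proof (induction P arbitrary: g rule: finite_induct)
    case (insert x P)
    define q where "q = p x"
    have q: "0 \<le> q" "q \<le> 1" using insert by (auto simp: q_def)
    let ?E = "bexp P p"
    define g1 where "g1 = (\<lambda>S. g (insert x S))"
    define h where "h = (\<lambda>S. q * g1 S + (1 - q) * g S)"
    have eh: "?E h = q * ?E g1 + (1 - q) * ?E g" by (simp add: h_def bexp_add bexp_cmult)
    have sq: "?E (\<lambda>S. q * (g1 S)\<^sup>2 + (1 - q) * (g S)\<^sup>2) = ?E (\<lambda>S. (h S)\<^sup>2 + q * ((1 - q) * (g1 S - g S)\<^sup>2))"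
      by (rule bexp_cong) (simp add: h_def algebra_simps power2_eq_square)
    have lhs: "bexp (insert x P) p (\<lambda>S. (g S)\<^sup>2) - (bexp (insert x P) p g)\<^sup>2 =
       (?E (\<lambda>S. (h S)\<^sup>2) - (?E h)\<^sup>2) + q * ((1 - q) * ?E (\<lambda>S. (g1 S - g S)\<^sup>2))"
    proof -
      have "bexp (insert x P) p f = q * ?E (\<lambda>S. f (insert x S)) + (1 - q) * ?E f" for f
        unfolding q_def by (rule bexp_insert[OF insert(1,2)])
      then show ?thesis using sq by (simp add: eh bexp_add bexp_cmult g1_def)
    qed
    have termx: "bexp (insert x P) p (\<lambda>S. if x \<in> S then 0 else (g (insert x S) - g S)\<^sup>2)
      = (1 - q) * ?E (\<lambda>S. (g1 S - g S)\<^sup>2)"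
    proof -
      have "?E (\<lambda>S. if x \<in> S then 0 else (g (insert x S) - g S)\<^sup>2) = ?E (\<lambda>S. (g1 S - g S)\<^sup>2)"
        using insert by (intro bexp_cong) (auto simp: g1_def)
      then show ?thesis by (simp add: bexp_insert[OF insert(1,2)] q_def bexp_const[OF insert(1)])
    qed
    have terme: "?E (\<lambda>S. if e \<in> S then 0 else (h (insert e S) - h S)\<^sup>2) \<le>
        bexp (insert x P) p (\<lambda>S. if e \<in> S then 0 else (g (insert e S) - g S)\<^sup>2)" if "e \<in> P" for e
    proof -
      have g1_x: "g1 S = g (insert x S)" for S by (simp add: g1_def)
      have g1_ex: "g1 (insert e S) = g (insert e (insert x S))" for S
        unfolding g1_def by (rule arg_cong[of _ _ g]) auto
      have "e \<noteq> x" using that insert by auto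
      then have "bexp (insert x P) p (\<lambda>S. if e \<in> S then 0 else (g (insert e S) - g S)\<^sup>2) =
         ?E (\<lambda>S. q * (if e \<in> S then 0 else (g1 (insert e S) - g1 S)\<^sup>2) + (1 - q) * (if e \<in> S then 0 else (g (insert e S) - g S)\<^sup>2))"
        by (simp add: bexp_insert[OF insert(1,2)] bexp_add bexp_cmult q_def flip: g1_x g1_ex cong: if_cong)
      moreover have "(h (insert e S) - h S)\<^sup>2 \<le> q * (g1 (insert e S) - g1 S)\<^sup>2 + (1 - q) * (g (insert e S) - g S)\<^sup>2" for S
      proof -
        define u v where "u = g1 (insert e S) - g1 S" and "v = g (insert e S) - g S"
        have "h (insert e S) - h S = q * u + (1 - q) * v" by (simp add: h_def u_def v_def algebra_simps)
        moreover have "q * u\<^sup>2 + (1 - q) * v\<^sup>2 - (q * u + (1 - q) * v)\<^sup>2 = q * (1 - q) * (u - v)\<^sup>2"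
          by (simp add: algebra_simps power2_eq_square)
        moreover have "0 \<le> q * (1 - q) * (u - v)\<^sup>2" using q by simp
        ultimately show ?thesis by (simp add: u_def v_def)
      qed
      ultimately show ?thesis using insert by (auto intro!: bexp_mono)
    qed
    have "?E (\<lambda>S. (h S)\<^sup>2) - (?E h)\<^sup>2 \<le> (\<Sum>e\<in>P. p e * ?E (\<lambda>S. if e \<in> S then 0 else (h (insert e S) - h S)\<^sup>2))"
      using insert by auto
    also have "\<dots> \<le> (\<Sum>e\<in>P. p e * bexp (insert x P) p (\<lambda>S. if e \<in> S then 0 else (g (insert e S) - g S)\<^sup>2))"
      using insert terme by (intro sum_mono mult_left_mono) auto
    finally show ?case using insert(1,2) by (simp add: lhs termx q_def)
  qed simp
  also have "(\<Sum>e\<in>P. p e * bexp P p (\<lambda>S. if e \<in> S then 0 else (g (insert e S) - g S)\<^sup>2)) =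
     bexp P p (\<lambda>S. \<Sum>e\<in>P. p e * (if e \<in> S then 0 else (g (insert e S) - g S)\<^sup>2))"
    by (simp add: bexp_sum bexp_cmult)
  also have "\<dots> = bexp P p (\<lambda>S. \<Sum>e\<in>P - S. p e * (g (insert e S) - g S)\<^sup>2)"
    using assms(1) by (intro bexp_cong sum.mono_neutral_cong_right) auto
  finally have "bexp P p (\<lambda>S. (g S)\<^sup>2) - (bexp P p g)\<^sup>2 \<le> \<dots>" .
  moreover have "bexp P p (\<lambda>S. (g S - bexp P p g)\<^sup>2) = bexp P p (\<lambda>S. (g S)\<^sup>2) - (bexp P p g)\<^sup>2"
  proof -
    define c where "c = bexp P p g"
    have "bexp P p (\<lambda>S. (g S - c)\<^sup>2) = bexp P p (\<lambda>S. (g S)\<^sup>2 + c\<^sup>2 - (2 * c) * g S)"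
      by (intro bexp_cong) (simp add: power2_diff)
    also have "\<dots> = bexp P p (\<lambda>S. (g S)\<^sup>2) - c\<^sup>2"
      by (simp add: bexp_add bexp_diff bexp_cmult bexp_const[OF assms(1)] c_def power2_eq_square)
    finally show ?thesis by (simp add: c_def)
  qed
  ultimately show ?thesis by simp
qed

section \<open>Moments of powers of the noise matrix\<close>

text \<open>The independent entries of a symmetric matrix are indexed by the pairs on or above the diagonal.\<close>

definition pairs :: "nat \<Rightarrow> (nat \<times> nat) set" where
  "pairs N = {(a, b). a \<le> b \<and> b < N}"

definition edge :: "nat \<Rightarrow> nat \<Rightarrow> nat \<times> nat" where
  "edge a b = (min a b, max a b)"

lemma finite_pairs [simp]: "finite (pairs N)"
  by (rule finite_subset[of _ "{..<N} \<times> {..<N}"]) (auto simp: pairs_def)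

lemma edge_in_pairs [simp]: "a < N \<Longrightarrow> b < N \<Longrightarrow> edge a b \<in> pairs N"
  by (auto simp: edge_def pairs_def)

lemma edge_commute: "edge a b = edge b a"
  by (simp add: edge_def min.commute max.commute)

definition noise :: "(nat \<times> nat \<Rightarrow> real) \<Rightarrow> (nat \<times> nat) set \<Rightarrow> nat \<Rightarrow> nat \<Rightarrow> real" where
  "noise p S a b = of_bool (edge a b \<in> S) - p (edge a b)"

fun walk_edges :: "nat \<Rightarrow> nat list \<Rightarrow> (nat \<times> nat) list" where
  "walk_edges a [] = []"
| "walk_edges a (x # xs) = edge a x # walk_edges x xs"

definition walks :: "nat set \<Rightarrow> nat \<Rightarrow> nat list set" where
  "walks A n = {xs. set xs \<subseteq> A \<and> length xs = n}"

lemma finite_walks: "finite A \<Longrightarrow> finite (walks A n)"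
  unfolding walks_def by (rule finite_lists_length_eq)

lemma card_walks: "finite A \<Longrightarrow> card (walks A n) = card A ^ n"
  unfolding walks_def by (rule card_lists_length_eq)

lemma sum_lists_Suc:
  fixes f :: "'b list \<Rightarrow> real"
  assumes "finite A"
  shows "(\<Sum>xs\<in>{xs. set xs \<subseteq> A \<and> length xs = Suc n}. f xs)
    = (\<Sum>x\<in>A. \<Sum>xs\<in>{xs. set xs \<subseteq> A \<and> length xs = n}. f (x # xs))"
proof -
  have eq: "{xs. set xs \<subseteq> A \<and> length xs = Suc n} =
      (\<lambda>(x, xs). x # xs) ` (A \<times> {xs. set xs \<subseteq> A \<and> length xs = n})"
    by (auto simp: image_iff length_Suc_conv)
  have "(\<Sum>xs\<in>{xs. set xs \<subseteq> A \<and> length xs = Suc n}. f xs) =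
     (\<Sum>z\<in>A \<times> {xs. set xs \<subseteq> A \<and> length xs = n}. f (fst z # snd z))"
    unfolding eq by (subst sum.reindex) (auto simp: inj_on_def case_prod_beta)
  then show ?thesis by (simp add: sum.cartesian_product case_prod_beta)
qed

lemma mvec_power_walks:
  "((mvec N H) ^^ n) c a =
    (\<Sum>xs\<in>walks {..<N} n. prod_list (map (\<lambda>(u, v). H u v) (zip (a # xs) xs)) * c (last (a # xs)))"
proof (induction n arbitrary: a)
  case 0
  have "walks {..<N} 0 = {[]}" by (auto simp: walks_def)
  then show ?case by simp
next
  case (Suc n)
  show ?case
    unfolding walks_def
    by (subst sum_lists_Suc) (simp_all add: mvec_def Suc.IH[unfolded walks_def] sum_distrib_left mult.assoc)
qed

lemma power_sum_lists:
  fixes t :: "'b \<Rightarrow> real"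
  assumes "finite X"
  shows "(\<Sum>x\<in>X. t x) ^ m = (\<Sum>ys\<in>{ys. set ys \<subseteq> X \<and> length ys = m}. prod_list (map t ys))"
proof (induction m)
  case 0
  have "{ys. set ys \<subseteq> X \<and> length ys = 0} = {[]}" by auto
  then show ?case by simp
next
  case (Suc m)
  then show ?case by (subst sum_lists_Suc[OF assms]) (simp add: sum_product)
qed

text \<open>A centred Bernoulli factor that occurs once has expectation zero, and one that occurs several
times still costs only a single factor q. Both facts drive the walk count.\<close>

lemma bernoulli_central_moment:
  fixes p q :: real
  assumes "0 \<le> p" "p \<le> q" "q \<le> 1"
  shows "\<bar>p * (1 - p) ^ m + (1 - p) * (- p) ^ m\<bar> \<le> (if m = 0 then 1 else if m = 1 then 0 else q)"
proof -
  consider "m = 0" | "m = 1" | k where "m = Suc (Suc k)"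
    by (metis One_nat_def not0_implies_Suc)
  then show ?thesis
  proof cases
    case 3
    have "(1 - p) ^ m \<le> (1 - p) ^ 1" "p ^ m \<le> p ^ 1"
      using assms 3 by (intro power_decreasing; simp)+
    then have b: "p * (1 - p) ^ m \<le> p * (1 - p)" "(1 - p) * p ^ m \<le> (1 - p) * p"
      using assms by (auto intro!: mult_left_mono)
    have "(1 - p) * p ^ m \<le> (1 - p) * p\<^sup>2"
      using assms 3 by (intro mult_left_mono power_decreasing) auto
    then have "p * (1 - p) ^ m + (1 - p) * p ^ m \<le> p * (1 - p) + (1 - p) * p\<^sup>2" using b by linarith
    also have "\<dots> = p - p * p\<^sup>2" by (simp add: algebra_simps power2_eq_square)
    also have "\<dots> \<le> q" proof -
      have "0 \<le> p * p\<^sup>2" using assms by simp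
      then show ?thesis using assms by linarith
    qed
    finally have "p * (1 - p) ^ m + (1 - p) * p ^ m \<le> q" .
    moreover have "\<bar>p * (1 - p) ^ m + (1 - p) * (- p) ^ m\<bar> \<le> p * (1 - p) ^ m + (1 - p) * p ^ m"
      using assms by (intro order_trans[OF abs_triangle_ineq]) (simp add: abs_mult power_abs)
    ultimately show ?thesis using 3 by simp
  qed auto
qed

lemma prod_list_map_count:
  fixes f :: "'b \<Rightarrow> real"
  assumes "finite P" "set es \<subseteq> P"
  shows "prod_list (map f es) = (\<Prod>e\<in>P. f e ^ count_list es e)"
  using assms(2)
proof (induction es)
  case (Cons x es)
  have "(\<Prod>e\<in>P. f e ^ count_list (x # es) e) = (\<Prod>e\<in>P. (if e = x then f x else 1) * f e ^ count_list es e)"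
    by (intro prod.cong) auto
  also have "\<dots> = f x * (\<Prod>e\<in>P. f e ^ count_list es e)"
    using Cons assms(1) by (simp add: prod.distrib)
  finally show ?case using Cons by simp
qed simp

lemma length_ge_twice_card:
  assumes "\<And>e. e \<in> set es \<Longrightarrow> count_list es e \<ge> 2"
  shows "2 * card (set es) \<le> length es"
proof -
  have "2 * card (set es) = (\<Sum>e\<in>set es. 2)" by simp
  also have "\<dots> \<le> (\<Sum>e\<in>set es. count_list es e)" using assms by (intro sum_mono) auto
  also have "\<dots> = length es" by (rule sum_count_set) auto
  finally show ?thesis .
qed

text \<open>By independence the expectation factorises over the distinct edges. It vanishes unless every edge
occurs at least twice, and then there are at most half as many distinct edges as factors.\<close>

lemma expected_edge_product_bound:
  fixes p :: "'e \<Rightarrow> real"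
  assumes P: "finite P" "\<And>e. e \<in> P \<Longrightarrow> 0 \<le> p e \<and> p e \<le> q" "q \<le> 1" and es: "set es \<subseteq> P"
  shows "\<bar>bexp P p (\<lambda>S. prod_list (map (\<lambda>e. of_bool (e \<in> S) - p e) es))\<bar>
    \<le> (if 2 * card (set es) \<le> length es then q ^ card (set es) else 0)"
proof -
  have "bexp P p (\<lambda>S. prod_list (map (\<lambda>e. of_bool (e \<in> S) - p e) es))
    = bexp P p (\<lambda>S. \<Prod>e\<in>P. (of_bool (e \<in> S) - p e) ^ count_list es e)"
    by (intro bexp_cong prod_list_map_count P es)
  also have "\<dots> = (\<Prod>e\<in>P. p e * (1 - p e) ^ count_list es e + (1 - p e) * (- p e) ^ count_list es e)"
    using bexp_prod[OF P(1), of p "\<lambda>e b. (of_bool b - p e) ^ count_list es e"] by simp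
  finally have eq: "\<bar>bexp P p (\<lambda>S. prod_list (map (\<lambda>e. of_bool (e \<in> S) - p e) es))\<bar>
     = (\<Prod>e\<in>P. \<bar>p e * (1 - p e) ^ count_list es e + (1 - p e) * (- p e) ^ count_list es e\<bar>)"
    by (simp add: abs_prod)
  have q0: "0 \<le> q" if "e \<in> P" for e using P(2)[OF that] by linarith
  show ?thesis
  proof (cases "\<exists>e\<in>set es. count_list es e < 2")
    case True
    then obtain e where e: "e \<in> set es" "count_list es e < 2" by blast
    then have "count_list es e = 1" using count_list_0_iff[of es e] by (cases "count_list es e") auto
    then have "\<bar>p e * (1 - p e) ^ count_list es e + (1 - p e) * (- p e) ^ count_list es e\<bar> = 0" by simp
    then have "(\<Prod>e\<in>P. \<bar>p e * (1 - p e) ^ count_list es e + (1 - p e) * (- p e) ^ count_list es e\<bar>) = 0"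
      using e es P(1) by (meson prod_zero subsetD)
    then show ?thesis unfolding eq using q0 e es by (auto intro!: zero_le_power)
  next
    case False
    have "(\<Prod>e\<in>P. \<bar>p e * (1 - p e) ^ count_list es e + (1 - p e) * (- p e) ^ count_list es e\<bar>)
       \<le> (\<Prod>e\<in>P. if e \<in> set es then q else 1)"
    proof (rule prod_mono, rule conjI)
      fix e assume e: "e \<in> P"
      show "\<bar>p e * (1 - p e) ^ count_list es e + (1 - p e) * (- p e) ^ count_list es e\<bar> \<le> (if e \<in> set es then q else 1)"
        using bernoulli_central_moment[of "p e" q "count_list es e"] P(2)[OF e] P(3) False
        by (cases "e \<in> set es") (auto simp: count_list_0_iff split: if_splits)
    qed simp
    also have "\<dots> = q ^ card (set es)"
      using P(1) es by (simp add: prod.If_cases Int_absorb1)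
    finally show ?thesis using length_ge_twice_card[of es] False unfolding eq by (auto simp: not_less)
  qed
qed

text \<open>A walk that starts in V enters each vertex outside V for the first time through an edge not used
before, so adding the walk raises the number of edges at least as much as the number of vertices.\<close>

lemma walk_vertices_edges:
  assumes "finite V" "finite F" "F \<subseteq> {edge u v |u v. u \<in> V \<and> v \<in> V}" "card V \<le> card F + 1" "a \<in> V"
  shows "F \<union> set (walk_edges a xs) \<subseteq> {edge u v |u v. u \<in> V \<union> set xs \<and> v \<in> V \<union> set xs} \<and>
    card (V \<union> set xs) \<le> card (F \<union> set (walk_edges a xs)) + 1"
  using assms
proof (induction xs arbitrary: V F a)
  case (Cons x xs)
  let ?V = "insert x V" and ?F = "insert (edge a x) F"
  have sub: "?F \<subseteq> {edge u v |u v. u \<in> ?V \<and> v \<in> ?V}" using Cons.prems by blast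
  have "card ?V \<le> card ?F + 1"
  proof (cases "x \<in> V")
    case True
    then show ?thesis using Cons.prems by (simp add: insert_absorb card_insert_if)
  next
    case False
    have "edge a x \<notin> F"
    proof
      assume "edge a x \<in> F"
      then obtain u v where "edge a x = edge u v" "u \<in> V" "v \<in> V" using Cons.prems by blast
      then have "x = u \<or> x = v" by (auto simp: edge_def min_def max_def split: if_splits)
      then show False using False \<open>u \<in> V\<close> \<open>v \<in> V\<close> by blast
    qed
    then show ?thesis using False Cons.prems by simp
  qed
  with Cons.IH[of ?V ?F x] sub Cons.prems show ?case by simp
qed auto

lemma star_vertices_edges:
  "set (concat (map (walk_edges a) ys)) \<subseteq>
      {edge u v |u v. u \<in> insert a (\<Union>(set ` set ys)) \<and> v \<in> insert a (\<Union>(set ` set ys))} \<and>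
   card (insert a (\<Union>(set ` set ys))) \<le> card (set (concat (map (walk_edges a) ys))) + 1"
proof (induction ys)
  case (Cons y ys)
  let ?V = "insert a (\<Union>(set ` set ys))" and ?F = "set (concat (map (walk_edges a) ys))"
  have "?F \<union> set (walk_edges a y) \<subseteq> {edge u v |u v. u \<in> ?V \<union> set y \<and> v \<in> ?V \<union> set y} \<and>
    card (?V \<union> set y) \<le> card (?F \<union> set (walk_edges a y)) + 1"
    using Cons by (intro walk_vertices_edges) auto
  moreover have "?V \<union> set y = insert a (\<Union>(set ` set (y # ys)))" by auto
  moreover have "?F \<union> set (walk_edges a y) = set (concat (map (walk_edges a) (y # ys)))" by auto
  ultimately show ?case by metis
qed simp

lemma length_walk_edges [simp]: "length (walk_edges a xs) = length xs"
  by (induction xs arbitrary: a) auto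

lemma walk_edges_in_pairs: "a < N \<Longrightarrow> set xs \<subseteq> {..<N} \<Longrightarrow> set (walk_edges a xs) \<subseteq> pairs N"
  by (induction xs arbitrary: a) auto

lemma walk_noise:
  "map (\<lambda>(u, v). noise p S u v) (zip (a # xs) xs) = map (\<lambda>e. of_bool (e \<in> S) - p e) (walk_edges a xs)"
  by (induction xs arbitrary: a) (auto simp: noise_def)

lemma sum_power_card_subsets:
  fixes q :: real
  assumes "finite A" "0 \<le> q" "card A * q \<le> R" "1 \<le> R"
  shows "(\<Sum>U\<in>{U. U \<subseteq> A \<and> card U \<le> m}. q ^ card U) \<le> (real m + 1) * R ^ m"
proof -
  have eq: "{U. U \<subseteq> A \<and> card U \<le> m} = (\<Union>k\<in>{..m}. {U. U \<subseteq> A \<and> card U = k})" by auto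
  have "(\<Sum>U\<in>{U. U \<subseteq> A \<and> card U \<le> m}. q ^ card U) = (\<Sum>k\<le>m. \<Sum>U\<in>{U. U \<subseteq> A \<and> card U = k}. q ^ card U)"
    unfolding eq using assms(1) by (subst sum.UNION_disjoint) auto
  also have "\<dots> = (\<Sum>k\<le>m. real (card A choose k) * q ^ k)"
    using assms(1) by (intro sum.cong) (auto simp: n_subsets)
  also have "\<dots> \<le> (\<Sum>k\<le>m. R ^ m)"
  proof (rule sum_mono)
    fix k assume k: "k \<in> {..m}"
    have "card A choose k \<le> card A ^ k"
      by (cases "k \<le> card A") (auto simp: binomial_le_pow binomial_eq_0)
    then have "real (card A choose k) * q ^ k \<le> real (card A ^ k) * q ^ k"
      using assms by (intro mult_right_mono) (auto simp del: of_nat_power)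
    also have "\<dots> = (real (card A) * q) ^ k" by (simp add: power_mult_distrib)
    also have "\<dots> \<le> R ^ k" using assms by (intro power_mono) auto
    also have "\<dots> \<le> R ^ m" using assms k by (intro power_increasing) auto
    finally show "real (card A choose k) * q ^ k \<le> R ^ m" .
  qed
  also have "\<dots> = (real m + 1) * R ^ m" by simp
  finally show ?thesis .
qed

text \<open>Expand the fourth power into quadruples of walks of length n starting at a. By
expected_edge_product_bound a quadruple with m distinct edges contributes at most q ^ m, and
nothing if m > 2 n. The walks together form a connected graph, so the vertex set insert a U
satisfies card U \<le> m; hence the quadruple contributes at most q ^ card U, and only sets U with
at most 2 n elements matter. At most (2 n + 1) ^ (4 n) quadruples stay inside such a vertex set,
and summing q ^ card U over all U gives the factor R ^ (2 n).\<close>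

lemma noise_power_fourth_moment:
  assumes p: "\<And>e. e \<in> pairs N \<Longrightarrow> 0 \<le> p e \<and> p e \<le> q" and q: "q \<le> 1" "real N * q \<le> R" "1 \<le> R"
    and c: "\<And>b. b < N \<Longrightarrow> \<bar>c b\<bar> \<le> 1" and a: "a < N"
  shows "bexp (pairs N) p (\<lambda>S. (((mvec N (noise p S)) ^^ n) c a) ^ 4)
    \<le> (2 * real n + 1) ^ (4 * n + 1) * R ^ (2 * n)"
proof -
  let ?P = "pairs N"
  let ?w = "\<lambda>S e. of_bool (e \<in> S) - p e :: real"
  define Y where "Y = {ys. set ys \<subseteq> walks {..<N} n \<and> length ys = 4}"
  define es where "es = (\<lambda>ys. concat (map (walk_edges a) ys))"
  define C where "C = (\<lambda>ys. prod_list (map (\<lambda>xs. c (last (a # xs))) ys))"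
  define V where "V = (\<lambda>ys. insert a (\<Union>(set ` set ys)) :: nat set)"
  have q0: "0 \<le> q" using p[of "(a, a)"] a by (auto simp: pairs_def intro: order_trans)
  have finY: "finite Y" unfolding Y_def by (intro finite_lists_length_eq finite_walks) simp
  have expand: "(((mvec N (noise p S)) ^^ n) c a) ^ 4 = (\<Sum>ys\<in>Y. C ys * prod_list (map (?w S) (es ys)))" for S
  proof -
    have pl: "prod_list (map (\<lambda>xs. prod_list (map (?w S) (walk_edges a xs)) * c (last (a # xs))) ys)
        = C ys * prod_list (map (?w S) (es ys))" for ys
      unfolding C_def es_def by (induction ys) (simp_all add: mult.assoc mult.left_commute del: last.simps)
    show ?thesis
      unfolding mvec_power_walks walk_noise Y_def
      by (subst power_sum_lists) (auto intro!: finite_walks sum.cong simp: pl simp del: last.simps)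
  qed
  have Y: "set y \<subseteq> {..<N}" "length y = n" if "ys \<in> Y" "y \<in> set ys" for y ys
    using that by (auto simp: Y_def walks_def)
  have esP: "set (es ys) \<subseteq> ?P" if "ys \<in> Y" for ys
    using walk_edges_in_pairs[OF a Y(1)[OF that]] by (auto simp: es_def)
  have les: "length (es ys) = 4 * n" if "ys \<in> Y" for ys
  proof -
    have "length (es ys) = sum_list (map length ys)" by (simp add: es_def length_concat comp_def)
    also have "\<dots> = sum_list (map (\<lambda>_. n) ys)" using Y(2)[OF that] by (intro arg_cong[where f=sum_list] map_cong) auto
    also have "\<dots> = 4 * n" using that by (simp add: Y_def sum_list_triv)
    finally show ?thesis .
  qed
  have Cle: "\<bar>C ys\<bar> \<le> 1" if "ys \<in> Y" for ys
  proof -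
    have "\<bar>prod_list (map (\<lambda>xs. c (last (a # xs))) zs)\<bar> \<le> 1" if "\<forall>z\<in>set zs. set z \<subseteq> {..<N}" for zs
      using that
    proof (induction zs)
      case (Cons z zs)
      have "last (a # z) < N" using Cons.prems a by (cases z rule: rev_cases) auto
      then have "\<bar>c (last (a # z))\<bar> * \<bar>prod_list (map (\<lambda>xs. c (last (a # xs))) zs)\<bar> \<le> 1 * 1"
        using Cons c by (intro mult_mono) auto
      then show ?case by (simp add: abs_mult)
    qed simp
    then show ?thesis using Y(1)[OF that] by (simp add: C_def)
  qed
  \<comment> \<open>The possible vertex sets of a nonvanishing quadruple, without the starting point a.\<close>
  define UU where "UU = {U. U \<subseteq> {..<N} - {a} \<and> card U \<le> 2 * n}"
  have finUU: "finite UU" by (auto simp: UU_def)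
  have termwise: "C ys * bexp ?P p (\<lambda>S. prod_list (map (?w S) (es ys)))
     \<le> (\<Sum>U\<in>UU. if \<Union>(set ` set ys) \<subseteq> insert a U then q ^ card U else 0)" (is "?l \<le> ?r")
    if ys: "ys \<in> Y" for ys
  proof -
    have r0: "0 \<le> ?r" using q0 by (intro sum_nonneg) auto
    have "?l \<le> \<bar>C ys\<bar> * \<bar>bexp ?P p (\<lambda>S. prod_list (map (?w S) (es ys)))\<bar>"
      by (simp flip: abs_mult)
    also have "\<dots> \<le> 1 * \<bar>bexp ?P p (\<lambda>S. prod_list (map (?w S) (es ys)))\<bar>"
      using Cle[OF ys] by (intro mult_right_mono) auto
    also have "\<dots> \<le> (if 2 * card (set (es ys)) \<le> 4 * n then q ^ card (set (es ys)) else 0)"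
      using expected_edge_product_bound[of ?P p q "es ys"] p q esP[OF ys] les[OF ys] by simp
    also have "\<dots> \<le> ?r"
    proof (cases "2 * card (set (es ys)) \<le> 4 * n")
      case True
      define U where "U = V ys - {a}"
      have fV: "finite (V ys)" by (auto simp: V_def)
      have cV: "card (V ys) \<le> card (set (es ys)) + 1"
        using star_vertices_edges[of a ys] by (simp add: V_def es_def)
      have cU: "card U \<le> card (set (es ys))" 
      proof -
        have "a \<in> V ys" by (simp add: V_def)
        then have "card U = card (V ys) - 1" unfolding U_def by (rule card_Diff_singleton)
        then show ?thesis using cV by simp
      qed
      have "U \<subseteq> {..<N} - {a}" using Y(1)[OF ys] by (auto simp: U_def V_def)
      then have UU: "U \<in> UU" using cU True by (auto simp: UU_def)
      have "q ^ card (set (es ys)) \<le> q ^ card U" using cU q0 q by (intro power_decreasing) auto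
      also have "\<dots> = (if \<Union>(set ` set ys) \<subseteq> insert a U then q ^ card U else 0)" by (auto simp: U_def V_def)
      also have "\<dots> \<le> ?r" using UU finUU q0 by (intro member_le_sum) auto
      finally show ?thesis using True by simp
    qed (use r0 in auto)
    finally show ?thesis .
  qed
  have count: "(\<Sum>ys\<in>Y. if \<Union>(set ` set ys) \<subseteq> insert a U then q ^ card U else 0)
      \<le> (2 * real n + 1) ^ (4 * n) * q ^ card U" if U: "U \<in> UU" for U
  proof -
    have fU: "finite (insert a U)" "card (insert a U) \<le> 2 * n + 1"
    proof -
      have "finite U" using U finite_subset[of U "{..<N} - {a}"] by (simp add: UU_def)
      then show "finite (insert a U)" "card (insert a U) \<le> 2 * n + 1"
        using U by (auto simp: UU_def card_insert_if)
    qed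
    have "(\<Sum>ys\<in>Y. if \<Union>(set ` set ys) \<subseteq> insert a U then q ^ card U else 0)
      = (\<Sum>ys\<in>{ys\<in>Y. \<Union>(set ` set ys) \<subseteq> insert a U}. q ^ card U)"
      using finY by (intro sum.mono_neutral_cong_right) auto
    also have "\<dots> = real (card {ys\<in>Y. \<Union>(set ` set ys) \<subseteq> insert a U}) * q ^ card U" by simp
    also have "real (card {ys\<in>Y. \<Union>(set ` set ys) \<subseteq> insert a U}) * q ^ card U
        \<le> (2 * real n + 1) ^ (4 * n) * q ^ card U"
    proof (intro mult_right_mono)
    have "card {ys\<in>Y. \<Union>(set ` set ys) \<subseteq> insert a U} \<le> card {ys. set ys \<subseteq> walks (insert a U) n \<and> length ys = 4}"
      using fU by (intro card_mono finite_lists_length_eq finite_walks) (auto simp: Y_def walks_def)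
    also have "\<dots> = card (insert a U) ^ (n * 4)"
      using fU by (simp add: card_lists_length_eq finite_walks card_walks power_mult)
    also have "\<dots> \<le> (2 * n + 1) ^ (n * 4)" using fU by (intro power_mono) auto
    finally have "real (card {ys\<in>Y. \<Union>(set ` set ys) \<subseteq> insert a U}) \<le> real ((2 * n + 1) ^ (n * 4))"
      by (simp only: of_nat_le_iff)
    then show "real (card {ys\<in>Y. \<Union>(set ` set ys) \<subseteq> insert a U}) \<le> (2 * real n + 1) ^ (4 * n)"
      by (simp add: mult.commute add.commute)
    qed (use q0 in simp)
    finally show ?thesis .
  qed
  have "bexp ?P p (\<lambda>S. (((mvec N (noise p S)) ^^ n) c a) ^ 4)
     = (\<Sum>ys\<in>Y. C ys * bexp ?P p (\<lambda>S. prod_list (map (?w S) (es ys))))"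
    by (simp add: expand bexp_sum bexp_cmult)
  also have "\<dots> \<le> (\<Sum>ys\<in>Y. \<Sum>U\<in>UU. if \<Union>(set ` set ys) \<subseteq> insert a U then q ^ card U else 0)"
    by (intro sum_mono termwise)
  also have "\<dots> = (\<Sum>U\<in>UU. \<Sum>ys\<in>Y. if \<Union>(set ` set ys) \<subseteq> insert a U then q ^ card U else 0)"
    by (rule sum.swap)
  also have "\<dots> \<le> (\<Sum>U\<in>UU. (2 * real n + 1) ^ (4 * n) * q ^ card U)" by (intro sum_mono count)
  also have "\<dots> = (2 * real n + 1) ^ (4 * n) * (\<Sum>U\<in>UU. q ^ card U)" by (simp add: sum_distrib_left)
  also have "\<dots> \<le> (2 * real n + 1) ^ (4 * n) * ((real (2 * n) + 1) * R ^ (2 * n))"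
  proof (intro mult_left_mono)
    have "real (card ({..<N} - {a})) * q \<le> real N * q" using q0 by (intro mult_right_mono) (auto simp: card_Diff_singleton_if)
    then show "(\<Sum>U\<in>UU. q ^ card U) \<le> (real (2 * n) + 1) * R ^ (2 * n)"
      unfolding UU_def using q q0 by (intro sum_power_card_subsets) auto
  qed simp
  finally show ?thesis by (simp add: mult_ac)
qed

section \<open>Norm of the noise and delocalization of eigenvectors\<close>

lemma mvec_pow_sum:
  "((mvec N W) ^^ n) (\<lambda>a. \<Sum>j\<in>J. c j * f j a) = (\<lambda>a. \<Sum>j\<in>J. c j * ((mvec N W) ^^ n) (f j) a)"
  by (induction n) (simp_all add: mvec_linear)

lemma mvec_pow_add_scale:
  "((mvec N W) ^^ n) (\<lambda>a. x a + c * y a) = (\<lambda>a. ((mvec N W) ^^ n) x a + c * ((mvec N W) ^^ n) y a)"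
  by (induction n) (simp_all add: mvec_linear)

lemma mvec_pow_cong:
  "(\<And>a. a < N \<Longrightarrow> x a = y a) \<Longrightarrow> a < N \<Longrightarrow> ((mvec N W) ^^ n) x a = ((mvec N W) ^^ n) y a"
proof (induction n arbitrary: a)
  case (Suc n)
  then have "mvec N W (((mvec N W) ^^ n) x) = mvec N W (((mvec N W) ^^ n) y)" by (intro mvec_cong) auto
  then show ?case by simp
qed simp

lemma vnorm_mvec_pow_le:
  assumes "\<And>x. vnorm N (mvec N W x) \<le> s * vnorm N x" "0 \<le> s"
  shows "vnorm N (((mvec N W) ^^ n) x) \<le> s ^ n * vnorm N x"
proof (induction n)
  case (Suc n)
  have "vnorm N (mvec N W (((mvec N W) ^^ n) x)) \<le> s * vnorm N (((mvec N W) ^^ n) x)" by (rule assms)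
  also have "\<dots> \<le> s * (s ^ n * vnorm N x)" using Suc assms by (intro mult_left_mono) auto
  finally show ?case by (simp add: mult_ac)
qed simp

lemma sum_power4_le: "(\<Sum>i\<in>I. x i :: real) ^ 4 \<le> real (card I) ^ 3 * (\<Sum>i\<in>I. x i ^ 4)"
proof -
  have sq: "(\<Sum>i\<in>I. y i :: real)\<^sup>2 \<le> real (card I) * (\<Sum>i\<in>I. (y i)\<^sup>2)" for y
    using sum_squared_le_sum_of_squares[of y I] by (simp add: mult.commute)
  have "(\<Sum>i\<in>I. x i) ^ 4 = ((\<Sum>i\<in>I. x i)\<^sup>2)\<^sup>2" by simp
  also have "\<dots> \<le> (real (card I) * (\<Sum>i\<in>I. (x i)\<^sup>2))\<^sup>2" by (intro power_mono sq) auto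
  also have "\<dots> = (real (card I))\<^sup>2 * (\<Sum>i\<in>I. (x i)\<^sup>2)\<^sup>2" by (simp add: power_mult_distrib)
  also have "\<dots> \<le> (real (card I))\<^sup>2 * (real (card I) * (\<Sum>i\<in>I. ((x i)\<^sup>2)\<^sup>2))" by (intro mult_left_mono sq) auto
  also have "\<dots> = real (card I) ^ 3 * (\<Sum>i\<in>I. x i ^ 4)"
    by (simp add: power2_eq_square power3_eq_cube power4_eq_xxxx mult.assoc)
  finally show ?thesis .
qed

text \<open>One square in each summand is bounded by the sum of all squares.\<close>

lemma sum_fourth_le_vnorm: "(\<Sum>a<N. x a ^ 4) \<le> vnorm N x ^ 4"
proof -
  have "(\<Sum>a<N. x a ^ 4) \<le> (\<Sum>a<N. (x a)\<^sup>2 * dotp N x x)"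
  proof (rule sum_mono)
    fix a assume "a \<in> {..<N}"
    then have "(x a)\<^sup>2 \<le> dotp N x x"
      unfolding dotp_def power2_eq_square[symmetric] by (intro member_le_sum) auto
    then have "(x a)\<^sup>2 * (x a)\<^sup>2 \<le> (x a)\<^sup>2 * dotp N x x" by (intro mult_left_mono) auto
    then show "x a ^ 4 \<le> (x a)\<^sup>2 * dotp N x x" by (simp add: power2_eq_square power4_eq_xxxx mult.assoc)
  qed
  also have "\<dots> = dotp N x x * dotp N x x"
    by (simp add: sum_distrib_right[symmetric] dotp_def power2_eq_square)
  also have "\<dots> = (vnorm N x)\<^sup>2 * (vnorm N x)\<^sup>2" by (simp add: vnorm_square)
  also have "\<dots> = vnorm N x ^ 4" by (simp add: power2_eq_square power4_eq_xxxx mult.assoc)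
  finally show ?thesis .
qed

text \<open>For symmetric W the norms of W^j x are log-convex in j, so a vector that is stretched by more than
s in the first step is stretched by at least s in every later step.\<close>

lemma norm_power_lower:
  assumes W: "symm N W" and s: "0 < s" and x: "s * vnorm N x < vnorm N (mvec N W x)"
  shows "s ^ n * vnorm N x \<le> vnorm N (((mvec N W) ^^ n) x) \<and> 0 < vnorm N x"
proof -
  let ?r = "\<lambda>j. vnorm N (((mvec N W) ^^ j) x)"
  have x0: "0 < vnorm N x"
  proof (rule ccontr)
    assume "\<not> 0 < vnorm N x"
    then have "dotp N x x = 0" using vnorm_nonneg[of N x] vnorm_square[of N x] by simp
    then have "mvec N W x a = 0" for a by (simp add: dotp_self_eq_0_iff mvec_def)
    then have "vnorm N (mvec N W x) = 0" by (simp add: vnorm_def dotp_def)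
    moreover have "vnorm N x = 0" using \<open>dotp N x x = 0\<close> by (simp add: vnorm_def)
    ultimately show False using x by simp
  qed
  have step: "0 < ?r j \<and> s * ?r j \<le> ?r (Suc j)" for j
  proof (induction j)
    case (Suc j)
    have "(?r (Suc j))\<^sup>2 = dotp N (((mvec N W) ^^ j) x) (((mvec N W) ^^ Suc (Suc j)) x)"
      unfolding vnorm_square by (simp add: dotp_mvec_symm[OF W])
    also have "\<dots> \<le> ?r j * ?r (Suc (Suc j))"
      using dotp_Cauchy_Schwarz by (rule order_trans[OF abs_ge_self])
    finally have le: "?r (Suc j) * ?r (Suc j) \<le> ?r j * ?r (Suc (Suc j))" by (simp add: power2_eq_square)
    have pos: "0 < ?r (Suc j)" using Suc s by (metis less_le_trans mult_pos_pos)
    have "s * ?r j * ?r (Suc j) \<le> ?r (Suc j) * ?r (Suc j)" using Suc by (intro mult_right_mono) auto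
    then have "?r j * (s * ?r (Suc j)) \<le> ?r j * ?r (Suc (Suc j))" using le by (simp add: mult_ac)
    then have "s * ?r (Suc j) \<le> ?r (Suc (Suc j))" using Suc by (simp add: mult_le_cancel_left)
    then show ?case using pos by blast
  qed (use x x0 in auto)
  have "s ^ n * vnorm N x \<le> ?r n"
  proof (induction n)
    case (Suc n)
    have "s * (s ^ n * vnorm N x) \<le> s * ?r n" using Suc s by (intro mult_left_mono) auto
    then show ?case using step[of n] by simp
  qed simp
  then show ?thesis using x0 by blast
qed

text \<open>The operator norm of W^n is at most the Frobenius norm, and the sum of squares of the entries is
compared with the sum of fourth powers by the Cauchy-Schwarz inequality.\<close>

lemma operator_norm_le_fourth_powers:
  assumes W: "symm N W" and s: "0 < s" and x: "s * vnorm N x < vnorm N (mvec N W x)"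
  shows "s ^ (4 * n) \<le> (real N)\<^sup>2 * (\<Sum>b<N. \<Sum>a<N. (((mvec N W) ^^ n) (\<lambda>c. of_bool (c = b)) a) ^ 4)"
proof -
  define M where "M = (\<lambda>b a. ((mvec N W) ^^ n) (\<lambda>c. of_bool (c = b)) a)"
  note low = norm_power_lower[OF assms, of n]
  have ex: "((mvec N W) ^^ n) x a = (\<Sum>b<N. x b * M b a)" if "a < N" for a
  proof -
    have "((mvec N W) ^^ n) x a = ((mvec N W) ^^ n) (\<lambda>c. \<Sum>b<N. x b * of_bool (c = b)) a"
      using that by (intro mvec_pow_cong) (auto simp: of_bool_def if_distrib cong: if_cong)
    then show ?thesis by (simp only: mvec_pow_sum M_def)
  qed
  define F where "F = (\<Sum>b<N. \<Sum>a<N. (M b a)\<^sup>2)"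
  have "(s ^ n * vnorm N x)\<^sup>2 \<le> (vnorm N (((mvec N W) ^^ n) x))\<^sup>2"
    using low s by (intro power_mono) auto
  also have "\<dots> = (\<Sum>a<N. (\<Sum>b<N. x b * M b a)\<^sup>2)"
    unfolding vnorm_square dotp_def by (intro sum.cong) (auto simp: ex power2_eq_square)
  also have "\<dots> \<le> (\<Sum>a<N. (\<Sum>b<N. (x b)\<^sup>2) * (\<Sum>b<N. (M b a)\<^sup>2))"
  proof (rule sum_mono)
    fix a
    have "\<bar>\<Sum>b<N. x b * M b a\<bar> \<le> L2_set x {..<N} * L2_set (\<lambda>b. M b a) {..<N}"
      by (rule order_trans[OF sum_abs order_trans[OF _ L2_set_mult_ineq]]) (simp add: abs_mult)
    then have "\<bar>\<Sum>b<N. x b * M b a\<bar>\<^sup>2 \<le> (L2_set x {..<N} * L2_set (\<lambda>b. M b a) {..<N})\<^sup>2"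
      by (intro power_mono) auto
    then show "(\<Sum>b<N. x b * M b a)\<^sup>2 \<le> (\<Sum>b<N. (x b)\<^sup>2) * (\<Sum>b<N. (M b a)\<^sup>2)"
      by (simp add: power_mult_distrib L2_set_def sum_nonneg)
  qed
  also have "\<dots> = F * (vnorm N x)\<^sup>2"
    unfolding F_def sum_distrib_left[symmetric] vnorm_square dotp_def
    by (subst sum.swap) (simp add: power2_eq_square)
  finally have "(s ^ n)\<^sup>2 * (vnorm N x)\<^sup>2 \<le> F * (vnorm N x)\<^sup>2"
    by (simp only: power_mult_distrib)
  then have sF: "(s ^ n)\<^sup>2 \<le> F"
    by (rule mult_right_le_imp_le) (use low in simp)
  have "s ^ (4 * n) = ((s ^ n)\<^sup>2)\<^sup>2" by (simp add: power_mult[symmetric] mult.commute)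
  also have "\<dots> \<le> F\<^sup>2" using sF by (intro power_mono) auto
  also have "F = (\<Sum>z\<in>{..<N} \<times> {..<N}. (M (fst z) (snd z))\<^sup>2)"
    by (simp add: F_def sum.cartesian_product case_prod_beta)
  also have "\<dots>\<^sup>2 \<le> (\<Sum>z\<in>{..<N} \<times> {..<N}. ((M (fst z) (snd z))\<^sup>2)\<^sup>2) * card ({..<N} \<times> {..<N})"
    by (rule sum_squared_le_sum_of_squares)
  also have "\<dots> = (real N)\<^sup>2 * (\<Sum>b<N. \<Sum>a<N. (M b a) ^ 4)"
    by (simp add: sum.cartesian_product case_prod_beta power2_eq_square mult.commute power4_eq_xxxx mult.assoc)
  finally show ?thesis by (simp add: M_def)
qed

lemma symm_noise: "symm N (noise p S)"
  by (simp add: symm_def noise_def edge_commute)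

definition norm_le :: "nat \<Rightarrow> (nat \<Rightarrow> nat \<Rightarrow> real) \<Rightarrow> real \<Rightarrow> bool" where
  "norm_le N W s \<longleftrightarrow> (\<forall>x. vnorm N (mvec N W x) \<le> s * vnorm N x)"

text \<open>Markov's inequality for the fourth powers of the entries of W^n.\<close>

lemma noise_norm_tail:
  assumes p: "\<And>e. e \<in> pairs N \<Longrightarrow> 0 \<le> p e \<and> p e \<le> q" and q: "q \<le> 1" "real N * q \<le> R" "1 \<le> R"
    and s: "0 < s"
  shows "bexp (pairs N) p (\<lambda>S. of_bool (\<not> norm_le N (noise p S) s))
    \<le> real N ^ 4 * ((2 * real n + 1) ^ (4 * n + 1) * R ^ (2 * n)) / s ^ (4 * n)"
proof -
  let ?P = "pairs N"
  define M where "M = (\<lambda>S b a. ((mvec N (noise p S)) ^^ n) (\<lambda>c. of_bool (c = b)) a)"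
  define C where "C = (real N)\<^sup>2 / s ^ (4 * n)"
  have C0: "0 \<le> C" using s by (simp add: C_def)
  have "bexp ?P p (\<lambda>S. of_bool (\<not> norm_le N (noise p S) s))
    \<le> bexp ?P p (\<lambda>S. \<Sum>b<N. \<Sum>a<N. C * (M S b a) ^ 4)"
  proof (rule bexp_mono)
    show "0 \<le> p e \<and> p e \<le> 1" if "e \<in> ?P" for e using p[OF that] q by linarith
    fix S
    show "of_bool (\<not> norm_le N (noise p S) s) \<le> (\<Sum>b<N. \<Sum>a<N. C * (M S b a) ^ 4)"
    proof (cases "norm_le N (noise p S) s")
      case True
      then show ?thesis using C0 by (auto intro!: sum_nonneg)
    next
      case False
      then obtain x where x: "s * vnorm N x < vnorm N (mvec N (noise p S) x)" by (auto simp: norm_le_def not_le)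
      have "1 \<le> C * (\<Sum>b<N. \<Sum>a<N. (M S b a) ^ 4)"
        using operator_norm_le_fourth_powers[OF symm_noise s x, of n] s
        by (simp add: C_def M_def field_simps)
      then show ?thesis using False by (simp add: sum_distrib_left)
    qed
  qed
  also have "\<dots> = (\<Sum>b<N. \<Sum>a<N. C * bexp ?P p (\<lambda>S. (M S b a) ^ 4))"
    by (simp add: bexp_sum bexp_cmult)
  also have "\<dots> \<le> (\<Sum>b<N. \<Sum>a<N. C * ((2 * real n + 1) ^ (4 * n + 1) * R ^ (2 * n)))"
    unfolding M_def using C0 p q by (intro sum_mono mult_left_mono noise_power_fourth_moment) auto
  also have "\<dots> = real N ^ 4 * ((2 * real n + 1) ^ (4 * n + 1) * R ^ (2 * n)) / s ^ (4 * n)"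
    by (simp add: C_def power2_eq_square power4_eq_xxxx)
  finally show ?thesis .
qed

text \<open>Iterating the eigenvector equation in the form v = w + W v / l.\<close>

lemma neumann_expansion:
  assumes v: "\<And>a. a < N \<Longrightarrow> v a = w a + mvec N W v a / l" and a: "a < N"
  shows "v a = (\<Sum>j<n. (1 / l) ^ j * ((mvec N W) ^^ j) w a) + (1 / l) ^ n * ((mvec N W) ^^ n) v a"
proof (induction n)
  case (Suc n)
  have "((mvec N W) ^^ n) v a = ((mvec N W) ^^ n) (\<lambda>a. w a + (1 / l) * mvec N W v a) a"
    using v a by (intro mvec_pow_cong) auto
  also have "\<dots> = ((mvec N W) ^^ n) w a + (1 / l) * ((mvec N W) ^^ Suc n) v a"
    by (simp only: mvec_pow_add_scale funpow_Suc_right comp_apply)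
  finally show ?case using Suc by (simp add: algebra_simps)
qed simp

text \<open>The eigenvector enters the Neumann expansion only through the remainder, where it is measured in
the norm and comes with the small factor (s / l0) ^ n. The remaining terms involve the explicit
vectors e m, for which moment bounds exist.\<close>

lemma sum_fourth_eigvec_le:
  assumes v: "\<And>a. a < N \<Longrightarrow> v a = (\<Sum>m=1..k. \<gamma> m * e m a) + mvec N W v a / l"
    and vv: "dotp N v v = 1" and l: "0 < l0" "l0 \<le> l" and W: "norm_le N W s" "0 \<le> s"
    and \<gamma>: "\<And>m. m \<in> {1..k} \<Longrightarrow> \<bar>\<gamma> m\<bar> \<le> \<Gamma>"
  shows "(\<Sum>a<N. v a ^ 4) \<le> 8 * (real (n * k) ^ 3 * (\<Sum>j<n. \<Sum>m=1..k. \<Sum>a<N.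
       \<Gamma> ^ 4 / l0 ^ (4 * j) * (((mvec N W) ^^ j) (e m) a) ^ 4)) + 8 * (s / l0) ^ (4 * n)"
proof -
  define M where "M = (\<lambda>j m a. ((mvec N W) ^^ j) (e m) a)"
  define V where "V = ((mvec N W) ^^ n) v"
  have inv: "0 \<le> 1 / l" "1 / l \<le> 1 / l0" using l by (auto simp: field_simps)
  have pt: "v a ^ 4 \<le> 8 * (real (n * k) ^ 3 * (\<Sum>j<n. \<Sum>m=1..k. \<Gamma> ^ 4 / l0 ^ (4 * j) * (M j m a) ^ 4)) + 8 * ((1 / l0) ^ (4 * n) * (V a) ^ 4)"
    if a: "a < N" for a
  proof -
    define X where "X = (\<Sum>j<n. (1 / l) ^ j * ((mvec N W) ^^ j) (\<lambda>a. \<Sum>m=1..k. \<gamma> m * e m a) a)"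
    define Y where "Y = (1 / l) ^ n * V a"
    have "v a = X + Y" unfolding X_def Y_def V_def by (rule neumann_expansion[OF v a])
    moreover have "(X + Y) ^ 4 \<le> 8 * X ^ 4 + 8 * Y ^ 4"
      using sum_power4_le[of "\<lambda>b. if b then X else Y" UNIV] by (simp add: UNIV_bool add.commute)
    ultimately have le: "v a ^ 4 \<le> 8 * X ^ 4 + 8 * Y ^ 4" by simp
    have "X = (\<Sum>z\<in>{..<n} \<times> {1..k}. (1 / l) ^ fst z * \<gamma> (snd z) * M (fst z) (snd z) a)"
      by (simp add: X_def M_def mvec_pow_sum sum_distrib_left sum.cartesian_product case_prod_beta mult.assoc)
    then have "X ^ 4 \<le> real (card ({..<n} \<times> {1..k})) ^ 3 * (\<Sum>z\<in>{..<n} \<times> {1..k}. ((1 / l) ^ fst z * \<gamma> (snd z) * M (fst z) (snd z) a) ^ 4)"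
      by (simp only: sum_power4_le)
    also have "\<dots> \<le> real (n * k) ^ 3 * (\<Sum>z\<in>{..<n} \<times> {1..k}. \<Gamma> ^ 4 / l0 ^ (4 * fst z) * (M (fst z) (snd z) a) ^ 4)"
    proof (intro mult_mono sum_mono)
      fix z :: "nat \<times> nat" assume z: "z \<in> {..<n} \<times> {1..k}"
      have "((1 / l) ^ fst z) ^ 4 \<le> ((1 / l0) ^ fst z) ^ 4" using inv by (intro power_mono) auto
      moreover have "\<gamma> (snd z) ^ 4 \<le> \<Gamma> ^ 4"
        using power_mono[OF \<gamma>[of "snd z"], of 4] z by auto
      ultimately have "((1 / l) ^ fst z) ^ 4 * \<gamma> (snd z) ^ 4 \<le> ((1 / l0) ^ fst z) ^ 4 * \<Gamma> ^ 4"
        using l by (intro mult_mono) auto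
      then have "((1 / l) ^ fst z * \<gamma> (snd z)) ^ 4 \<le> \<Gamma> ^ 4 / l0 ^ (4 * fst z)"
        by (simp add: power_mult_distrib power_divide power_mult[symmetric] mult.commute)
      then show "((1 / l) ^ fst z * \<gamma> (snd z) * M (fst z) (snd z) a) ^ 4 \<le> \<Gamma> ^ 4 / l0 ^ (4 * fst z) * (M (fst z) (snd z) a) ^ 4"
        unfolding power_mult_distrib[of _ "M _ _ _"] by (intro mult_right_mono) auto
    qed (auto intro!: sum_nonneg)
    also have "\<dots> = real (n * k) ^ 3 * (\<Sum>j<n. \<Sum>m=1..k. \<Gamma> ^ 4 / l0 ^ (4 * j) * (M j m a) ^ 4)"
      by (simp add: sum.cartesian_product case_prod_beta)
    finally have X: "X ^ 4 \<le> \<dots>" .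
    have "(1 / l) ^ n \<le> (1 / l0) ^ n" using inv by (intro power_mono) auto
    then have "((1 / l) ^ n) ^ 4 \<le> ((1 / l0) ^ n) ^ 4" by (rule power_mono) (use l in simp)
    then have "Y ^ 4 \<le> ((1 / l0) ^ n) ^ 4 * (V a) ^ 4"
      unfolding Y_def power_mult_distrib by (intro mult_right_mono) auto
    also have "((1 / l0) ^ n) ^ 4 = (1 / l0) ^ (4 * n)" by (simp add: power_mult[symmetric] mult.commute)
    finally show ?thesis using le X by linarith
  qed
  have "(\<Sum>a<N. v a ^ 4) \<le> (\<Sum>a<N. 8 * (real (n * k) ^ 3 * (\<Sum>j<n. \<Sum>m=1..k. \<Gamma> ^ 4 / l0 ^ (4 * j) * (M j m a) ^ 4)) + 8 * ((1 / l0) ^ (4 * n) * (V a) ^ 4))"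
    using pt by (intro sum_mono) auto
  also have "\<dots> = 8 * (real (n * k) ^ 3 * (\<Sum>a<N. \<Sum>j<n. \<Sum>m=1..k. \<Gamma> ^ 4 / l0 ^ (4 * j) * (M j m a) ^ 4)) + 8 * ((1 / l0) ^ (4 * n) * (\<Sum>a<N. V a ^ 4))"
    by (simp only: sum.distrib sum_distrib_left)
  also have "(\<Sum>a<N. \<Sum>j<n. \<Sum>m=1..k. \<Gamma> ^ 4 / l0 ^ (4 * j) * (M j m a) ^ 4) = (\<Sum>j<n. \<Sum>m=1..k. \<Sum>a<N. \<Gamma> ^ 4 / l0 ^ (4 * j) * (M j m a) ^ 4)"
    by (subst sum.swap) (intro sum.cong refl sum.swap)
  also have "(1 / l0) ^ (4 * n) * (\<Sum>a<N. V a ^ 4) \<le> (s / l0) ^ (4 * n)"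
  proof -
    have "vnorm N V \<le> s ^ n * vnorm N v"
      unfolding V_def using W by (intro vnorm_mvec_pow_le) (auto simp: norm_le_def)
    then have "vnorm N V \<le> s ^ n" using vv by (simp add: vnorm_def[of N v])
    then have "vnorm N V ^ 4 \<le> (s ^ n) ^ 4" by (intro power_mono) auto
    then have "(\<Sum>a<N. V a ^ 4) \<le> (s ^ n) ^ 4" using sum_fourth_le_vnorm[of V N] by linarith
    then have "(1 / l0) ^ (4 * n) * (\<Sum>a<N. V a ^ 4) \<le> (1 / l0) ^ (4 * n) * (s ^ n) ^ 4"
      using l by (intro mult_left_mono) auto
    also have "\<dots> = (s / l0) ^ (4 * n)" by (simp add: power_divide power_mult[symmetric] mult.commute)
    finally show ?thesis .
  qed
  finally show ?thesis by (simp add: M_def)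
qed

text \<open>Delocalization: for n of order log N and l0 of order N q the first term is a power of log N
divided by N, and the second is negligible once s / l0 is at most exp (- 1). The assumption on n
makes the moments of (W / l0)^j e m bounded uniformly in j < n.\<close>

lemma expected_fourth_norm_of_eigvec:
  assumes p: "\<And>e. e \<in> pairs N \<Longrightarrow> 0 \<le> p e \<and> p e \<le> q" and q: "q \<le> 1" "real N * q \<le> R" "1 \<le> R"
    and N: "0 < N" and e: "\<And>m b. m \<in> {1..k} \<Longrightarrow> b < N \<Longrightarrow> \<bar>e m b\<bar> \<le> K / sqrt (real N)" and K: "0 < K"
    and v: "\<And>S a. S \<subseteq> pairs N \<Longrightarrow> good S \<Longrightarrow> a < N \<Longrightarrow>
        v S a = (\<Sum>m=1..k. \<gamma> S m * e m a) + mvec N (noise p S) (v S) a / l S"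
    and vv: "\<And>S. S \<subseteq> pairs N \<Longrightarrow> good S \<Longrightarrow> dotp N (v S) (v S) = 1"
    and l: "0 < l0" "\<And>S. S \<subseteq> pairs N \<Longrightarrow> good S \<Longrightarrow> l0 \<le> l S"
    and W: "\<And>S. S \<subseteq> pairs N \<Longrightarrow> good S \<Longrightarrow> norm_le N (noise p S) s" "0 \<le> s"
    and \<gamma>: "\<And>S m. S \<subseteq> pairs N \<Longrightarrow> good S \<Longrightarrow> m \<in> {1..k} \<Longrightarrow> \<bar>\<gamma> S m\<bar> \<le> \<Gamma>"
    and n: "(2 * real n + 1) ^ 4 * R\<^sup>2 \<le> l0 ^ 4"
  shows "bexp (pairs N) p (\<lambda>S. if good S then \<Sum>a<N. v S a ^ 4 else 0)
    \<le> 8 * (real (n * k) ^ 4 * (2 * real n + 1)) * (\<Gamma> * K) ^ 4 / N + 8 * (s / l0) ^ (4 * n)"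
proof -
  let ?P = "pairs N"
  have p1: "0 \<le> p e \<and> p e \<le> 1" if "e \<in> ?P" for e using p[OF that] q by linarith
  define M where "M = (\<lambda>S j m a. ((mvec N (noise p S)) ^^ j) (e m) a)"
  have G0: "0 \<le> \<Gamma> ^ 4 / l0 ^ (4 * j)" for j using l by simp
  have bnd: "bexp ?P p (\<lambda>S. (M S j m a) ^ 4) * (\<Gamma> ^ 4 / l0 ^ (4 * j)) \<le> (2 * real n + 1) * (\<Gamma> * K) ^ 4 / (real N)\<^sup>2"
    if j: "j < n" and m: "m \<in> {1..k}" and a: "a < N" for j m a
  proof -
    \<comment> \<open>The moment bound is for vectors with entries in [-1, 1].\<close>
    define c where "c = (\<lambda>b. e m b * (sqrt (real N) / K))"
    have c: "\<bar>c b\<bar> \<le> 1" if "b < N" for b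
    proof -
      have "\<bar>c b\<bar> = \<bar>e m b\<bar> * (sqrt (real N) / K)" using K by (simp add: c_def abs_mult)
      also have "\<dots> \<le> (K / sqrt (real N)) * (sqrt (real N) / K)"
        using e[OF m that] K by (intro mult_right_mono) auto
      also have "\<dots> = 1" using K N by simp
      finally show ?thesis .
    qed
    have "M S j m a = (K / sqrt (real N)) * ((mvec N (noise p S)) ^^ j) c a" for S
    proof -
      have "e m = (\<lambda>a. 0 + (K / sqrt (real N)) * c a)" using K N by (simp add: c_def)
      then have "M S j m a = ((mvec N (noise p S)) ^^ j) (\<lambda>a. 0 + (K / sqrt (real N)) * c a) a"
        by (simp add: M_def)
      also have "\<dots> = ((mvec N (noise p S)) ^^ j) (\<lambda>_. 0) a + (K / sqrt (real N)) * ((mvec N (noise p S)) ^^ j) c a"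
        by (subst mvec_pow_add_scale) simp
      also have "((mvec N (noise p S)) ^^ j) (\<lambda>_. 0) a = 0"
        using mvec_pow_sum[where J = "{}" and N = N and W = "noise p S" and n = j] by simp
      finally show ?thesis by simp
    qed
    then have "bexp ?P p (\<lambda>S. (M S j m a) ^ 4) = (K / sqrt (real N)) ^ 4 * bexp ?P p (\<lambda>S. (((mvec N (noise p S)) ^^ j) c a) ^ 4)"
      by (simp only: power_mult_distrib bexp_cmult)
    also have "\<dots> \<le> (K / sqrt (real N)) ^ 4 * ((2 * real j + 1) ^ (4 * j + 1) * R ^ (2 * j))"
      using c p q a by (intro mult_left_mono noise_power_fourth_moment) auto
    also have "(K / sqrt (real N)) ^ 4 = K ^ 4 / (real N)\<^sup>2"
    proof -
      have "sqrt (real N) ^ (2 * 2) = (real N)\<^sup>2" unfolding power_mult by simp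
      then show ?thesis by (simp add: power_divide)
    qed
    finally have "bexp ?P p (\<lambda>S. (M S j m a) ^ 4) * (\<Gamma> ^ 4 / l0 ^ (4 * j))
       \<le> K ^ 4 / (real N)\<^sup>2 * ((2 * real j + 1) ^ (4 * j + 1) * R ^ (2 * j)) * (\<Gamma> ^ 4 / l0 ^ (4 * j))"
      by (intro mult_right_mono G0) auto
    also have "\<dots> = ((\<Gamma> * K) ^ 4 / (real N)\<^sup>2) * ((2 * real j + 1) * (((2 * real j + 1) ^ 4 * R\<^sup>2) ^ j / (l0 ^ 4) ^ j))"
      by (simp add: power_mult_distrib power_add power_mult[symmetric] mult_ac)
    also have "\<dots> \<le> ((\<Gamma> * K) ^ 4 / (real N)\<^sup>2) * ((2 * real n + 1) * 1)"
    proof (intro mult_left_mono mult_mono)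
      have "(2 * real j + 1) ^ 4 * R\<^sup>2 \<le> (2 * real n + 1) ^ 4 * R\<^sup>2"
        using j by (intro mult_right_mono power_mono) auto
      then have "(2 * real j + 1) ^ 4 * R\<^sup>2 \<le> l0 ^ 4" using n by linarith
      then have "((2 * real j + 1) ^ 4 * R\<^sup>2) ^ j \<le> (l0 ^ 4) ^ j" by (intro power_mono) auto
      then show "((2 * real j + 1) ^ 4 * R\<^sup>2) ^ j / (l0 ^ 4) ^ j \<le> 1" using l by simp
    qed (use j l in auto)
    finally show ?thesis by (simp add: mult_ac)
  qed
  have "bexp ?P p (\<lambda>S. if good S then \<Sum>a<N. v S a ^ 4 else 0)
     \<le> bexp ?P p (\<lambda>S. 8 * (real (n * k) ^ 3 * (\<Sum>j<n. \<Sum>m=1..k. \<Sum>a<N.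
       \<Gamma> ^ 4 / l0 ^ (4 * j) * (M S j m a) ^ 4)) + 8 * (s / l0) ^ (4 * n))"
  proof (rule bexp_mono[OF p1])
    fix S assume S: "S \<subseteq> ?P"
    show "(if good S then \<Sum>a<N. v S a ^ 4 else 0) \<le> 8 * (real (n * k) ^ 3 * (\<Sum>j<n. \<Sum>m=1..k. \<Sum>a<N.
       \<Gamma> ^ 4 / l0 ^ (4 * j) * (M S j m a) ^ 4)) + 8 * (s / l0) ^ (4 * n)"
    proof (cases "good S")
      case True
      then show ?thesis unfolding M_def
        using sum_fourth_eigvec_le[OF v[OF S True] vv[OF S True] l(1) l(2)[OF S True] W(1)[OF S True] W(2) \<gamma>[OF S True], of n] by simp
    next
      case False
      have "0 \<le> (s / l0) ^ (4 * n)" using W(2) l by simp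
      moreover have "0 \<le> (\<Sum>j<n. \<Sum>m=1..k. \<Sum>a<N. \<Gamma> ^ 4 / l0 ^ (4 * j) * (M S j m a) ^ 4)"
        by (intro sum_nonneg mult_nonneg_nonneg G0) simp
      ultimately show ?thesis using False by simp
    qed
  qed
  also have "\<dots> = 8 * (real (n * k) ^ 3 * (\<Sum>j<n. \<Sum>m=1..k. \<Sum>a<N.
       bexp ?P p (\<lambda>S. (M S j m a) ^ 4) * (\<Gamma> ^ 4 / l0 ^ (4 * j)))) + 8 * (s / l0) ^ (4 * n)"
    by (simp only: bexp_add bexp_cmult bexp_sum bexp_const[OF finite_pairs] mult.commute[of "bexp _ _ _"])
  also have "\<dots> \<le> 8 * (real (n * k) ^ 3 * (\<Sum>j<n. \<Sum>m=1..k. \<Sum>a<N. (2 * real n + 1) * (\<Gamma> * K) ^ 4 / (real N)\<^sup>2)) + 8 * (s / l0) ^ (4 * n)"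
    by (intro add_right_mono mult_left_mono sum_mono bnd) auto
  also have "(\<Sum>j<n. \<Sum>m=1..k. \<Sum>a<N. (2 * real n + 1) * (\<Gamma> * K) ^ 4 / (real N)\<^sup>2) = real (n * k) * ((2 * real n + 1) * (\<Gamma> * K) ^ 4 / N)"
    using N by (simp add: power2_eq_square)
  finally show ?thesis by (simp add: power_Suc[of _ 3, simplified] mult_ac numeral_eq_Suc)
qed

section \<open>Changing a single entry\<close>

text \<open>The change of the adjacency matrix when the edge e is added.\<close>

definition edge_mat :: "nat \<times> nat \<Rightarrow> nat \<Rightarrow> nat \<Rightarrow> real" where
  "edge_mat e a b = of_bool (edge a b = e)"

lemma edge_eq_iff: "a \<le> b \<Longrightarrow> edge c d = (a, b) \<longleftrightarrow> (c = a \<and> d = b) \<or> (c = b \<and> d = a)"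
  by (auto simp: edge_def min_def max_def)

lemma mvec_edge_mat:
  assumes "a \<le> b" "b < N"
  shows "mvec N (edge_mat (a, b)) x c = (if c = a then x b else if c = b then x a else 0)"
proof -
  have "mvec N (edge_mat (a, b)) x c =
     (\<Sum>d<N. if d = (if c = a then b else a) then (if c = a \<or> c = b then x d else 0) else 0)"
    unfolding mvec_def edge_mat_def using assms(1)
    by (intro sum.cong) (auto simp: edge_eq_iff)
  also have "\<dots> = (if c = a then x b else if c = b then x a else 0)"
    using assms by (subst sum.delta) auto
  finally show ?thesis .
qed

lemma sum_two_points:
  fixes f :: "nat \<Rightarrow> real"
  assumes "a < N" "b < N"
  shows "(\<Sum>c<N. if c = a then f c else if c = b then f c else 0) = (if a = b then f a else f a + f b)"
proof -
  have "(\<Sum>c<N. if c = a then f c else if c = b then f c else 0) =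
    (\<Sum>c<N. (if c = a then f c else 0) + (if c = b then (if a = b then 0 else f c) else 0))"
    by (intro sum.cong) auto
  also have "\<dots> = f a + (if a = b then 0 else f b)" using assms by (simp add: sum.distrib)
  finally show ?thesis by simp
qed

lemma dotp_edge_mat:
  assumes "a \<le> b" "b < N"
  shows "dotp N y (mvec N (edge_mat (a, b)) x) = (if a = b then y a * x a else y a * x b + y b * x a)"
proof -
  have "dotp N y (mvec N (edge_mat (a, b)) x) =
     (\<Sum>c<N. if c = a then (\<lambda>c. if c = a then y a * x b else y b * x a) c
        else if c = b then (\<lambda>c. if c = a then y a * x b else y b * x a) c else 0)"
    unfolding dotp_def mvec_edge_mat[OF assms] by (intro sum.cong) auto
  also have "\<dots> = (if a = b then y a * x a else y a * x b + y b * x a)"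
    using assms by (subst sum_two_points) auto
  finally show ?thesis .
qed

lemma dotp_edge_mat_self:
  assumes "a \<le> b" "b < N"
  shows "dotp N (mvec N (edge_mat (a, b)) x) (mvec N (edge_mat (a, b)) x)
    = (if a = b then (x a)\<^sup>2 else (x a)\<^sup>2 + (x b)\<^sup>2)"
  using assms by (auto simp: dotp_edge_mat mvec_edge_mat power2_eq_square)

lemma vnorm_edge_mat_le:
  assumes "a \<le> b" "b < N"
  shows "vnorm N (mvec N (edge_mat (a, b)) x) \<le> vnorm N x"
proof -
  have "(if a = b then (x a)\<^sup>2 else (x a)\<^sup>2 + (x b)\<^sup>2)
    = (\<Sum>c<N. if c = a then (x c)\<^sup>2 else if c = b then (x c)\<^sup>2 else 0)"
    using assms by (subst sum_two_points) auto
  also have "\<dots> \<le> (\<Sum>c<N. (x c)\<^sup>2)" by (intro sum_mono) auto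
  finally show ?thesis
    unfolding vnorm_def dotp_edge_mat_self[OF assms] by (simp add: dotp_def power2_eq_square)
qed

section \<open>Riemann sums of products\<close>

definition grid_cell :: "nat \<Rightarrow> nat \<Rightarrow> real set" where
  "grid_cell N a = {real a / real N .. real (Suc a) / real N}"

lemma grid_cell_subset: "a < N \<Longrightarrow> grid_cell N a \<subseteq> {0..1}"
proof -
  assume a: "a < N"
  then have le: "real (Suc a) / real N \<le> 1" by simp
  show ?thesis
  proof
    fix z assume "z \<in> grid_cell N a"
    then have z: "real a / real N \<le> z" "z \<le> real (Suc a) / real N" by (auto simp: grid_cell_def)
    have "0 \<le> z" by (rule order_trans[OF _ z(1)]) simp
    moreover have "z \<le> 1" using z(2) le by (rule order_trans)
    ultimately show "z \<in> {0..1}" by simp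
  qed
qed

lemma grid_cell_interiors_disjoint:
  assumes "a \<noteq> b"
  shows "interior (grid_cell N a) \<inter> interior (grid_cell N b) = {}"
proof -
  have le: "real (Suc p) / real N \<le> real q / real N" if "p < q" for p q
    using that by (intro divide_right_mono) auto
  have "z \<notin> interior (grid_cell N a) \<inter> interior (grid_cell N b)" for z
  proof
    assume "z \<in> interior (grid_cell N a) \<inter> interior (grid_cell N b)"
    then have "real a / real N < z" "z < real (Suc a) / real N" "real b / real N < z" "z < real (Suc b) / real N"
      by (simp_all add: grid_cell_def)
    moreover have "a < b \<or> b < a" using assms by auto
    ultimately show False using le[of a b] le[of b a] by linarith
  qed
  then show ?thesis by blast
qed

lemma grid_cells_cover:
  assumes "0 < N" "z \<in> {0..1}"
  shows "\<exists>a<N. z \<in> grid_cell N a"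
proof (cases "z = 1")
  case True
  then show ?thesis using assms by (intro exI[of _ "N - 1"]) (simp add: grid_cell_def)
next
  case False
  define a where "a = nat \<lfloor>z * real N\<rfloor>"
  have zN: "0 \<le> z * real N" "z * real N < real N" using assms False by auto
  have ra: "real a = of_int \<lfloor>z * real N\<rfloor>" using zN by (simp add: a_def)
  have "real a \<le> z * real N" "z * real N \<le> real (Suc a)" unfolding of_nat_Suc ra by linarith+
  moreover from this have "real a < real N" using zN by linarith
  ultimately show ?thesis using assms(1) by (intro exI[of _ a]) (simp add: grid_cell_def field_simps)
qed

text \<open>Cells with arbitrary tags are admissible in the definition of the Riemann integral, and their mesh
is 1 / N.\<close>

lemma grid_cell_tagged_division:
  assumes N: "0 < N" and t: "\<And>a. a < N \<Longrightarrow> t a \<in> grid_cell N a"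
  shows "(\<lambda>a. (t a, grid_cell N a)) ` {..<N} tagged_division_of {0..1}" (is "?D tagged_division_of _")
proof (rule tagged_division_ofI)
  show "finite ?D" by simp
  fix x K assume "(x, K) \<in> ?D"
  then obtain a where a: "a < N" "x = t a" "K = grid_cell N a" by auto
  show "x \<in> K" using t a by simp
  show "\<exists>a b. K = cbox a b" using a by (auto simp: grid_cell_def cbox_interval)
  show "K \<subseteq> {0..1}" using grid_cell_subset a by simp
  fix y L assume "(y, L) \<in> ?D" "(x, K) \<noteq> (y, L)"
  then obtain b where "b < N" "L = grid_cell N b" "a \<noteq> b" using a by auto
  then show "interior K \<inter> interior L = {}" using a by (simp add: grid_cell_interiors_disjoint)
next
  show "\<Union>{K. \<exists>x. (x, K) \<in> ?D} = {0..1}" (is "?U = _")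
  proof
    show "?U \<subseteq> {0..1}" using grid_cell_subset by auto
    show "{0..1} \<subseteq> ?U" using grid_cells_cover[OF N] by blast
  qed
qed

lemma measure_grid_cell: "0 < N \<Longrightarrow> measure lborel (grid_cell N a) = 1 / real N"
  by (simp add: grid_cell_def divide_right_mono diff_divide_distrib[symmetric])

lemma grid_cell_sum:
  assumes N: "0 < N"
  shows "(\<Sum>(x, K)\<in>(\<lambda>a. (t a, grid_cell N a)) ` {..<N}. measure lborel K * g x) = (\<Sum>a<N. g (t a)) / real N"
proof -
  have "a = b" if "grid_cell N a = grid_cell N b" for a b
  proof -
    have "real a / real N = real b / real N"
      using that N unfolding grid_cell_def by (subst (asm) Icc_eq_Icc) (auto simp: divide_right_mono)
    then show ?thesis using N by simp
  qed
  then have "inj_on (\<lambda>a. (t a, grid_cell N a)) {..<N}" by (auto simp: inj_on_def)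
  then show ?thesis using N
    by (subst sum.reindex) (auto simp: measure_grid_cell sum_divide_distrib)
qed

text \<open>Two Riemann sums on the same fine grid are close to each other. Taking the larger of the two
values in each cell for one of them and the smaller for the other turns their difference into a
sum of absolute values.\<close>

lemma riemann_integrable_small_oscillation:
  assumes r: "riemann_integrable_on g 0 1" and \<eta>: "0 < \<eta>"
  shows "\<forall>\<^sub>F N in sequentially. \<forall>x y. (\<forall>a<N. x a \<in> grid_cell N a \<and> y a \<in> grid_cell N a) \<longrightarrow>
     (\<Sum>a<N. \<bar>g (x a) - g (y a)\<bar>) / real N \<le> \<eta>"
proof -
  obtain I where "\<forall>\<epsilon>>0. \<exists>\<delta>>0. \<forall>D. D tagged_division_of {0..1} \<and> (\<forall>(x, K)\<in>D. measure lborel K < \<delta>) \<longrightarrow>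
        \<bar>(\<Sum>(x, K)\<in>D. measure lborel K * g x) - I\<bar> < \<epsilon>"
    using r unfolding riemann_integrable_on_def by blast
  then have "0 < \<eta> / 2 \<longrightarrow> (\<exists>\<delta>>0. \<forall>D. D tagged_division_of {0..1} \<and> (\<forall>(x, K)\<in>D. measure lborel K < \<delta>) \<longrightarrow>
        \<bar>(\<Sum>(x, K)\<in>D. measure lborel K * g x) - I\<bar> < \<eta> / 2)" by (rule spec)
  then have "\<exists>\<delta>>0. \<forall>D. D tagged_division_of {0..1} \<and> (\<forall>(x, K)\<in>D. measure lborel K < \<delta>) \<longrightarrow>
        \<bar>(\<Sum>(x, K)\<in>D. measure lborel K * g x) - I\<bar> < \<eta> / 2" using \<eta> by simp
  then obtain \<delta> where \<delta>: "0 < \<delta>" and I: "\<forall>D. D tagged_division_of {0..1} \<and> (\<forall>(x, K)\<in>D. measure lborel K < \<delta>) \<longrightarrow>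
        \<bar>(\<Sum>(x, K)\<in>D. measure lborel K * g x) - I\<bar> < \<eta> / 2"
    by (elim exE conjE)
  have "\<forall>\<^sub>F N in sequentially. 1 / real N < \<delta>"
    using order_tendstoD(2)[OF lim_1_over_n \<delta>] by simp
  then show ?thesis using eventually_gt_at_top[of 0]
  proof eventually_elim
    case (elim N)
    show ?case
    proof (intro allI impI)
      fix x y assume xy: "\<forall>a<N. x a \<in> grid_cell N a \<and> y a \<in> grid_cell N a"
      have RS: "\<bar>(\<Sum>a<N. g (t a)) / real N - I\<bar> < \<eta> / 2" if t: "\<And>a. a < N \<Longrightarrow> t a \<in> grid_cell N a" for t
      proof -
        have "\<forall>(x, K)\<in>(\<lambda>a. (t a, grid_cell N a)) ` {..<N}. measure lborel K < \<delta>"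
          using elim by (simp add: measure_grid_cell)
        then show ?thesis
          using I[rule_format, OF conjI[OF grid_cell_tagged_division[OF elim(2) t]]] elim
          by (simp add: grid_cell_sum)
      qed
      \<comment> \<open>u collects the larger and w the smaller of the two values in each cell.\<close>
      define u where "u = (\<lambda>a. if g (y a) \<le> g (x a) then x a else y a)"
      define w where "w = (\<lambda>a. if g (y a) \<le> g (x a) then y a else x a)"
      have "\<bar>(\<Sum>a<N. g (u a)) / real N - I\<bar> < \<eta> / 2"
        by (rule RS) (use xy in \<open>auto simp: u_def\<close>)
      moreover have "\<bar>(\<Sum>a<N. g (w a)) / real N - I\<bar> < \<eta> / 2"
        by (rule RS) (use xy in \<open>auto simp: w_def\<close>)
      moreover have "(\<Sum>a<N. \<bar>g (x a) - g (y a)\<bar>) = (\<Sum>a<N. g (u a)) - (\<Sum>a<N. g (w a))"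
        by (simp add: sum_subtractf[symmetric] u_def w_def) (intro sum.cong; auto)
      ultimately show "(\<Sum>a<N. \<bar>g (x a) - g (y a)\<bar>) / real N \<le> \<eta>"
        by (simp only: diff_divide_distrib abs_less_iff) linarith
    qed
  qed
qed

lemma near_maximal_oscillation_point:
  fixes g :: "real \<Rightarrow> real"
  assumes "\<And>x. x \<in> S \<Longrightarrow> \<bar>g x\<bar> \<le> K" "x \<in> S" "0 < \<eta>"
  shows "\<exists>y\<in>S. \<forall>z\<in>S. \<bar>g z - g x\<bar> \<le> \<bar>g y - g x\<bar> + \<eta>"
proof -
  let ?A = "(\<lambda>z. \<bar>g z - g x\<bar>) ` S"
  have bdd: "bdd_above ?A"
  proof (rule bdd_aboveI2)
    fix z assume "z \<in> S"
    then show "\<bar>g z - g x\<bar> \<le> K + K" using assms(1)[of z] assms(1)[of x] assms(2) by linarith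
  qed
  have "\<exists>s\<in>?A. Sup ?A - \<eta> < s"
    using assms by (intro less_cSupD) auto
  then obtain y where y: "y \<in> S" "Sup ?A - \<eta> < \<bar>g y - g x\<bar>" by auto
  have "\<bar>g z - g x\<bar> \<le> Sup ?A" if "z \<in> S" for z using that bdd by (intro cSup_upper) auto
  then show ?thesis using y by (intro bexI[of _ y]) force
qed

lemma integral_split_grid:
  fixes h :: "real \<Rightarrow> real"
  assumes h: "h integrable_on {0..1}" and N: "0 < N"
  shows "integral {0..1} h = (\<Sum>a<N. integral (grid_cell N a) h)"
proof -
  have "integral {0..real m / real N} h = (\<Sum>a<m. integral (grid_cell N a) h)" if "m \<le> N" for m
    using that
  proof (induction m)
    case (Suc m)
    have le: "real (Suc m) / real N \<le> 1" using Suc.prems N by simp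
    have "integral {0..real (Suc m) / real N} h = integral {0..real m / real N} h + integral {real m / real N..real (Suc m) / real N} h"
    proof (rule Henstock_Kurzweil_Integration.integral_combine[symmetric])
      show "h integrable_on {0..real (Suc m) / real N}"
        by (rule integrable_on_subinterval[OF h]) (use le in auto)
    qed (auto simp: divide_right_mono)
    then show ?case using Suc by (simp add: grid_cell_def)
  qed simp
  from this[of N] show ?thesis using N by simp
qed

text \<open>In each cell the product differs from its value at the right end point by at most K times the
oscillations of the two factors there, and these sum up to little by
riemann_integrable_small_oscillation. The supremum over a cell need not be attained, so the
oscillation is replaced by its value at a nearly optimal point.\<close>

lemma riemann_sum_product_tendsto:
  assumes r: "riemann_integrable_on f 0 1" "riemann_integrable_on g 0 1"
    and bd: "bounded (f ` {0..1})" "bounded (g ` {0..1})"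
    and meas: "f \<in> borel_measurable (lebesgue_on {0..1})" "g \<in> borel_measurable (lebesgue_on {0..1})"
  shows "(\<lambda>N. (\<Sum>a<N. f (real (Suc a) / real N) * g (real (Suc a) / real N)) / real N)
     \<longlonglongrightarrow> (\<integral>x. f x * g x \<partial>lebesgue_on {0..1})"
proof -
  obtain K1 where K1: "\<And>x. x \<in> {0..1} \<Longrightarrow> \<bar>f x\<bar> \<le> K1"
    using bd(1) by (force simp: bounded_iff)
  obtain K2 where K2: "\<And>x. x \<in> {0..1} \<Longrightarrow> \<bar>g x\<bar> \<le> K2"
    using bd(2) by (force simp: bounded_iff)
  define K where "K = max 1 (max K1 K2)"
  have K: "\<bar>f x\<bar> \<le> K" "\<bar>g x\<bar> \<le> K" if "x \<in> {0..1}" for x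
    using K1[OF that] K2[OF that] by (auto simp: K_def)
  have K0: "0 < K" by (simp add: K_def)
  define h where "h = (\<lambda>x. f x * g x)"
  have hint: "integrable (lebesgue_on {0..1}) h"
  proof (rule integrableI_bounded_set[of "{0..1}" _ _ "K * K"])
    show "h \<in> borel_measurable (lebesgue_on {0..1})" unfolding h_def using meas by simp
    show "AE x in lebesgue_on {0..1}. x \<in> {0..1} \<longrightarrow> norm (h x) \<le> K * K"
      using K K0 by (intro AE_I2) (auto simp: h_def abs_mult intro!: mult_mono)
  qed (auto simp: emeasure_restrict_space)
  have hk: "h integrable_on {0..1}" "(\<integral>x. h x \<partial>lebesgue_on {0..1}) = integral {0..1} h"
    using integrable_on_lebesgue_on[OF hint] lebesgue_integral_eq_integral[OF hint] by auto
  show ?thesis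
  proof (rule LIMSEQ_I)
    fix \<epsilon> :: real assume \<epsilon>: "0 < \<epsilon>"
    \<comment> \<open>Four errors of size K \<eta> arise: an oscillation and an approximate supremum for each factor.\<close>
    define \<eta> where "\<eta> = \<epsilon> / (8 * K)"
    have \<eta>: "0 < \<eta>" using \<epsilon> K0 by (simp add: \<eta>_def)
    have "\<forall>\<^sub>F N in sequentially. norm ((\<Sum>a<N. f (real (Suc a) / real N) * g (real (Suc a) / real N)) / real N -
         (\<integral>x. f x * g x \<partial>lebesgue_on {0..1})) < \<epsilon>"
      using riemann_integrable_small_oscillation[OF r(1) \<eta>] riemann_integrable_small_oscillation[OF r(2) \<eta>]
        eventually_gt_at_top[of 0]
    proof eventually_elim
      case (elim N)
      let ?x = "\<lambda>a. real (Suc a) / real N"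
      have xc: "?x a \<in> grid_cell N a" for a by (auto simp: grid_cell_def divide_right_mono)
      note sub = grid_cell_subset[of _ N]
      have "\<exists>y\<in>grid_cell N a. \<forall>z\<in>grid_cell N a. \<bar>f z - f (?x a)\<bar> \<le> \<bar>f y - f (?x a)\<bar> + \<eta>" if "a < N" for a
        using K sub[OF that] xc[of a] \<eta> by (intro near_maximal_oscillation_point[of _ f K]) auto
      then obtain y where y: "\<And>a. a < N \<Longrightarrow> y a \<in> grid_cell N a"
        "\<And>a z. a < N \<Longrightarrow> z \<in> grid_cell N a \<Longrightarrow> \<bar>f z - f (?x a)\<bar> \<le> \<bar>f (y a) - f (?x a)\<bar> + \<eta>" by metis
      have "\<exists>y\<in>grid_cell N a. \<forall>z\<in>grid_cell N a. \<bar>g z - g (?x a)\<bar> \<le> \<bar>g y - g (?x a)\<bar> + \<eta>" if "a < N" for a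
        using K sub[OF that] xc[of a] \<eta> by (intro near_maximal_oscillation_point[of _ g K]) auto
      then obtain w where w: "\<And>a. a < N \<Longrightarrow> w a \<in> grid_cell N a"
        "\<And>a z. a < N \<Longrightarrow> z \<in> grid_cell N a \<Longrightarrow> \<bar>g z - g (?x a)\<bar> \<le> \<bar>g (w a) - g (?x a)\<bar> + \<eta>" by metis
      define B where "B = (\<lambda>a. K * ((\<bar>f (y a) - f (?x a)\<bar> + \<eta>) + (\<bar>g (w a) - g (?x a)\<bar> + \<eta>)))"
      have cell: "\<bar>integral (grid_cell N a) h - h (?x a) / real N\<bar> \<le> B a / real N" if a: "a < N" for a
      proof -
        have hi: "h integrable_on grid_cell N a"
          using hk(1) sub[OF a] unfolding grid_cell_def by (rule integrable_on_subinterval)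
        have ptw: "\<bar>h z - h (?x a)\<bar> \<le> B a" if z: "z \<in> grid_cell N a" for z
        proof -
          have "h z - h (?x a) = (f z - f (?x a)) * g z + f (?x a) * (g z - g (?x a))"
            by (simp add: h_def algebra_simps)
          also have "\<bar>\<dots>\<bar> \<le> \<bar>f z - f (?x a)\<bar> * \<bar>g z\<bar> + \<bar>f (?x a)\<bar> * \<bar>g z - g (?x a)\<bar>"
            by (rule order_trans[OF abs_triangle_ineq]) (simp add: abs_mult)
          also have "\<dots> \<le> (\<bar>f (y a) - f (?x a)\<bar> + \<eta>) * K + K * (\<bar>g (w a) - g (?x a)\<bar> + \<eta>)"
          proof (intro add_mono mult_mono)
            show "\<bar>g z\<bar> \<le> K" "\<bar>f (?x a)\<bar> \<le> K" using K z xc[of a] sub[OF a] by blast+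
          qed (use y(2)[OF a z] w(2)[OF a z] K0 \<eta> in auto)
          finally show ?thesis by (simp add: B_def algebra_simps)
        qed
        have "((\<lambda>z. h z - h (?x a)) has_integral (integral (grid_cell N a) h - h (?x a) / real N)) (grid_cell N a)"
        proof (rule has_integral_diff)
          show "(h has_integral integral (grid_cell N a) h) (grid_cell N a)" using hi by (rule integrable_integral)
          have "((\<lambda>_. h (?x a)) has_integral (measure lborel (cbox (real a / real N) (?x a)) *\<^sub>R h (?x a))) (cbox (real a / real N) (?x a))"
            by (rule has_integral_const)
          then show "((\<lambda>_. h (?x a)) has_integral (h (?x a) / real N)) (grid_cell N a)"
            by (simp add: grid_cell_def cbox_interval divide_right_mono diff_divide_distrib[symmetric])
        qed
        then have "norm (integral (grid_cell N a) h - h (?x a) / real N) \<le> B a * measure lborel {real a / real N..?x a}"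
          unfolding grid_cell_def
          using ptw[unfolded grid_cell_def] order_trans[OF abs_ge_zero ptw[OF xc]]
          by (intro has_integral_bound_real[of "B a" "{}"]) auto
        then show ?thesis by (simp add: divide_right_mono diff_divide_distrib[symmetric])
      qed
      have "\<bar>integral {0..1} h - (\<Sum>a<N. h (?x a)) / real N\<bar> = \<bar>\<Sum>a<N. integral (grid_cell N a) h - h (?x a) / real N\<bar>"
        using elim by (simp add: integral_split_grid[OF hk(1)] sum_subtractf sum_divide_distrib)
      also have "\<dots> \<le> (\<Sum>a<N. B a / real N)"
        by (rule order_trans[OF sum_abs]) (intro sum_mono cell, simp)
      also have "\<dots> = K * ((\<Sum>a<N. \<bar>f (y a) - f (?x a)\<bar>) / real N + \<eta> + (\<Sum>a<N. \<bar>g (w a) - g (?x a)\<bar>) / real N + \<eta>)"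
        using elim by (simp add: B_def sum_divide_distrib[symmetric] sum_distrib_left[symmetric] sum.distrib field_simps)
      also have "\<dots> \<le> K * (\<eta> + \<eta> + \<eta> + \<eta>)"
        using elim y(1) w(1) xc K0 by (intro mult_left_mono add_mono) auto
      also have "\<dots> < \<epsilon>" using \<epsilon> K0 by (simp add: \<eta>_def)
      finally show ?case using hk(2) by (simp add: h_def abs_minus_commute)
    qed
    then show "\<exists>no. \<forall>n\<ge>no. norm ((\<Sum>a<n. f (real (Suc a) / real n) * g (real (Suc a) / real n)) / real n -
         (\<integral>x. f x * g x \<partial>lebesgue_on {0..1})) < \<epsilon>"
      by (simp add: eventually_sequentially)
  qed
qed

section \<open>Random symmetric matrices as random edge sets\<close>

definition adj :: "(nat \<times> nat) set \<Rightarrow> nat \<Rightarrow> nat \<Rightarrow> real" where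
  "adj S a b = of_bool (edge a b \<in> S)"

definition graph_mat :: "nat \<Rightarrow> (nat \<times> nat) set \<Rightarrow> real Matrix.mat" where
  "graph_mat N S = Matrix.mat N N (\<lambda>(a, b). adj S a b)"

lemma symm_edge_function: "symm N (\<lambda>a b. x (edge a b))"
  by (simp add: symm_def edge_commute)

lemma vnorm_mvec_le_sum_abs:
  "vnorm N (mvec N D z) \<le> (\<Sum>a<N. \<Sum>b<N. \<bar>D a b\<bar>) * vnorm N z"
proof -
  have zb: "\<bar>z b\<bar> \<le> vnorm N z" if "b < N" for b
  proof -
    have "z b * z b \<le> dotp N z z"
      unfolding dotp_def using that by (intro member_le_sum[of b "{..<N}" "\<lambda>b. z b * z b"]) auto
    then have "\<bar>z b\<bar>\<^sup>2 \<le> (vnorm N z)\<^sup>2" by (simp add: vnorm_square power2_eq_square[of "z b"])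
    then show ?thesis by (rule power2_le_imp_le) simp
  qed
  have "vnorm N (mvec N D z) \<le> (\<Sum>a<N. \<bar>mvec N D z a\<bar>)"
    unfolding vnorm_L2_set by (rule L2_set_le_sum_abs)
  also have "\<dots> \<le> (\<Sum>a<N. \<Sum>b<N. \<bar>D a b\<bar> * vnorm N z)"
  proof (rule sum_mono)
    fix a
    have "\<bar>mvec N D z a\<bar> \<le> (\<Sum>b<N. \<bar>D a b * z b\<bar>)" unfolding mvec_def by (rule sum_abs)
    also have "\<dots> \<le> (\<Sum>b<N. \<bar>D a b\<bar> * vnorm N z)"
      unfolding abs_mult using zb by (intro sum_mono mult_left_mono) auto
    finally show "\<bar>mvec N D z a\<bar> \<le> (\<Sum>b<N. \<bar>D a b\<bar> * vnorm N z)" .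
  qed
  finally show ?thesis by (simp add: sum_distrib_right)
qed

text \<open>Continuity in the product topology, from Weyl's inequality.\<close>

lemma eig_edge_function_continuous:
  assumes i: "1 \<le> i" "i \<le> N"
  shows "continuous_on UNIV (\<lambda>x :: nat \<times> nat \<Rightarrow> real. eig N (\<lambda>a b. x (edge a b)) i)"
proof -
  let ?F = "\<lambda>x :: nat \<times> nat \<Rightarrow> real. eig N (\<lambda>a b. x (edge a b)) i"
  have "(?F \<longlongrightarrow> ?F x) (at x)" for x
  proof -
    define s where "s = (\<lambda>y. \<Sum>a<N. \<Sum>b<N. \<bar>y (edge a b) - x (edge a b)\<bar>)"
    have "continuous_on UNIV s"
      unfolding s_def by (intro continuous_intros continuous_on_product_coordinates)
    then have "isCont s x" by (simp add: continuous_on_eq_continuous_at)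
    moreover have "s x = 0" by (simp add: s_def)
    ultimately have s0: "(s \<longlongrightarrow> 0) (at x)" by (simp add: isCont_def)
    have le: "norm (?F y - ?F x) \<le> s y" for y
      unfolding s_def real_norm_def
      by (rule weyl_perturbation[OF symm_edge_function symm_edge_function i, where D = "\<lambda>a b. y (edge a b) - x (edge a b)"])
        (auto intro: vnorm_mvec_le_sum_abs)
    have "((\<lambda>y. ?F y - ?F x) \<longlongrightarrow> 0) (at x)"
      by (rule Lim_null_comparison[where g = s, OF always_eventually s0]) (use le in blast)
    then show ?thesis by (rule LIM_zero_cancel)
  qed
  then show ?thesis by (simp add: continuous_on_def)
qed

lemma bexp_indicator:
  assumes "finite P" "e \<in> P"
  shows "bexp P p (\<lambda>S. of_bool (e \<in> S)) = p e"
proof -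
  have "bexp P p (\<lambda>S. of_bool (e \<in> S)) = bexp P p (\<lambda>S. \<Prod>f\<in>P. if f = e then of_bool (f \<in> S) else 1)"
    using assms by (intro bexp_cong) simp
  also have "\<dots> = (\<Prod>f\<in>P. p f * (if f = e then of_bool True else 1) + (1 - p f) * (if f = e then of_bool False else 1))"
    by (rule bexp_prod[OF assms(1), of p "\<lambda>f b. if f = e then of_bool b else 1"])
  also have "\<dots> = (\<Prod>f\<in>P. if f = e then p f else 1)" by (intro prod.cong) auto
  also have "\<dots> = p e" using assms by simp
  finally show ?thesis .
qed

text \<open>The link between a random matrix on an arbitrary probability space and random subsets of pairs N.\<close>

locale bernoulli_matrix = prob_space M for M :: "'a measure" +
  fixes N :: nat and p :: "nat \<Rightarrow> nat \<Rightarrow> real" and X :: "'a \<Rightarrow> real Matrix.mat"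
  assumes N: "0 < N" and X: "bernoulli_symmetric_mat M N p X"
    and p01: "\<And>a b. a \<le> b \<Longrightarrow> b < N \<Longrightarrow> 0 \<le> p (Suc a) (Suc b) \<and> p (Suc a) (Suc b) \<le> 1"
begin

definition pe :: "nat \<times> nat \<Rightarrow> real" where "pe = (\<lambda>(a, b). p (Suc a) (Suc b))"

definition entry :: "nat \<times> nat \<Rightarrow> 'a \<Rightarrow> real" where "entry e \<omega> = X \<omega> $$ e"

lemma indep: "indep_vars (\<lambda>_. borel) entry (pairs N)"
proof -
  have "entry = (\<lambda>(a, b) \<omega>. X \<omega> $$ (a, b))" by (auto simp: entry_def fun_eq_iff)
  then show ?thesis using X by (simp add: bernoulli_symmetric_mat_def pairs_def)
qed

lemma entry_measurable: "e \<in> pairs N \<Longrightarrow> entry e \<in> borel_measurable M"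
  using indep by (auto simp: indep_vars_def)

lemma entry_prob:
  assumes e: "e \<in> pairs N"
  shows "prob (entry e -` {of_bool b} \<inter> space M) = (if b then pe e else 1 - pe e)"
proof -
  obtain a c where ac: "e = (a, c)" "a \<le> c" "c < N" using e by (auto simp: pairs_def)
  have "prob (entry e -` {of_bool b} \<inter> space M) = measure (distr M borel (entry e)) {of_bool b}"
    using entry_measurable[OF e] by (intro measure_distr[symmetric]) auto
  also have "distr M borel (entry e) = distr M borel (\<lambda>\<omega>. X \<omega> $$ (a, c))"
    by (rule arg_cong[of _ _ "distr M borel"]) (simp add: entry_def ac fun_eq_iff)
  also have "\<dots> = distr (measure_pmf (bernoulli_pmf (p (Suc a) (Suc c)))) borel of_bool"
    using X ac by (simp add: bernoulli_symmetric_mat_def)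
  also have "measure \<dots> {of_bool b} = measure (measure_pmf (bernoulli_pmf (p (Suc a) (Suc c)))) (of_bool -` {of_bool b :: real} \<inter> UNIV)"
    by (subst measure_distr) auto
  also have "of_bool -` {of_bool b :: real} \<inter> UNIV = {b}" by (auto split: if_splits)
  also have "measure (measure_pmf (bernoulli_pmf (p (Suc a) (Suc c)))) {b} = (if b then pe e else 1 - pe e)"
    using p01[OF ac(2,3)] by (cases b) (simp_all add: measure_pmf_single pe_def ac)
  finally show ?thesis .
qed

definition config :: "(nat \<times> nat) set \<Rightarrow> 'a set" where
  "config S = (\<Inter>e\<in>pairs N. entry e -` {of_bool (e \<in> S)} \<inter> space M)"

lemma pairs_nonempty: "pairs N \<noteq> {}" using N by (auto simp: pairs_def)

lemma config_sets [measurable]: "config S \<in> sets M"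
  unfolding config_def
  by (intro sets.finite_INT measurable_sets[OF entry_measurable] finite_pairs pairs_nonempty) auto

lemma config_iff:
  "\<omega> \<in> config S \<longleftrightarrow> \<omega> \<in> space M \<and> (\<forall>e\<in>pairs N. entry e \<omega> = of_bool (e \<in> S))"
proof -
  have "\<omega> \<in> config S \<longleftrightarrow> (\<forall>e\<in>pairs N. entry e \<omega> = of_bool (e \<in> S) \<and> \<omega> \<in> space M)"
    unfolding config_def by (simp only: INT_iff Int_iff vimage_eq singleton_iff)
  then show ?thesis using pairs_nonempty by blast
qed

lemma config_prob: "prob (config S) = (\<Prod>e\<in>pairs N. if e \<in> S then pe e else 1 - pe e)"
proof -
  have "prob (config S) = (\<Prod>e\<in>pairs N. prob (entry e -` {of_bool (e \<in> S)} \<inter> space M))"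
    unfolding config_def by (rule indep_varsD[OF indep]) (use pairs_nonempty in auto)
  then show ?thesis by (simp add: entry_prob)
qed

lemma config_disjoint: "S \<in> Pow (pairs N) \<Longrightarrow> S' \<in> Pow (pairs N) \<Longrightarrow> S \<noteq> S' \<Longrightarrow> config S \<inter> config S' = {}"
proof (rule ccontr)
  assume S: "S \<in> Pow (pairs N)" "S' \<in> Pow (pairs N)" "S \<noteq> S'" "config S \<inter> config S' \<noteq> {}"
  then obtain \<omega> where \<omega>: "\<omega> \<in> config S" "\<omega> \<in> config S'" by blast
  have "e \<in> S \<longleftrightarrow> e \<in> S'" if "e \<in> pairs N" for e
    using \<omega> that by (auto simp: config_iff split: if_splits)
  then show False using S by blast
qed

lemma config_cover_sets: "(\<Union>S\<in>Pow (pairs N). config S) \<in> sets M"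
  by (intro sets.finite_UN config_sets) auto

lemma config_cover_prob: "prob (\<Union>S\<in>Pow (pairs N). config S) = 1"
proof -
  have "prob (\<Union>S\<in>Pow (pairs N). config S) = (\<Sum>S\<in>Pow (pairs N). prob (config S))"
    using config_disjoint by (intro measure_finite_Union) (auto simp: disjoint_family_on_def)
  also have "\<dots> = bexp (pairs N) pe (\<lambda>_. 1)" by (simp add: bexp_def config_prob)
  also have "\<dots> = 1" by (rule bexp_const) simp
  finally show ?thesis .
qed

text \<open>The entries take values in {0, 1} only almost surely, so the configurations cover the space up to
a null set.\<close>

lemma config_cover: "AE \<omega> in M. \<omega> \<in> (\<Union>S\<in>Pow (pairs N). config S)"
  by (rule AE_prob_1[OF config_cover_prob])

lemma X_symmetric_entry:
  assumes "\<omega> \<in> space M" "a < N" "b < N"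
  shows "X \<omega> $$ (a, b) = X \<omega> $$ edge a b"
proof -
  have c: "X \<omega> \<in> carrier_mat N N" and t: "transpose_mat (X \<omega>) = X \<omega>"
    using X assms(1) by (auto simp: bernoulli_symmetric_mat_def)
  have "X \<omega> $$ (a, b) = X \<omega> $$ (b, a)"
    using c assms(2,3) by (subst t[symmetric]) simp
  then show ?thesis by (simp add: edge_def min_def max_def)
qed

lemma X_eq_entries: "\<omega> \<in> space M \<Longrightarrow> X \<omega> = Matrix.mat N N (\<lambda>(a, b). entry (edge a b) \<omega>)"
  using X by (intro eq_matI) (auto simp: bernoulli_symmetric_mat_def X_symmetric_entry entry_def)

lemma X_config: "\<omega> \<in> config S \<Longrightarrow> X \<omega> = graph_mat N S"
proof -
  assume \<omega>: "\<omega> \<in> config S"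
  have sp: "\<omega> \<in> space M" using \<omega> by (simp add: config_iff)
  have "entry e \<omega> = of_bool (e \<in> S)" if "e \<in> pairs N" for e
    using \<omega> that by (simp only: config_iff)
  then show ?thesis
    unfolding X_eq_entries[OF sp] graph_mat_def adj_def by (intro cong_mat) auto
qed

text \<open>Almost every sample point lies in exactly one configuration, on which the matrix is constant.\<close>

lemma expectation_eq_bexp:
  assumes h: "(\<lambda>\<omega>. g (X \<omega>)) \<in> borel_measurable M"
  shows "(\<integral>\<omega>. g (X \<omega>) \<partial>M) = bexp (pairs N) pe (\<lambda>S. g (graph_mat N S))"
proof -
  have "(\<integral>\<omega>. g (X \<omega>) \<partial>M) = (\<integral>\<omega>. (\<Sum>S\<in>Pow (pairs N). indicator (config S) \<omega> * g (graph_mat N S)) \<partial>M)"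
  proof (rule integral_cong_AE[OF h])
    show "AE \<omega> in M. g (X \<omega>) = (\<Sum>S\<in>Pow (pairs N). indicator (config S) \<omega> * g (graph_mat N S))"
      using config_cover
    proof eventually_elim
      case (elim \<omega>)
      then obtain S where S: "S \<in> Pow (pairs N)" "\<omega> \<in> config S" by blast
      have "(\<Sum>S\<in>Pow (pairs N). indicator (config S) \<omega> * g (graph_mat N S)) = (\<Sum>S'\<in>{S}. indicator (config S') \<omega> * g (graph_mat N S'))"
      proof (intro sum.mono_neutral_right ballI)
        fix S' assume "S' \<in> Pow (pairs N) - {S}"
        then have "\<omega> \<notin> config S'" using config_disjoint[OF S(1), of S'] S(2) by blast
        then show "indicator (config S') \<omega> * g (graph_mat N S') = 0" by simp
      qed (use S in auto)
      then show ?case using S by (simp add: X_config)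
    qed
  qed (intro borel_measurable_sum borel_measurable_times borel_measurable_indicator config_sets borel_measurable_const)
  also have "\<dots> = (\<Sum>S\<in>Pow (pairs N). \<integral>\<omega>. indicator (config S) \<omega> * g (graph_mat N S) \<partial>M)"
    by (intro Bochner_Integration.integral_sum integrable_mult_left integrable_real_indicator config_sets)
      (simp add: emeasure_eq_measure)
  also have "\<dots> = (\<Sum>S\<in>Pow (pairs N). prob (config S) * g (graph_mat N S))"
    by (intro sum.cong refl) (simp add: sets.Int_space_eq2[OF config_sets])
  finally show ?thesis by (simp add: bexp_def config_prob)
qed

text \<open>Only an inequality holds, since the event need not be measurable outside the configurations, and a
non-measurable set has measure 0.\<close>

lemma prob_le_bexp:
  "prob {\<omega> \<in> space M. Q (X \<omega>)} \<le> bexp (pairs N) pe (\<lambda>S. of_bool (Q (graph_mat N S)))"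
proof -
  let ?U = "\<Union>S\<in>Pow (pairs N). config S" and ?B = "\<Union>S\<in>{S \<in> Pow (pairs N). Q (graph_mat N S)}. config S"
  have B: "?B \<in> sets M" by (intro sets.finite_UN config_sets) auto
  have "{\<omega> \<in> space M. Q (X \<omega>)} \<subseteq> (space M - ?U) \<union> ?B"
    using X_config by fastforce
  then have 1: "prob {\<omega> \<in> space M. Q (X \<omega>)} \<le> prob ((space M - ?U) \<union> ?B)"
    using B by (intro finite_measure_mono sets.Un sets.compl_sets config_cover_sets)
  have 2: "prob ((space M - ?U) \<union> ?B) \<le> prob (space M - ?U) + prob ?B"
    using B by (intro measure_Un_le sets.compl_sets config_cover_sets)
  have 3: "prob (space M - ?U) = 0"
    using prob_compl[OF config_cover_sets] config_cover_prob by simp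
  have "prob ?B \<le> (\<Sum>S\<in>{S \<in> Pow (pairs N). Q (graph_mat N S)}. prob (config S))"
    by (rule finite_measure_subadditive_finite) auto
  also have "\<dots> = (\<Sum>S\<in>Pow (pairs N). if Q (graph_mat N S) then prob (config S) else 0)"
    by (rule sum.inter_filter) simp
  also have "\<dots> = (\<Sum>S\<in>Pow (pairs N). prob (config S) * of_bool (Q (graph_mat N S)))"
    by (intro sum.cong) auto
  also have "\<dots> = bexp (pairs N) pe (\<lambda>S. of_bool (Q (graph_mat N S)))"
    by (simp only: bexp_def config_prob)
  finally show ?thesis using 1 2 3 by linarith
qed

lemma entry_edge_expectation:
  assumes "a < N" "b < N"
  shows "(\<integral>\<omega>. X \<omega> $$ (a, b) \<partial>M) = pe (edge a b)"
proof -
  have "(\<lambda>\<omega>. X \<omega> $$ (a, b)) \<in> borel_measurable M"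
  proof -
    have "(\<lambda>\<omega>. X \<omega> $$ (a, b)) \<in> borel_measurable M \<longleftrightarrow> entry (edge a b) \<in> borel_measurable M"
      by (rule measurable_cong) (use assms in \<open>simp add: X_symmetric_entry entry_def\<close>)
    then show ?thesis using entry_measurable[of "edge a b"] assms by simp
  qed
  then have "(\<integral>\<omega>. X \<omega> $$ (a, b) \<partial>M) = bexp (pairs N) pe (\<lambda>S. graph_mat N S $$ (a, b))"
    by (rule expectation_eq_bexp)
  also have "\<dots> = bexp (pairs N) pe (\<lambda>S. of_bool (edge a b \<in> S))"
    using assms by (intro bexp_cong) (simp add: graph_mat_def adj_def)
  also have "\<dots> = pe (edge a b)" using assms by (intro bexp_indicator) auto
  finally show ?thesis .
qed

text \<open>On the null set outside the configurations the entries are arbitrary reals, so measurability is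
obtained from the continuity of the eigenvalue as a function of all entries.\<close>

lemma eigval_measurable:
  assumes i: "1 \<le> i" "i \<le> N"
  shows "(\<lambda>\<omega>. eigval i (X \<omega>)) \<in> borel_measurable M"
proof -
  let ?x = "\<lambda>\<omega> e. if e \<in> pairs N then entry e \<omega> else 0"
  have "(\<lambda>\<omega>. ?x \<omega> e) \<in> borel_measurable M" for e
    by (cases "e \<in> pairs N") (simp_all add: entry_measurable)
  then have "?x \<in> borel_measurable M"
    by (rule measurable_coordinatewise_then_product)
  then have "(\<lambda>\<omega>. eig N (\<lambda>a b. ?x \<omega> (edge a b)) i) \<in> borel_measurable M"
    by (rule measurable_compose) (rule borel_measurable_continuous_onI[OF eig_edge_function_continuous[OF i]])
  moreover have "eig N (\<lambda>a b. ?x \<omega> (edge a b)) i = eigval i (X \<omega>)" if "\<omega> \<in> space M" for \<omega>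
    unfolding eig_def X_eq_entries[OF that] by (intro arg_cong[where f = "eigval i"] cong_mat) auto
  ultimately show ?thesis by (subst measurable_cong[symmetric]) auto
qed

end

section \<open>Fluctuations of a spike eigenvalue at fixed size\<close>

text \<open>The constant of projection_close, made explicit because it must not depend on the size of the
matrix.\<close>

definition alignment_const :: "nat \<Rightarrow> real \<Rightarrow> real \<Rightarrow> real" where
  "alignment_const k t g = 2 * ((2 / g) * (2 * k * t * (2 * (2 * k * t + 2) / g) + 1)) + 1"

text \<open>The random matrix at a fixed size. The adjacency matrix of a random edge set plays the role of H
in spiked_matrix, with noise p S as the perturbation; p_mean says that the matrix of edge
probabilities is the sum of the spikes.\<close>

locale random_spike =
  fixes N k :: nat and \<theta> :: "nat \<Rightarrow> real" and e :: "nat \<Rightarrow> nat \<Rightarrow> real"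
    and \<tau> d :: real and i :: nat and g :: real
    and p :: "nat \<times> nat \<Rightarrow> real" and q K :: real and n :: nat
  assumes tau: "0 < \<tau>" and kN: "k < N"
    and theta_mono: "\<And>l m. 1 \<le> l \<Longrightarrow> l \<le> m \<Longrightarrow> m \<le> k \<Longrightarrow> \<theta> m \<le> \<theta> l"
    and theta_pos: "\<And>l. 1 \<le> l \<Longrightarrow> l \<le> k \<Longrightarrow> 0 < \<theta> l"
    and gram: "\<And>l m. l \<in> {1..k} \<Longrightarrow> m \<in> {1..k} \<Longrightarrow> \<bar>dotp N (e l) (e m) - (if l = m then 1 else 0)\<bar> \<le> d"
    and d0: "0 < d" and kd: "real k * d \<le> 1 / 2"
    and i: "1 \<le> i" "i \<le> k" and g0: "0 < g"
    and theta_gap: "\<And>m. 1 \<le> m \<Longrightarrow> m \<le> k \<Longrightarrow> m \<noteq> i \<Longrightarrow> g \<le> \<bar>\<theta> m - \<theta> i\<bar>" and theta_i: "g \<le> \<theta> i"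
    and kappa: "(k * \<theta> 1 + 1) * d \<le> g / 4"
    and p_mean: "\<And>a b. a < N \<Longrightarrow> b < N \<Longrightarrow> p (edge a b) = \<tau> * (\<Sum>l=1..k. \<theta> l * e l a * e l b)"
    and p_bound: "\<And>z. z \<in> pairs N \<Longrightarrow> 0 \<le> p z \<and> p z \<le> q"
    and q1: "q \<le> 1" and Nq: "1 \<le> real N * q"
    and e_bound: "\<And>m b. m \<in> {1..k} \<Longrightarrow> b < N \<Longrightarrow> \<bar>e m b\<bar> \<le> K / sqrt (real N)" and K: "0 < K"
    and tg: "8 \<le> \<tau> * g"
    and n_bound: "(2 * real n + 1) ^ 4 * (real N * q)\<^sup>2 \<le> (\<tau> * (g / 2)) ^ 4"
begin

abbreviation "E \<equiv> bexp (pairs N) p"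
abbreviation "lam S \<equiv> eig N (adj S) i"
definition "good S \<longleftrightarrow> norm_le N (noise p S) (d * \<tau>)"
definition "v S = (SOME v. unit_eigvec N (adj S) (lam S) v)"
definition "quad S = dotp N (e i) (mvec N (adj S) (e i))"
abbreviation "D2 \<equiv> alignment_const k (\<theta> 1) g"

lemma N0: "0 < N" using kN by simp

lemma i_le_N: "i \<le> N" using i kN by simp

lemma q0: "0 \<le> q" using p_bound[of "(0, 0)"] N0 by (auto simp: pairs_def intro: order_trans)

lemma p01: "z \<in> pairs N \<Longrightarrow> 0 \<le> p z \<and> p z \<le> 1"
  using p_bound[of z] q1 by linarith

lemma symm_adj: "symm N (adj S)"
  by (simp add: symm_def adj_def edge_commute)

lemma v: "unit_eigvec N (adj S) (lam S) (v S)"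
  unfolding v_def by (rule someI_ex[OF unit_eigvec_exists[OF symm_adj i(1) i_le_N]])

lemma spike:
  assumes "good S"
  shows "simple_spike N k \<theta> e \<tau> d (noise p S) (adj S) i g"
proof -
  interpret spiked_matrix N k \<theta> e \<tau> d "noise p S" "adj S"
  proof
    show "vnorm N (mvec N (noise p S) x) \<le> d * \<tau> * vnorm N x" for x
      using assms by (simp add: good_def norm_le_def)
    show "adj S a b = \<tau> * (\<Sum>l=1..k. \<theta> l * e l a * e l b) + noise p S a b" if "a < N" "b < N" for a b
      using p_mean[OF that] by (simp add: adj_def noise_def)
  qed (use tau kN theta_mono theta_pos gram d0 kd symm_noise in auto)
  show ?thesis
    by unfold_locales (use i g0 theta_gap theta_i kappa in \<open>auto simp: \<kappa>_def\<close>)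
qed

lemma adj_insert:
  assumes "z \<notin> S"
  shows "adj (insert z S) a b = adj S a b + edge_mat z a b"
  using assms by (auto simp: adj_def edge_mat_def)

lemma quad_insert:
  assumes "(a, b) \<in> pairs N" "(a, b) \<notin> S"
  shows "quad (insert (a, b) S) - quad S = (if a = b then 1 else 2) * (e i a * e i b)"
proof -
  have ab: "a \<le> b" "b < N" using assms(1) by (auto simp: pairs_def)
  have "quad (insert (a, b) S) = quad S + dotp N (e i) (mvec N (edge_mat (a, b)) (e i))"
    unfolding quad_def by (rule dotp_mvec_matrix_add) (rule adj_insert[OF assms(2)])
  then show ?thesis using ab by (simp add: dotp_edge_mat mult.commute)
qed

lemma e_prod_bound:
  assumes "a < N" "b < N"
  shows "\<bar>e i a * e i b\<bar> \<le> K\<^sup>2"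
proof -
  have le: "K / sqrt (real N) \<le> K" using K N0 by (simp add: field_simps)
  have "\<bar>e i a\<bar> \<le> K" "\<bar>e i b\<bar> \<le> K"
    using e_bound[of i a] e_bound[of i b] assms i le by auto
  then show ?thesis unfolding abs_mult power2_eq_square using K by (intro mult_mono) auto
qed

text \<open>The crude bound for the rare complement of the good event, from Weyl's inequality for a
perturbation of norm at most 1.\<close>

lemma increment_bound:
  assumes z: "(a, b) \<in> pairs N" "(a, b) \<notin> S"
  shows "\<bar>(lam (insert (a, b) S) - quad (insert (a, b) S)) - (lam S - quad S)\<bar> \<le> 1 + 2 * K\<^sup>2"
proof -
  have ab: "a \<le> b" "b < N" using z(1) by (auto simp: pairs_def)
  have "\<bar>lam (insert (a, b) S) - lam S\<bar> \<le> 1"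
    by (rule weyl_perturbation[OF symm_adj symm_adj i(1) i_le_N adj_insert[OF z(2)]])
      (use vnorm_edge_mat_le[OF ab] in simp)
  moreover have "\<bar>quad (insert (a, b) S) - quad S\<bar> \<le> 2 * K\<^sup>2"
  proof -
    have "\<bar>quad (insert (a, b) S) - quad S\<bar> \<le> 2 * \<bar>e i a * e i b\<bar>"
      unfolding quad_insert[OF z] abs_mult[of "if _ then _ else _"] by (intro mult_right_mono) auto
    then show ?thesis using e_prod_bound[of a b] ab by simp
  qed
  ultimately show ?thesis by linarith
qed

text \<open>The first-order change 2 v(a) v(b) of the eigenvalue is compensated by the change of quad up to
the difference of the two rank-one projections.\<close>

lemma increment_good:
  assumes z: "(a, b) \<in> pairs N" "(a, b) \<notin> S" and S: "good S"
  shows "((lam (insert (a, b) S) - quad (insert (a, b) S)) - (lam S - quad S))\<^sup>2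
    \<le> 8 * (v S a * v S b - e i a * e i b)\<^sup>2 + 64 / (\<tau> * g)\<^sup>2 * (v S a ^ 4 + v S b ^ 4)"
proof -
  interpret simple_spike N k \<theta> e \<tau> d "noise p S" "adj S" i g by (rule spike[OF S])
  have ab: "a \<le> b" "b < N" using z(1) by (auto simp: pairs_def)
  define D where "D = mvec N (edge_mat (a, b)) (v S)"
  define x where "x = lam (insert (a, b) S) - lam S - dotp N (v S) D"
  define y where "y = v S a * v S b - e i a * e i b"
  \<comment> \<open>A diagonal entry is counted once, any other entry twice.\<close>
  define m :: real where "m = (if a = b then 1 else 2)"
  define w where "w = (v S a)\<^sup>2 + (v S b)\<^sup>2"
  \<comment> \<open>The gap \<tau> g / 2 exceeds 4, so at least half of it survives the loss of 2.\<close>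
  have G: "2 < \<tau> * g / 2" using tg by simp
  have "\<bar>x\<bar> \<le> dotp N D D / (\<tau> * g / 2 - 2)"
    unfolding x_def D_def
    by (rule second_order_perturbation[OF symm_adj symm_adj i(1) i_le_N adj_insert[OF z(2)] _ v])
      (use vnorm_edge_mat_le[OF ab] spectral_gap[OF v] G in auto)
  also have "\<dots> \<le> w / (\<tau> * g / 4)"
    using dotp_edge_mat_self[OF ab, of "v S"] tg
    by (intro frac_le) (auto simp: D_def w_def)
  finally have "\<bar>x\<bar> \<le> 4 * w / (\<tau> * g)" by (simp add: mult.commute)
  then have "\<bar>x\<bar>\<^sup>2 \<le> (4 * w / (\<tau> * g))\<^sup>2" by (intro power_mono) auto
  then have "x\<^sup>2 \<le> 16 / (\<tau> * g)\<^sup>2 * w\<^sup>2" by (simp add: power_divide power_mult_distrib)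
  also have "\<dots> \<le> 16 / (\<tau> * g)\<^sup>2 * (2 * (v S a ^ 4 + v S b ^ 4))"
  proof (intro mult_left_mono)
    have "2 * (v S a ^ 4 + v S b ^ 4) - w\<^sup>2 = ((v S a)\<^sup>2 - (v S b)\<^sup>2)\<^sup>2"
      by (simp add: w_def power2_eq_square power4_eq_xxxx algebra_simps)
    then show "w\<^sup>2 \<le> 2 * (v S a ^ 4 + v S b ^ 4)" by (metis diff_ge_0_iff_ge zero_le_power2)
  qed simp
  finally have x2: "x\<^sup>2 \<le> 32 / (\<tau> * g)\<^sup>2 * (v S a ^ 4 + v S b ^ 4)" by simp
  have "m\<^sup>2 \<le> 2\<^sup>2" unfolding m_def by (intro power_mono) auto
  then have y2: "(m * y)\<^sup>2 \<le> 4 * y\<^sup>2" unfolding power_mult_distrib by (intro mult_right_mono) auto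
  have "dotp N (v S) D = m * (v S a * v S b)"
    using ab by (simp add: D_def dotp_edge_mat m_def mult.commute)
  then have eq: "(lam (insert (a, b) S) - quad (insert (a, b) S)) - (lam S - quad S) = x + m * y"
    using quad_insert[OF z] by (simp add: x_def y_def m_def algebra_simps)
  have "(x + m * y)\<^sup>2 \<le> 2 * x\<^sup>2 + 2 * (m * y)\<^sup>2"
  proof -
    have "2 * x\<^sup>2 + 2 * (m * y)\<^sup>2 - (x + m * y)\<^sup>2 = (x - m * y)\<^sup>2" by (simp add: power2_eq_square algebra_simps)
    then show ?thesis by (metis diff_ge_0_iff_ge zero_le_power2)
  qed
  also have "\<dots> \<le> 2 * (32 / (\<tau> * g)\<^sup>2 * (v S a ^ 4 + v S b ^ 4)) + 2 * (4 * y\<^sup>2)"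
    using x2 y2 by (intro add_mono mult_left_mono) auto
  finally show ?thesis unfolding eq by (simp add: y_def)
qed

lemma sum_pairs_le:
  assumes "\<And>a b. (a, b) \<in> pairs N \<Longrightarrow> (a, b) \<notin> S \<Longrightarrow> f (a, b) \<le> F a b"
    and "\<And>a b. a < N \<Longrightarrow> b < N \<Longrightarrow> 0 \<le> F a b"
  shows "(\<Sum>z\<in>pairs N - S. p z * f z) \<le> q * (\<Sum>a<N. \<Sum>b<N. F a b :: real)"
proof -
  have "(\<Sum>z\<in>pairs N - S. p z * f z) \<le> (\<Sum>z\<in>pairs N - S. q * F (fst z) (snd z))"
  proof (rule sum_mono)
    fix z assume z: "z \<in> pairs N - S"
    obtain a b where ab: "z = (a, b)" by (cases z)
    then have "f z \<le> F a b" "a < N" "b < N" using assms(1)[of a b] z by (auto simp: pairs_def)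
    then have "p z * f z \<le> p z * F a b" using p_bound[of z] z by (intro mult_left_mono) auto
    also have "\<dots> \<le> q * F a b"
      using p_bound[of z] z assms(2) \<open>a < N\<close> \<open>b < N\<close> by (intro mult_right_mono) auto
    finally show "p z * f z \<le> q * F (fst z) (snd z)" by (simp add: ab)
  qed
  also have "\<dots> \<le> (\<Sum>z\<in>{..<N} \<times> {..<N}. q * F (fst z) (snd z))"
    using q0 assms(2) by (intro sum_mono2) (auto simp: pairs_def)
  also have "\<dots> = q * (\<Sum>a<N. \<Sum>b<N. F a b)"
    by (simp add: sum.cartesian_product case_prod_beta sum_distrib_left)
  finally show ?thesis .
qed

lemma increments_pointwise:
  fixes S
  defines "\<Delta> \<equiv> \<lambda>z. (lam (insert z S) - quad (insert z S)) - (lam S - quad S)"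
  shows "(\<Sum>z\<in>pairs N - S. p z * (\<Delta> z)\<^sup>2)
    \<le> q * (80 * (D2 * d)\<^sup>2 + 128 * real N / (\<tau> * g)\<^sup>2 * (if good S then \<Sum>a<N. v S a ^ 4 else 0)
           + (real N)\<^sup>2 * (1 + 2 * K\<^sup>2)\<^sup>2 * of_bool (\<not> good S))"
proof (cases "good S")
  case True
  interpret simple_spike N k \<theta> e \<tau> d "noise p S" "adj S" i g by (rule spike[OF True])
  let ?c = "64 / (\<tau> * g)\<^sup>2"
  have "(\<Sum>z\<in>pairs N - S. p z * (\<Delta> z)\<^sup>2)
     \<le> q * (\<Sum>a<N. \<Sum>b<N. 8 * (v S a * v S b - e i a * e i b)\<^sup>2 + ?c * (v S a ^ 4 + v S b ^ 4))"
    unfolding \<Delta>_def using increment_good True by (intro sum_pairs_le) auto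
  also have "(\<Sum>a<N. \<Sum>b<N. 8 * (v S a * v S b - e i a * e i b)\<^sup>2 + ?c * (v S a ^ 4 + v S b ^ 4))
     = 8 * (\<Sum>a<N. \<Sum>b<N. (v S a * v S b - e i a * e i b)\<^sup>2) + ?c * (2 * real N * (\<Sum>a<N. v S a ^ 4))"
  proof -
    have "(\<Sum>a<N. \<Sum>b<N. v S a ^ 4 + v S b ^ 4) = 2 * real N * (\<Sum>a<N. v S a ^ 4)"
      by (simp add: sum.distrib sum_distrib_left[symmetric])
    then show ?thesis by (simp only: sum.distrib[of "\<lambda>a. \<Sum>b<N. 8 * _ a b"] sum.distrib sum_distrib_left[symmetric])
  qed
  also have "\<dots> \<le> 8 * (10 * (D2 * d)\<^sup>2) + ?c * (2 * real N * (\<Sum>a<N. v S a ^ 4))"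
    using projection_close[OF v] by (simp add: C1_def C0_def alignment_const_def)
  finally show ?thesis using True q0 by (simp add: mult_left_mono mult.assoc)
next
  case False
  have "(\<Sum>z\<in>pairs N - S. p z * (\<Delta> z)\<^sup>2) \<le> q * (\<Sum>a<N. \<Sum>b<N. (1 + 2 * K\<^sup>2)\<^sup>2)"
  proof (rule sum_pairs_le)
    fix a b assume "(a, b) \<in> pairs N" "(a, b) \<notin> S"
    then have "\<bar>\<Delta> (a, b)\<bar>\<^sup>2 \<le> (1 + 2 * K\<^sup>2)\<^sup>2"
      unfolding \<Delta>_def by (intro power_mono increment_bound) auto
    then show "(\<Delta> (a, b))\<^sup>2 \<le> (1 + 2 * K\<^sup>2)\<^sup>2" by simp
  qed simp
  also have "\<dots> \<le> q * (80 * (D2 * d)\<^sup>2 + (real N)\<^sup>2 * (1 + 2 * K\<^sup>2)\<^sup>2)"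
    using q0 by (intro mult_left_mono) (auto simp: power2_eq_square)
  finally show ?thesis using False by simp
qed

text \<open>Efron-Stein with increments_pointwise. The three terms come from the misalignment of v and e i,
the second-order terms, and the bad event.\<close>

lemma variance_bound:
  "E (\<lambda>S. ((lam S - quad S) - E (\<lambda>S. lam S - quad S))\<^sup>2)
    \<le> q * (80 * (D2 * d)\<^sup>2 + 128 * real N / (\<tau> * g)\<^sup>2 * E (\<lambda>S. if good S then \<Sum>a<N. v S a ^ 4 else 0)
        + (real N)\<^sup>2 * (1 + 2 * K\<^sup>2)\<^sup>2 * E (\<lambda>S. of_bool (\<not> good S)))"
proof -
  have "E (\<lambda>S. ((lam S - quad S) - E (\<lambda>S. lam S - quad S))\<^sup>2)
    \<le> E (\<lambda>S. \<Sum>z\<in>pairs N - S. p z * ((lam (insert z S) - quad (insert z S)) - (lam S - quad S))\<^sup>2)"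
    by (rule efron_stein[OF finite_pairs p01])
  also have "\<dots> \<le> E (\<lambda>S. q * (80 * (D2 * d)\<^sup>2 + 128 * real N / (\<tau> * g)\<^sup>2 * (if good S then \<Sum>a<N. v S a ^ 4 else 0)
           + (real N)\<^sup>2 * (1 + 2 * K\<^sup>2)\<^sup>2 * of_bool (\<not> good S)))"
    by (rule bexp_mono[OF p01 increments_pointwise])
  also have "\<dots> = q * (80 * (D2 * d)\<^sup>2 + 128 * real N / (\<tau> * g)\<^sup>2 * E (\<lambda>S. if good S then \<Sum>a<N. v S a ^ 4 else 0)
        + (real N)\<^sup>2 * (1 + 2 * K\<^sup>2)\<^sup>2 * E (\<lambda>S. of_bool (\<not> good S)))"
    by (simp only: bexp_cmult bexp_add bexp_const[OF finite_pairs])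
  finally show ?thesis .
qed

lemma quad_variance: "E (\<lambda>S. (quad S - E quad)\<^sup>2) \<le> 16 * q"
proof -
  have "E (\<lambda>S. (quad S - E quad)\<^sup>2) \<le> E (\<lambda>S. \<Sum>z\<in>pairs N - S. p z * (quad (insert z S) - quad S)\<^sup>2)"
    by (rule efron_stein[OF finite_pairs p01])
  also have "\<dots> \<le> E (\<lambda>S. 16 * q)"
  proof (rule bexp_mono[OF p01])
    fix S
    have "(\<Sum>z\<in>pairs N - S. p z * (quad (insert z S) - quad S)\<^sup>2) \<le> q * (\<Sum>a<N. \<Sum>b<N. 4 * ((e i a)\<^sup>2 * (e i b)\<^sup>2))"
    proof (rule sum_pairs_le)
      fix a b assume z: "(a, b) \<in> pairs N" "(a, b) \<notin> S"
      show "(quad (insert (a, b) S) - quad S)\<^sup>2 \<le> 4 * ((e i a)\<^sup>2 * (e i b)\<^sup>2)"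
        unfolding quad_insert[OF z] power_mult_distrib by (intro mult_right_mono) auto
    qed simp
    also have "(\<Sum>a<N. \<Sum>b<N. 4 * ((e i a)\<^sup>2 * (e i b)\<^sup>2)) = 4 * (dotp N (e i) (e i) * dotp N (e i) (e i))"
    proof -
      have "dotp N (e i) (e i) * dotp N (e i) (e i) = (\<Sum>a<N. \<Sum>b<N. (e i a)\<^sup>2 * (e i b)\<^sup>2)"
        by (simp add: dotp_def sum_product power2_eq_square)
      then show ?thesis by (simp only: sum_distrib_left)
    qed
    also have "q * (4 * (dotp N (e i) (e i) * dotp N (e i) (e i))) \<le> q * (4 * (2 * 2))"
    proof (intro mult_left_mono mult_mono)
      have "1 * d \<le> real k * d" using i d0 by (intro mult_right_mono) auto
      then have "d \<le> 1" using kd by linarith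
      then show "dotp N (e i) (e i) \<le> 2" "dotp N (e i) (e i) \<le> 2" using gram[of i i] i by auto
    qed (use q0 in \<open>auto simp: dotp_nonneg\<close>)
    finally show "(\<Sum>z\<in>pairs N - S. p z * (quad (insert z S) - quad S)\<^sup>2) \<le> 16 * q" by simp
  qed
  also have "\<dots> = 16 * q" by (rule bexp_const) simp
  finally show ?thesis .
qed

lemma bad_prob:
  "E (\<lambda>S. of_bool (\<not> good S)) \<le> real N ^ 4 * ((2 * real n + 1) ^ (4 * n + 1) * (real N * q) ^ (2 * n)) / (d * \<tau>) ^ (4 * n)"
  unfolding good_def using p_bound q1 Nq d0 tau by (intro noise_norm_tail) auto

lemma fourth_norm:
  "E (\<lambda>S. if good S then \<Sum>a<N. v S a ^ 4 else 0)
    \<le> 8 * (real (n * k) ^ 4 * (2 * real n + 1)) * (4 * \<theta> 1 / g * K) ^ 4 / N + 8 * (2 * d / g) ^ (4 * n)"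
proof -
  have "E (\<lambda>S. if good S then \<Sum>a<N. v S a ^ 4 else 0)
    \<le> 8 * (real (n * k) ^ 4 * (2 * real n + 1)) * (4 * \<theta> 1 / g * K) ^ 4 / N + 8 * (d * \<tau> / (\<tau> * (g / 2))) ^ (4 * n)"
  proof (rule expected_fourth_norm_of_eigvec[where q = q and R = "real N * q" and e = e and l = lam
        and \<gamma> = "\<lambda>S m. \<tau> * \<theta> m * dotp N (e m) (v S) / lam S"])
    fix S assume S: "good S"
    interpret simple_spike N k \<theta> e \<tau> d "noise p S" "adj S" i g by (rule spike[OF S])
    show "v S a = (\<Sum>m=1..k. \<tau> * \<theta> m * dotp N (e m) (v S) / lam S * e m a) + mvec N (noise p S) (v S) a / lam S"
      if "a < N" for a using eigvec_expansion[OF v that] .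
    show "dotp N (v S) (v S) = 1" using v by (simp add: unit_eigvec_def)
    have "\<tau> * (g / 2) \<le> \<tau> * (3 * g / 4)" using tau g0 by simp
    then show "\<tau> * (g / 2) \<le> lam S" using l_lower by linarith
    show "norm_le N (noise p S) (d * \<tau>)" using S by (simp add: good_def)
    show "\<bar>\<tau> * \<theta> m * dotp N (e m) (v S) / lam S\<bar> \<le> 4 * \<theta> 1 / g" if "m \<in> {1..k}" for m
      using eigvec_coeff_le[OF v that] .
  qed (use p_bound q1 Nq N0 e_bound K tau g0 d0 n_bound in auto)
  also have "d * \<tau> / (\<tau> * (g / 2)) = 2 * d / g" using tau g0 by (simp add: field_simps)
  finally show ?thesis .
qed

text \<open>This is why the factor in front of the linear statistic may be replaced by 1.\<close>

lemma ratio_close: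
  assumes S: "good S"
  shows "\<bar>1 - \<tau> * \<theta> i / lam S\<bar> \<le> 2 * ((k * \<theta> 1 + 1) * d) / g"
proof -
  interpret simple_spike N k \<theta> e \<tau> d "noise p S" "adj S" i g by (rule spike[OF S])
  have l2: "\<tau> * (g / 2) \<le> lam S"
  proof -
    have "\<tau> * (g / 2) \<le> \<tau> * (3 * g / 4)" using tau g0 by simp
    then show ?thesis using l_lower by linarith
  qed
  have "1 - \<tau> * \<theta> i / lam S = (lam S - \<tau> * \<theta> i) / lam S" using l_pos by (simp add: field_simps)
  then have "\<bar>1 - \<tau> * \<theta> i / lam S\<bar> = \<bar>lam S - \<tau> * \<theta> i\<bar> / lam S" using l_pos by simp
  also have "\<dots> \<le> \<tau> * \<kappa> / (\<tau> * (g / 2))"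
    using eig_near[OF i] l2 tau g0 by (intro frac_le) auto
  also have "\<dots> = 2 * ((k * \<theta> 1 + 1) * d) / g" using tau g0 by (simp add: \<kappa>_def field_simps)
  finally show ?thesis .
qed

text \<open>With G = lam - quad, the error term splits as G - E G plus (1 - \<tau> \<theta> i / lam) (quad - E
quad); Chebyshev's inequality is applied to each of the two.\<close>

lemma deviation_prob:
  assumes t: "0 < t"
  defines "V \<equiv> E (\<lambda>S. ((lam S - quad S) - E (\<lambda>S. lam S - quad S))\<^sup>2)"
    and "\<eta> \<equiv> 2 * ((k * \<theta> 1 + 1) * d) / g"
  shows "E (\<lambda>S. of_bool (t < \<bar>lam S - (E lam + \<tau> * \<theta> i / lam S * (quad S - E quad))\<bar>))
    \<le> E (\<lambda>S. of_bool (\<not> good S)) + 4 / t\<^sup>2 * V + 4 / t\<^sup>2 * (\<eta>\<^sup>2 * (16 * q))"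
proof -
  let ?Y = "\<lambda>S. lam S - (E lam + \<tau> * \<theta> i / lam S * (quad S - E quad))"
  let ?G = "\<lambda>S. (lam S - quad S) - E (\<lambda>S. lam S - quad S)"
  have "E (\<lambda>S. of_bool (t < \<bar>?Y S\<bar>)) \<le> E (\<lambda>S. of_bool (\<not> good S) + 4 / t\<^sup>2 * (?G S)\<^sup>2 + 4 / t\<^sup>2 * (\<eta>\<^sup>2 * (quad S - E quad)\<^sup>2))"
  proof (rule bexp_mono[OF p01])
    fix S
    have nn: "0 \<le> 4 / t\<^sup>2 * (?G S)\<^sup>2" "0 \<le> 4 / t\<^sup>2 * (\<eta>\<^sup>2 * (quad S - E quad)\<^sup>2)" by simp_all
    show "of_bool (t < \<bar>?Y S\<bar>) \<le> of_bool (\<not> good S) + 4 / t\<^sup>2 * (?G S)\<^sup>2 + 4 / t\<^sup>2 * (\<eta>\<^sup>2 * (quad S - E quad)\<^sup>2)"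
    proof (cases "good S \<and> t < \<bar>?Y S\<bar>")
      case False
      then show ?thesis using nn by auto
    next
      case True
      have ob: "of_bool (t < \<bar>?Y S\<bar>) = (1 :: real)" "of_bool (\<not> good S) = (0 :: real)" using True by auto
      define B where "B = (1 - \<tau> * \<theta> i / lam S) * (quad S - E quad)"
      have Y: "?Y S = ?G S + B" by (simp add: B_def bexp_diff algebra_simps)
      have big: "1 \<le> 4 / t\<^sup>2 * x\<^sup>2" if "t / 2 < \<bar>x\<bar>" for x
      proof -
        have "(t / 2)\<^sup>2 \<le> \<bar>x\<bar>\<^sup>2" using that t by (intro power_mono) auto
        then show ?thesis using t by (simp add: field_simps power2_eq_square)
      qed
      have "t / 2 < \<bar>?G S\<bar> \<or> t / 2 < \<bar>B\<bar>" using True Y by linarith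
      then show ?thesis
      proof
        assume "t / 2 < \<bar>?G S\<bar>"
        then have "1 \<le> 4 / t\<^sup>2 * (?G S)\<^sup>2" by (rule big)
        then show ?thesis unfolding ob using nn(2) by linarith
      next
        assume "t / 2 < \<bar>B\<bar>"
        then have "1 \<le> 4 / t\<^sup>2 * B\<^sup>2" by (rule big)
        also have "B\<^sup>2 \<le> \<eta>\<^sup>2 * (quad S - E quad)\<^sup>2"
        proof -
          have "\<bar>1 - \<tau> * \<theta> i / lam S\<bar>\<^sup>2 \<le> \<eta>\<^sup>2"
            using ratio_close[of S] True unfolding \<eta>_def by (intro power_mono) auto
          then show ?thesis unfolding B_def power_mult_distrib by (intro mult_right_mono) auto
        qed
        then have "4 / t\<^sup>2 * B\<^sup>2 \<le> 4 / t\<^sup>2 * (\<eta>\<^sup>2 * (quad S - E quad)\<^sup>2)" by (intro mult_left_mono) auto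
        finally show ?thesis unfolding ob using nn(1) by linarith
      qed
    qed
  qed
  also have "\<dots> = E (\<lambda>S. of_bool (\<not> good S)) + 4 / t\<^sup>2 * V + 4 / t\<^sup>2 * (\<eta>\<^sup>2 * E (\<lambda>S. (quad S - E quad)\<^sup>2))"
    unfolding V_def by (simp only: bexp_add bexp_cmult)
  also have "\<dots> \<le> E (\<lambda>S. of_bool (\<not> good S)) + 4 / t\<^sup>2 * V + 4 / t\<^sup>2 * (\<eta>\<^sup>2 * (16 * q))"
    using quad_variance by (intro add_left_mono mult_left_mono) auto
  finally show ?thesis .
qed

text \<open>The choice n = ceiling (ln N) gives N \<le> exp n, so that the factor exp (- 8 n) in the
probability of the bad event beats both the factor N^4 of noise_norm_tail and the factor N^2 with
which that probability enters variance_bound.\<close>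

lemma deviation_prob_explicit:
  assumes L: "L = ln (real N)" "1 \<le> L" "n = nat \<lceil>L\<rceil>"
    and small: "(2 * real n + 1) ^ 4 * (real N * q)\<^sup>2 * exp 8 \<le> (d * \<tau>) ^ 4" and dg: "2 * d / g \<le> exp (- 1)"
    and q: "q = F * \<epsilon>" and pos: "0 < F" "0 < \<epsilon>" "0 < \<delta>"
  shows "E (\<lambda>S. of_bool (\<delta> * sqrt \<epsilon> < \<bar>lam S - (E lam + \<tau> * \<theta> i / lam S * (quad S - E quad))\<bar>))
    \<le> 5 / N + 4 * F / \<delta>\<^sup>2 * (80 * (D2 * d)\<^sup>2
        + 128 / g\<^sup>2 * (640 * real k ^ 4 * (4 * \<theta> 1 / g * K) ^ 4 + 8) * (L ^ 8 / \<tau>)\<^sup>2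
        + (1 + 2 * K\<^sup>2)\<^sup>2 * (5 / N))
      + 4 * F / \<delta>\<^sup>2 * (16 * (2 * ((k * \<theta> 1 + 1) * d) / g)\<^sup>2)"
proof -
  have N1: "1 \<le> real N" using N0 by simp
  have nL: "L \<le> real n" "real n \<le> 2 * L" "2 * real n + 1 \<le> 5 * L"
    using L by (simp_all add: of_nat_nat) linarith+
  have LN: "L \<le> real N" using ln_bound[of "real N"] N0 L by simp
  have Nexp: "real N \<le> exp (real n)" using nL(1) L(1) N0 by (metis exp_le_cancel_iff exp_ln of_nat_0_less_iff)
  have expn: "exp (- real m * real n) \<le> 1 / real N ^ m" for m
  proof -
    have "real N ^ m \<le> exp (real n) ^ m" using Nexp by (intro power_mono) auto
    also have "\<dots> = exp (real m * real n)" by (simp add: exp_of_nat_mult)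
    finally have "1 / exp (real m * real n) \<le> 1 / real N ^ m" using N0 by (intro divide_left_mono) auto
    then show ?thesis by (simp add: exp_minus field_simps)
  qed
  define bad where "bad = E (\<lambda>S. of_bool (\<not> good S))"
  have bad: "bad \<le> (2 * real n + 1) / real N ^ 4"
  proof -
    have "bad \<le> real N ^ 4 * ((2 * real n + 1) ^ (4 * n + 1) * (real N * q) ^ (2 * n)) / (d * \<tau>) ^ (4 * n)"
      unfolding bad_def by (rule bad_prob)
    also have "\<dots> = real N ^ 4 * (2 * real n + 1) * (((2 * real n + 1) ^ 4 * (real N * q)\<^sup>2) / (d * \<tau>) ^ 4) ^ n"
      by (simp add: power_add power_mult power_divide power_mult_distrib)
    also have "\<dots> \<le> real N ^ 4 * (2 * real n + 1) * (exp (- 8)) ^ n"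
    proof (intro mult_left_mono power_mono)
      have "0 < (d * \<tau>) ^ 4" using d0 tau by simp
      then show "(2 * real n + 1) ^ 4 * (real N * q)\<^sup>2 / (d * \<tau>) ^ 4 \<le> exp (- 8)"
        using small by (simp add: exp_minus field_simps)
    qed auto
    also have "exp (- 8) ^ n = exp (- real 8 * real n)" by (simp add: exp_of_nat_mult[symmetric] mult.commute)
    also have "real N ^ 4 * (2 * real n + 1) * exp (- real 8 * real n) \<le> real N ^ 4 * (2 * real n + 1) * (1 / real N ^ 8)"
      by (intro mult_left_mono expn) auto
    also have "\<dots> = (2 * real n + 1) / real N ^ 4"
      using N0 by (simp add: field_simps power_add[symmetric])
    finally show ?thesis .
  qed
  have bad2: "(real N)\<^sup>2 * bad \<le> 5 / N"
  proof -
    have "(real N)\<^sup>2 * bad \<le> (real N)\<^sup>2 * ((2 * real n + 1) / real N ^ 4)" using bad by (intro mult_left_mono) auto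
    also have "\<dots> = (2 * real n + 1) / (real N)\<^sup>2" using N0 by (simp add: field_simps power2_eq_square power4_eq_xxxx)
    also have "\<dots> \<le> 5 * real N / (real N)\<^sup>2" using nL(3) LN by (intro divide_right_mono) auto
    also have "\<dots> = 5 / N" using N0 by (simp add: power2_eq_square)
    finally show ?thesis .
  qed
  have bad0: "0 \<le> bad" unfolding bad_def by (rule bexp_nonneg[OF finite_pairs p01]) auto
  have bad1: "bad \<le> 5 / N"
  proof -
    have "1 * bad \<le> (real N)\<^sup>2 * bad" using N1 bad0 by (intro mult_right_mono) auto
    then show ?thesis using bad2 by simp
  qed
  define \<Gamma> where "\<Gamma> = (4 * \<theta> 1 / g * K) ^ 4"
  have G0: "0 \<le> \<Gamma>" by (simp add: \<Gamma>_def)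
  define X where "X = (L ^ 8 / \<tau>)\<^sup>2"
  have D4: "128 * real N / (\<tau> * g)\<^sup>2 * E (\<lambda>S. if good S then \<Sum>a<N. v S a ^ 4 else 0)
     \<le> 128 / g\<^sup>2 * (640 * real k ^ 4 * \<Gamma> + 8) * X"
  proof -
    have "(2 * d / g) ^ (4 * n) \<le> exp (- 1) ^ (4 * n)" using dg d0 g0 by (intro power_mono) auto
    also have "\<dots> = exp (- real 4 * real n)" by (simp add: exp_of_nat_mult[symmetric] mult.commute)
    also have "\<dots> \<le> 1 / real N ^ 4" by (rule expn)
    also have "\<dots> \<le> 1 / real N ^ 1" using N1 by (intro divide_left_mono power_increasing) auto
    finally have r: "(2 * d / g) ^ (4 * n) \<le> 1 / N" by simp
    have "E (\<lambda>S. if good S then \<Sum>a<N. v S a ^ 4 else 0) \<le> 8 * (real (n * k) ^ 4 * (2 * real n + 1)) * \<Gamma> / N + 8 * (1 / N)"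
      using fourth_norm r unfolding \<Gamma>_def by linarith
    also have "\<dots> \<le> 8 * (80 * L ^ 5 * real k ^ 4) * \<Gamma> / N + 8 * (L ^ 5 / N)"
    proof (intro add_mono divide_right_mono mult_right_mono mult_left_mono)
      have "real (n * k) ^ 4 * (2 * real n + 1) \<le> ((2 * L) ^ 4 * real k ^ 4) * (5 * L)"
      proof (intro mult_mono)
        have "real n ^ 4 \<le> (2 * L) ^ 4" using nL by (intro power_mono) auto
        then show "real (n * k) ^ 4 \<le> (2 * L) ^ 4 * real k ^ 4"
          unfolding of_nat_mult power_mult_distrib[of "real n"] by (intro mult_right_mono) auto
      qed (use nL L(2) in auto)
      also have "\<dots> = 80 * L ^ 5 * real k ^ 4" by (simp add: power_mult_distrib eval_nat_numeral)
      finally show "real (n * k) ^ 4 * (2 * real n + 1) \<le> 80 * L ^ 5 * real k ^ 4" .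
      show "1 \<le> L ^ 5" using L(2) by simp
    qed (use G0 in auto)
    also have "\<dots> = (640 * real k ^ 4 * \<Gamma> + 8) * L ^ 5 / N" by (simp add: algebra_simps add_divide_distrib)
    also have "\<dots> \<le> (640 * real k ^ 4 * \<Gamma> + 8) * L ^ 16 / N"
      using G0 L(2) by (intro divide_right_mono mult_left_mono power_increasing) auto
    finally have "128 * real N / (\<tau> * g)\<^sup>2 * E (\<lambda>S. if good S then \<Sum>a<N. v S a ^ 4 else 0)
      \<le> 128 * real N / (\<tau> * g)\<^sup>2 * ((640 * real k ^ 4 * \<Gamma> + 8) * L ^ 16 / N)"
      by (intro mult_left_mono) auto
    also have "\<dots> = 128 / g\<^sup>2 * (640 * real k ^ 4 * \<Gamma> + 8) * X"
    proof -
      have "L ^ 16 = (L ^ 8)\<^sup>2" by (simp flip: power_mult)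
      then have "128 * real N / (\<tau> * g)\<^sup>2 * (c * L ^ 16 / N) = 128 / g\<^sup>2 * c * X" for c
        using N0 by (simp add: X_def power_divide power_mult_distrib mult_ac)
      then show ?thesis .
    qed
    finally show ?thesis .
  qed
  define V where "V = E (\<lambda>S. ((lam S - quad S) - E (\<lambda>S. lam S - quad S))\<^sup>2)"
  define R where "R = 80 * (D2 * d)\<^sup>2 + 128 / g\<^sup>2 * (640 * real k ^ 4 * \<Gamma> + 8) * X + (1 + 2 * K\<^sup>2)\<^sup>2 * (5 / N)"
  have "V \<le> q * (80 * (D2 * d)\<^sup>2 + 128 * real N / (\<tau> * g)\<^sup>2 * E (\<lambda>S. if good S then \<Sum>a<N. v S a ^ 4 else 0)
        + (real N)\<^sup>2 * (1 + 2 * K\<^sup>2)\<^sup>2 * bad)"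
    unfolding V_def bad_def by (rule variance_bound)
  also have "\<dots> \<le> q * R"
  proof (intro mult_left_mono q0)
    have "(1 + 2 * K\<^sup>2)\<^sup>2 * ((real N)\<^sup>2 * bad) \<le> (1 + 2 * K\<^sup>2)\<^sup>2 * (5 / N)" using bad2 by (intro mult_left_mono) auto
    moreover have "(real N)\<^sup>2 * (1 + 2 * K\<^sup>2)\<^sup>2 * bad = (1 + 2 * K\<^sup>2)\<^sup>2 * ((real N)\<^sup>2 * bad)" by simp
    ultimately show "80 * (D2 * d)\<^sup>2 + 128 * real N / (\<tau> * g)\<^sup>2 * E (\<lambda>S. if good S then \<Sum>a<N. v S a ^ 4 else 0)
        + (real N)\<^sup>2 * (1 + 2 * K\<^sup>2)\<^sup>2 * bad \<le> R" using D4 unfolding R_def by linarith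
  qed
  finally have VR: "V \<le> q * R" .
  have t: "0 < \<delta> * sqrt \<epsilon>" using pos by simp
  have tq: "4 / (\<delta> * sqrt \<epsilon>)\<^sup>2 * q = 4 * F / \<delta>\<^sup>2" using pos by (simp add: q power_mult_distrib field_simps)
  have "4 / (\<delta> * sqrt \<epsilon>)\<^sup>2 * V \<le> 4 / (\<delta> * sqrt \<epsilon>)\<^sup>2 * (q * R)" using VR by (intro mult_left_mono) auto
  also have "\<dots> = 4 * F / \<delta>\<^sup>2 * R" by (simp only: mult.assoc[symmetric] tq)
  finally have 1: "4 / (\<delta> * sqrt \<epsilon>)\<^sup>2 * V \<le> 4 * F / \<delta>\<^sup>2 * R" .
  have 2: "4 / (\<delta> * sqrt \<epsilon>)\<^sup>2 * (y * (16 * q)) = 4 * F / \<delta>\<^sup>2 * (16 * y)" for y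
    unfolding tq[symmetric] by simp
  show ?thesis
    using deviation_prob[OF t] 1 bad1 unfolding 2 V_def[symmetric] bad_def[symmetric] R_def X_def \<Gamma>_def by linarith
qed

end

section \<open>The limit theorem\<close>

text \<open>The strict inequalities at i concern its neighbours only; monotonicity extends them to all other
indices.\<close>

lemma simple_index_gap:
  assumes i: "i \<in> simple_indices k \<theta>"
    and mono: "\<And>i j. 1 \<le> i \<Longrightarrow> i \<le> j \<Longrightarrow> j \<le> k \<Longrightarrow> \<theta> j \<le> \<theta> i" and pos: "0 < \<theta> k"
  shows "\<exists>g>0. g \<le> \<theta> i \<and> (\<forall>m. 1 \<le> m \<longrightarrow> m \<le> k \<longrightarrow> m \<noteq> i \<longrightarrow> g \<le> \<bar>\<theta> m - \<theta> i\<bar>)"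
proof -
  have ik: "1 \<le> i" "i \<le> k" and gt: "theta_ext k \<theta> (i - 1) > theta_ext k \<theta> i" "theta_ext k \<theta> i > theta_ext k \<theta> (i + 1)"
    using i by (auto simp: simple_indices_def)
  have ne: "\<theta> m \<noteq> \<theta> i" if m: "1 \<le> m" "m \<le> k" "m \<noteq> i" for m
  proof (cases "m < i")
    case True
    then have "\<theta> i < \<theta> (i - 1)" using gt(1) ik m by (auto simp: theta_ext_def split: if_splits)
    also have "\<dots> \<le> \<theta> m" using True m ik by (intro mono) auto
    finally show ?thesis by simp
  next
    case False
    then have "i + 1 \<le> m" using m by simp
    then have "\<theta> (i + 1) < \<theta> i" using gt(2) ik m by (auto simp: theta_ext_def split: if_splits)
    moreover have "\<theta> m \<le> \<theta> (i + 1)" using \<open>i + 1 \<le> m\<close> m by (intro mono) auto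
    ultimately show ?thesis by simp
  qed
  define A where "A = insert (\<theta> i) ((\<lambda>m. \<bar>\<theta> m - \<theta> i\<bar>) ` ({1..k} - {i}))"
  have A: "finite A" "A \<noteq> {}" by (auto simp: A_def)
  have "0 < \<theta> i" using mono[of i k] ik pos by simp
  then have "0 < Min A" using A ne by (auto simp: Min_gr_iff A_def)
  moreover have "Min A \<le> \<theta> i" using A by (intro Min_le) (auto simp: A_def)
  moreover have "Min A \<le> \<bar>\<theta> m - \<theta> i\<bar>" if "1 \<le> m" "m \<le> k" "m \<noteq> i" for m
    using A that by (intro Min_le) (auto simp: A_def)
  ultimately show ?thesis by blast
qed

lemma gram_matrix_tendsto:
  assumes orth: "orthonormal_L2 r {1..k}"
    and bd: "\<And>i. i \<in> {1..k} \<Longrightarrow> bounded (r i ` {0..1})"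
    and rint: "\<And>i. i \<in> {1..k} \<Longrightarrow> riemann_integrable_on (r i) 0 1"
    and lm: "l \<in> {1..k}" "m \<in> {1..k}"
  shows "(\<lambda>N. dotp N (\<lambda>a. r l (real (Suc a) / real N) / sqrt (real N)) (\<lambda>a. r m (real (Suc a) / real N) / sqrt (real N)))
     \<longlonglongrightarrow> (if l = m then 1 else 0)"
proof -
  have "(\<lambda>N. (\<Sum>a<N. r l (real (Suc a) / real N) * r m (real (Suc a) / real N)) / real N)
     \<longlonglongrightarrow> (\<integral>x. r l x * r m x \<partial>lebesgue_on {0..1})"
    using orth lm by (intro riemann_sum_product_tendsto rint bd) (auto simp: orthonormal_L2_def)
  moreover have "(\<integral>x. r l x * r m x \<partial>lebesgue_on {0..1}) = (if l = m then 1 else 0)"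
    using orth lm by (auto simp: orthonormal_L2_def)
  moreover have "(\<lambda>N. dotp N (\<lambda>a. r l (real (Suc a) / real N) / sqrt (real N)) (\<lambda>a. r m (real (Suc a) / real N) / sqrt (real N)))
    = (\<lambda>N. (\<Sum>a<N. r l (real (Suc a) / real N) * r m (real (Suc a) / real N)) / real N)"
    by (auto simp: dotp_def sum_divide_distrib fun_eq_iff)
  ultimately show ?thesis by simp
qed

text \<open>All error terms can be expressed through this null sequence. It is here that the exponent 8
enters.\<close>

lemma ln_power_over_tendsto_0:
  assumes lim: "(\<lambda>N. inverse (real N * \<epsilon> N) * ln (real N) powr \<xi>) \<longlonglongrightarrow> 0" and \<xi>: "8 < \<xi>"
    and pos: "\<And>N. N \<ge> 1 \<Longrightarrow> 0 < \<epsilon> N"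
  shows "(\<lambda>N. ln (real N) ^ 8 / (real N * \<epsilon> N)) \<longlonglongrightarrow> 0"
proof (rule Lim_null_comparison[OF _ lim])
  show "\<forall>\<^sub>F N in sequentially. norm (ln (real N) ^ 8 / (real N * \<epsilon> N)) \<le> inverse (real N * \<epsilon> N) * ln (real N) powr \<xi>"
    using eventually_ge_at_top[of 3]
  proof eventually_elim
    case (elim N)
    have "exp 1 \<le> real N" using elim exp_le by linarith
    then have L: "1 \<le> ln (real N)" using elim by (subst ln_ge_iff) auto
    have "ln (real N) ^ 8 = ln (real N) powr 8" using L by (simp add: powr_numeral)
    also have "\<dots> \<le> ln (real N) powr \<xi>" using L \<xi> by (intro powr_mono) auto
    finally have "ln (real N) ^ 8 \<le> ln (real N) powr \<xi>" .
    moreover have "0 < real N * \<epsilon> N" using pos[of N] elim by simp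
    ultimately show ?case using L by (simp add: field_simps)
  qed
qed

lemma evec_scalar_prod:
  "Matrix.scalar_prod (evec r N i) ((graph_mat N S - Matrix.mat N N (\<lambda>(a, b). m a b)) *\<^sub>v evec r N i)
    = dotp N (\<lambda>a. r i (real (Suc a) / real N) / sqrt (real N)) (mvec N (adj S) (\<lambda>a. r i (real (Suc a) / real N) / sqrt (real N)))
    - dotp N (\<lambda>a. r i (real (Suc a) / real N) / sqrt (real N)) (mvec N m (\<lambda>a. r i (real (Suc a) / real N) / sqrt (real N)))"
proof -
  define x where "x = (\<lambda>a. r i (real (Suc a) / real N) / sqrt (real N))"
  have ev: "evec r N i = Matrix.vec N x" by (simp add: evec_def x_def)
  have "Matrix.scalar_prod (Matrix.vec N x) ((graph_mat N S - Matrix.mat N N (\<lambda>(a, b). m a b)) *\<^sub>v Matrix.vec N x)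
    = (\<Sum>a<N. x a * (\<Sum>b<N. (adj S a b - m a b) * x b))"
    by (simp add: scalar_prod_def graph_mat_def lessThan_atLeast0)
  also have "\<dots> = dotp N x (mvec N (adj S) x) - dotp N x (mvec N m x)"
    by (simp add: dotp_def mvec_def left_diff_distrib right_diff_distrib sum_subtractf)
  finally show ?thesis by (simp only: ev x_def[symmetric])
qed

theorem theorem2p2:
  fixes k :: nat
    and \<theta> :: "nat \<Rightarrow> real"
    and r :: "nat \<Rightarrow> real \<Rightarrow> real"
    and \<epsilon> :: "nat \<Rightarrow> real"
    and \<epsilon>_inf \<xi> :: real
    and M :: "nat \<Rightarrow> 'a measure"
    and A :: "nat \<Rightarrow> 'a \<Rightarrow> real Matrix.mat"
    and W :: "nat \<Rightarrow> 'a \<Rightarrow> real Matrix.mat"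
    and i :: nat
  assumes "k \<ge> 1"
    and "\<And>i j. 1 \<le> i \<Longrightarrow> i \<le> j \<Longrightarrow> j \<le> k \<Longrightarrow> \<theta> j \<le> \<theta> i"
    and "\<theta> k > 0"
    and "orthonormal_L2 r {1..k}"
    and "\<And>x y. x \<in> {0..1} \<Longrightarrow> y \<in> {0..1} \<Longrightarrow> edge_kernel k \<theta> r x y \<ge> 0"
    and "\<And>N. N \<ge> 1 \<Longrightarrow> 0 < \<epsilon> N"
    and "\<And>N. N \<ge> 1 \<Longrightarrow>
           \<epsilon> N \<le> inverse (SUP (x, y) \<in> {0..1} \<times> {0..1}. edge_kernel k \<theta> r x y)"
    and "\<And>N. N \<ge> 1 \<Longrightarrow> prob_space (M N)"
    and "\<And>N. N \<ge> 1 \<Longrightarrow>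
           bernoulli_symmetric_mat (M N) N
             (\<lambda>m n. \<epsilon> N * edge_kernel k \<theta> r (real m / real N) (real n / real N)) (A N)"
    and "\<And>N \<omega>. W N \<omega> = A N \<omega> - expectation_mat (M N) N (A N)"
    and "\<And>i. i \<in> {1..k} \<Longrightarrow> bounded (r i ` {0..1})"
    and "\<And>i. i \<in> {1..k} \<Longrightarrow> riemann_integrable_on (r i) 0 1"
    and "\<xi> > 8"
    and "(\<lambda>N. inverse (real N * \<epsilon> N) * ln (real N) powr \<xi>) \<longlonglongrightarrow> 0"
    and "\<epsilon> \<longlonglongrightarrow> \<epsilon>_inf"
    and "\<epsilon>_inf \<ge> 0"
    and "i \<in> simple_indices k \<theta>"
  shows "little_op M
           (\<lambda>N \<omega>. eigval i (A N \<omega>) -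
              ((\<integral>\<omega>'. eigval i (A N \<omega>') \<partial>M N) +
               real N * \<theta> i * \<epsilon> N / eigval i (A N \<omega>) *
                 Matrix.scalar_prod (evec r N i) (W N \<omega> *\<^sub>v evec r N i)))
           (\<lambda>N \<omega>. sqrt (\<epsilon> N))"
proof -
  note mono = assms(2) and pos_k = assms(3) and f_nonneg = assms(5) and eps_pos = assms(6)
  have ik: "1 \<le> i" "i \<le> k" using assms(17) by (auto simp: simple_indices_def)
  have theta_pos: "0 < \<theta> l" if "1 \<le> l" "l \<le> k" for l using mono[OF that(1,2) order_refl] pos_k by simp
  obtain g where g: "0 < g" "g \<le> \<theta> i" "\<And>m. 1 \<le> m \<Longrightarrow> m \<le> k \<Longrightarrow> m \<noteq> i \<Longrightarrow> g \<le> \<bar>\<theta> m - \<theta> i\<bar>"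
    using simple_index_gap[OF assms(17) mono pos_k] by blast

  have "\<exists>B. \<forall>x\<in>{0..1}. \<bar>r m x\<bar> \<le> B" if "m \<in> {1..k}" for m
    using assms(11)[OF that] by (auto simp: bounded_iff)
  then obtain B where B: "\<And>m x. m \<in> {1..k} \<Longrightarrow> x \<in> {0..1} \<Longrightarrow> \<bar>r m x\<bar> \<le> B m" by metis
  \<comment> \<open>A common bound for all the functions r m; the summand 1 keeps it positive.\<close>
  define K where "K = 1 + (\<Sum>m=1..k. \<bar>B m\<bar>)"
  have K0: "0 < K" unfolding K_def by (intro add_pos_nonneg sum_nonneg) auto
  have rK: "\<bar>r m x\<bar> \<le> K" if "m \<in> {1..k}" "x \<in> {0..1}" for m x
  proof -
    have "\<bar>B m\<bar> \<le> (\<Sum>m=1..k. \<bar>B m\<bar>)" using that by (intro member_le_sum) auto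
    then show ?thesis using B[OF that] by (simp add: K_def)
  qed

  define f where "f = edge_kernel k \<theta> r"
  define F where "F = (SUP (x, y) \<in> {0..1} \<times> {0..1}. f x y)"
  have f_sym: "f x y = f y x" for x y by (simp add: f_def edge_kernel_def mult_ac)
  have f_bound: "f x y \<le> (\<Sum>l=1..k. \<theta> l * (K * K))" if "x \<in> {0..1}" "y \<in> {0..1}" for x y
    unfolding f_def edge_kernel_def
  proof (rule sum_mono)
    fix l assume l: "l \<in> {1..k}"
    have "r l x * r l y \<le> \<bar>r l x\<bar> * \<bar>r l y\<bar>" by (simp flip: abs_mult)
    also have "\<dots> \<le> K * K" using rK[OF l] that K0 by (intro mult_mono) auto
    finally show "\<theta> l * r l x * r l y \<le> \<theta> l * (K * K)"
      using theta_pos[of l] l unfolding mult.assoc by (intro mult_left_mono) auto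
  qed
  have fF: "f x y \<le> F" if "x \<in> {0..1}" "y \<in> {0..1}" for x y
  proof -
    have "bdd_above ((\<lambda>(x, y). f x y) ` ({0..1} \<times> {0..1}))"
      using f_bound by (intro bdd_aboveI[of _ "\<Sum>l=1..k. \<theta> l * (K * K)"]) auto
    then have "(\<lambda>(x, y). f x y) (x, y) \<le> F" unfolding F_def using that by (intro cSUP_upper) auto
    then show ?thesis by simp
  qed
  have F0: "0 < F"
  proof -
    have "0 < inverse F" using eps_pos[of 1] assms(7)[of 1] unfolding F_def f_def by linarith
    then show ?thesis by simp
  qed
  have epsF: "\<epsilon> N * F \<le> 1" if "N \<ge> 1" for N
    using assms(7)[OF that] F0 unfolding F_def[unfolded f_def, symmetric] by (simp add: field_simps)

  define e where "e = (\<lambda>N m a. r m (real (Suc a) / real N) / sqrt (real N))"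
  define L where "L = (\<lambda>N. ln (real N))"
  define n where "n = (\<lambda>N. nat \<lceil>L N\<rceil>)"
  define X where "X = (\<lambda>N. L N ^ 8 / (real N * \<epsilon> N))"
  have X0: "X \<longlonglongrightarrow> 0"
    unfolding X_def L_def by (rule ln_power_over_tendsto_0[OF assms(14,13) eps_pos])
  have gridpt: "real (Suc a) / real N \<in> {0..1}" if "a < N" for a N using that by simp

  have spike_ready: "\<forall>\<^sub>F N in sequentially. random_spike N k \<theta> (e N) (real N * \<epsilon> N) d i g
        (\<lambda>(a, b). \<epsilon> N * f (real (Suc a) / real N) (real (Suc b) / real N)) (F * \<epsilon> N) K (n N)
      \<and> (2 * real (n N) + 1) ^ 4 * (real N * (F * \<epsilon> N))\<^sup>2 * exp 8 \<le> (d * (real N * \<epsilon> N)) ^ 4 \<and> 1 \<le> L N \<and> k < N"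
    if d: "0 < d" "real k * d \<le> 1 / 2" "(k * \<theta> 1 + 1) * d \<le> g / 4" "2 * d / g \<le> exp (- 1)" for d
  proof -
    have gram: "\<forall>\<^sub>F N in sequentially. \<forall>z\<in>{1..k} \<times> {1..k}.
        \<bar>dotp N (e N (fst z)) (e N (snd z)) - (if fst z = snd z then 1 else 0)\<bar> \<le> d"
    proof (rule eventually_ball_finite)
      show "\<forall>z\<in>{1..k} \<times> {1..k}. \<forall>\<^sub>F N in sequentially. \<bar>dotp N (e N (fst z)) (e N (snd z)) - (if fst z = snd z then 1 else 0)\<bar> \<le> d"
      proof
        fix z :: "nat \<times> nat" assume z: "z \<in> {1..k} \<times> {1..k}"
        have "(\<lambda>N. dotp N (e N (fst z)) (e N (snd z))) \<longlonglongrightarrow> (if fst z = snd z then 1 else 0)"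
          unfolding e_def using z by (intro gram_matrix_tendsto[OF assms(4,11,12)]) auto
        from tendstoD[OF this d(1)]
        show "\<forall>\<^sub>F N in sequentially. \<bar>dotp N (e N (fst z)) (e N (snd z)) - (if fst z = snd z then 1 else 0)\<bar> \<le> d"
          by (rule eventually_mono) (auto simp: dist_real_def)
      qed
    qed simp
    \<comment> \<open>Three smallness conditions on X: for the spectral gap, for the density N q, and for the rarity of the bad event.\<close>
    have "\<forall>\<^sub>F N in sequentially. X N < min (min (g / 8) F) (d\<^sup>2 / (25 * F * exp 4))"
      by (rule order_tendstoD(2)[OF X0]) (use g F0 d in simp)
    with gram eventually_ge_at_top[of "max 3 (k + 1)"] show ?thesis
    proof eventually_elim
      case (elim N)
      define \<tau> where "\<tau> = real N * \<epsilon> N"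
      have N3: "3 \<le> N" "k < N" "1 \<le> N" using elim(2) by auto
      have tau: "0 < \<tau>" using eps_pos[of N] N3 by (simp add: \<tau>_def)
      have L1: "1 \<le> L N"
      proof -
        have "exp 1 \<le> real N" using N3(1) exp_le by linarith
        then show ?thesis using N3 unfolding L_def by (subst ln_ge_iff) auto
      qed
      have n5: "2 * real (n N) + 1 \<le> 5 * L N" using L1 by (simp add: n_def of_nat_nat) linarith
      have "1 \<le> L N ^ 8" using L1 by simp
      then have invX: "1 / \<tau> \<le> X N" using tau by (simp add: X_def \<tau>_def[symmetric] divide_right_mono)
      have tg: "8 \<le> \<tau> * g"
      proof -
        have "1 / \<tau> \<le> g / 8" using invX elim(3) by simp
        then show ?thesis using tau by (simp add: field_simps)
      qed
      have Nq: "1 \<le> real N * (F * \<epsilon> N)"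
      proof -
        have "1 / \<tau> \<le> F" using invX elim(3) by simp
        then show ?thesis using tau by (simp add: field_simps \<tau>_def)
      qed
      have small: "(2 * real (n N) + 1) ^ 4 * (real N * (F * \<epsilon> N))\<^sup>2 * exp 8 \<le> (d * \<tau>) ^ 4"
      proof -
        have "(2 * real (n N) + 1)\<^sup>2 * (real N * (F * \<epsilon> N)) * exp 4 \<le> (d * \<tau>)\<^sup>2"
        proof -
          have "X N * (25 * F * exp 4) \<le> d\<^sup>2" using elim(3) F0 by (simp add: field_simps)
          then have "L N ^ 8 * (25 * F * exp 4) \<le> d\<^sup>2 * \<tau>"
            using tau by (simp add: X_def \<tau>_def[symmetric] field_simps)
          then have "L N ^ 8 * (25 * F * exp 4) * \<tau> \<le> d\<^sup>2 * \<tau> * \<tau>" using tau by (intro mult_right_mono) auto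
          moreover have "(2 * real (n N) + 1)\<^sup>2 \<le> 25 * L N ^ 8"
          proof -
            have "(2 * real (n N) + 1)\<^sup>2 \<le> (5 * L N)\<^sup>2" using n5 by (intro power_mono) auto
            also have "\<dots> = 25 * L N ^ 2" by (simp add: power_mult_distrib)
            also have "\<dots> \<le> 25 * L N ^ 8" using L1 by (intro mult_left_mono power_increasing) auto
            finally show ?thesis .
          qed
          then have "(2 * real (n N) + 1)\<^sup>2 * (\<tau> * F * exp 4) \<le> 25 * L N ^ 8 * (\<tau> * F * exp 4)"
            using tau F0 by (intro mult_right_mono) auto
          ultimately show ?thesis by (simp add: \<tau>_def power2_eq_square mult_ac)
        qed
        then have "((2 * real (n N) + 1)\<^sup>2 * (real N * (F * \<epsilon> N)) * exp 4)\<^sup>2 \<le> ((d * \<tau>)\<^sup>2)\<^sup>2"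
          using F0 eps_pos[of N] N3 by (intro power_mono) auto
        moreover have "(exp 4)\<^sup>2 = exp (8 :: real)" by (simp flip: exp_of_nat_mult[of 2])
        ultimately show ?thesis by (simp add: power_mult_distrib)
      qed
      have "random_spike N k \<theta> (e N) \<tau> d i g
        (\<lambda>(a, b). \<epsilon> N * f (real (Suc a) / real N) (real (Suc b) / real N)) (F * \<epsilon> N) K (n N)"
      proof
        show "\<bar>dotp N (e N l) (e N m) - (if l = m then 1 else 0)\<bar> \<le> d" if "l \<in> {1..k}" "m \<in> {1..k}" for l m
          using elim(1) that by auto
        show "(case edge a b of (a, b) \<Rightarrow> \<epsilon> N * f (real (Suc a) / real N) (real (Suc b) / real N))
            = \<tau> * (\<Sum>l=1..k. \<theta> l * e N l a * e N l b)" if "a < N" "b < N" for a b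
        proof -
          have "\<tau> * (\<Sum>l=1..k. \<theta> l * e N l a * e N l b) = \<epsilon> N * f (real (Suc a) / real N) (real (Suc b) / real N)"
            using N3 by (simp add: \<tau>_def e_def f_def edge_kernel_def sum_distrib_left mult_ac)
          then show ?thesis
            using f_sym[of "real (Suc a) / real N"] by (simp add: edge_def min_def max_def)
        qed
        show "0 \<le> (case z of (a, b) \<Rightarrow> \<epsilon> N * f (real (Suc a) / real N) (real (Suc b) / real N)) \<and>
           (case z of (a, b) \<Rightarrow> \<epsilon> N * f (real (Suc a) / real N) (real (Suc b) / real N)) \<le> F * \<epsilon> N" if "z \<in> pairs N" for z
        proof -
          obtain a b where z: "z = (a, b)" "a < N" "b < N" using \<open>z \<in> pairs N\<close> by (auto simp: pairs_def)
          show ?thesis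
            using f_nonneg[OF gridpt[OF z(2)] gridpt[OF z(3)]] fF[OF gridpt[OF z(2)] gridpt[OF z(3)]] eps_pos[of N] N3
            by (simp add: z(1) f_def[symmetric] mult.commute)
        qed
        show "F * \<epsilon> N \<le> 1" using epsF[of N] N3 by (simp add: mult.commute)
        show "\<bar>e N m b\<bar> \<le> K / sqrt (real N)" if "m \<in> {1..k}" "b < N" for m b
          using rK[OF that(1) gridpt[OF that(2)]] N3 by (simp add: e_def divide_right_mono)
        show "(2 * real (n N) + 1) ^ 4 * (real N * (F * \<epsilon> N))\<^sup>2 \<le> (\<tau> * (g / 2)) ^ 4"
        proof -
          have "(2 * real (n N) + 1) ^ 4 * (real N * (F * \<epsilon> N))\<^sup>2 * 1 \<le> (2 * real (n N) + 1) ^ 4 * (real N * (F * \<epsilon> N))\<^sup>2 * exp 8"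
            by (intro mult_left_mono) auto
          also note small
          also have "(d * \<tau>) ^ 4 \<le> (\<tau> * (g / 2)) ^ 4"
          proof (intro power_mono)
            have "2 * d / g \<le> 1" by (rule order_trans[OF d(4)]) simp
            then have "d \<le> g / 2" using g by (simp add: field_simps)
            then show "d * \<tau> \<le> \<tau> * (g / 2)" using tau by (simp add: mult.commute)
          qed (use d tau in auto)
          finally show ?thesis by simp
        qed
      qed (use tau N3 mono theta_pos d ik g Nq K0 tg in auto)
      then show ?case using small L1 N3 by (simp add: \<tau>_def)
    qed
  qed

  define Y where "Y = (\<lambda>N \<omega>. eigval i (A N \<omega>) -
              ((\<integral>\<omega>'. eigval i (A N \<omega>') \<partial>M N) +
               real N * \<theta> i * \<epsilon> N / eigval i (A N \<omega>) *
                 Matrix.scalar_prod (evec r N i) (W N \<omega> *\<^sub>v evec r N i)))"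
  \<comment> \<open>The limit of the bound as N tends to infinity; it is quadratic in d.\<close>
  define c where "c = (\<lambda>\<delta> d. 4 * F / \<delta>\<^sup>2 * (80 * (alignment_const k (\<theta> 1) g * d)\<^sup>2)
      + 4 * F / \<delta>\<^sup>2 * (16 * (2 * ((k * \<theta> 1 + 1) * d) / g)\<^sup>2))"
  \<comment> \<open>The part of the bound that tends to 0.\<close>
  define s where "s = (\<lambda>\<delta> N. 5 / real N + 4 * F / \<delta>\<^sup>2 * (128 / g\<^sup>2 * (640 * real k ^ 4 * (4 * \<theta> 1 / g * K) ^ 4 + 8) * (X N)\<^sup>2
        + (1 + 2 * K\<^sup>2)\<^sup>2 * (5 / real N)))"
  have bound: "\<forall>\<^sub>F N in sequentially. measure (M N) {\<omega> \<in> space (M N). \<bar>Y N \<omega>\<bar> > \<delta> * \<bar>sqrt (\<epsilon> N)\<bar>} \<le> s \<delta> N + c \<delta> d"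
    if \<delta>: "0 < \<delta>" and d: "0 < d" "real k * d \<le> 1 / 2" "(k * \<theta> 1 + 1) * d \<le> g / 4" "2 * d / g \<le> exp (- 1)" for \<delta> d
    using spike_ready[OF d]
  proof eventually_elim
    case (elim N)
    have N1: "1 \<le> N" using elim by simp
    interpret prob_space "M N" by (rule assms(8)[OF N1])
    interpret B: bernoulli_matrix "M N" N "\<lambda>m n. \<epsilon> N * edge_kernel k \<theta> r (real m / real N) (real n / real N)" "A N"
    proof
      show "0 \<le> \<epsilon> N * edge_kernel k \<theta> r (real (Suc a) / real N) (real (Suc b) / real N) \<and>
          \<epsilon> N * edge_kernel k \<theta> r (real (Suc a) / real N) (real (Suc b) / real N) \<le> 1" if "a \<le> b" "b < N" for a b
      proof -
        have ab: "real (Suc a) / real N \<in> {0..1}" "real (Suc b) / real N \<in> {0..1}" using that by (auto intro!: gridpt)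
        have "\<epsilon> N * edge_kernel k \<theta> r (real (Suc a) / real N) (real (Suc b) / real N) \<le> \<epsilon> N * F"
          using fF[OF ab] eps_pos[OF N1] unfolding f_def by (intro mult_left_mono) auto
        also have "\<dots> \<le> 1" by (rule epsF[OF N1])
        finally show ?thesis using f_nonneg[OF ab] eps_pos[OF N1] by (intro conjI mult_nonneg_nonneg) auto
      qed
    qed (use N1 assms(9)[OF N1] in auto)
    define p where "p = (\<lambda>(a, b). \<epsilon> N * f (real (Suc a) / real N) (real (Suc b) / real N))"
    have pe: "B.pe = p" by (simp add: B.pe_def p_def f_def)
    define \<tau> where "\<tau> = real N * \<epsilon> N"
    interpret R: random_spike N k \<theta> "e N" \<tau> d i g p "F * \<epsilon> N" K "n N"
      using elim by (simp add: p_def \<tau>_def)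
    have mean: "(\<integral>\<omega>'. eigval i (A N \<omega>') \<partial>M N) = R.E (\<lambda>S. eig N (adj S) i)"
      using B.expectation_eq_bexp[OF B.eigval_measurable[OF ik(1) R.i_le_N]]
      by (simp add: pe eig_def graph_mat_def)
    have EM: "expectation_mat (M N) N (A N) = Matrix.mat N N (\<lambda>(a, b). p (edge a b))"
      unfolding expectation_mat_def by (intro cong_mat) (auto simp: B.entry_edge_expectation pe)
    have Equad: "R.E R.quad = dotp N (e N i) (mvec N (\<lambda>a b. p (edge a b)) (e N i))"
    proof -
      have "R.E R.quad = R.E (\<lambda>S. \<Sum>a<N. \<Sum>b<N. e N i a * e N i b * of_bool (edge a b \<in> S))"
        unfolding R.quad_def[abs_def] dotp_def mvec_def adj_def by (simp only: sum_distrib_left mult_ac)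
      also have "\<dots> = (\<Sum>a<N. \<Sum>b<N. e N i a * e N i b * p (edge a b))"
        unfolding bexp_sum bexp_cmult by (intro sum.cong refl) (simp add: bexp_indicator)
      finally show ?thesis by (simp add: dotp_def mvec_def sum_distrib_left mult_ac)
    qed
    define y where "y = (\<lambda>B. eigval i B - (R.E (\<lambda>S. eig N (adj S) i) + real N * \<theta> i * \<epsilon> N / eigval i B *
        Matrix.scalar_prod (evec r N i) ((B - Matrix.mat N N (\<lambda>(a, b). p (edge a b))) *\<^sub>v evec r N i)))"
    have Yy: "Y N \<omega> = y (A N \<omega>)" for \<omega>
      by (simp add: Y_def y_def mean assms(10) EM)
    have yS: "y (graph_mat N S) = eig N (adj S) i - (R.E (\<lambda>S. eig N (adj S) i) + \<tau> * \<theta> i / eig N (adj S) i * (R.quad S - R.E R.quad))" for S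
      unfolding y_def evec_scalar_prod e_def[THEN fun_cong, THEN fun_cong, symmetric] Equad R.quad_def \<tau>_def
      by (simp add: eig_def graph_mat_def mult_ac)
    have "measure (M N) {\<omega> \<in> space (M N). \<bar>Y N \<omega>\<bar> > \<delta> * \<bar>sqrt (\<epsilon> N)\<bar>}
        \<le> R.E (\<lambda>S. of_bool (\<delta> * sqrt (\<epsilon> N) < \<bar>y (graph_mat N S)\<bar>))"
      using B.prob_le_bexp[of "\<lambda>B. \<delta> * sqrt (\<epsilon> N) < \<bar>y B\<bar>"] eps_pos[OF N1] by (simp add: Yy pe)
    also have "\<dots> \<le> 5 / N + 4 * F / \<delta>\<^sup>2 * (80 * (alignment_const k (\<theta> 1) g * d)\<^sup>2
        + 128 / g\<^sup>2 * (640 * real k ^ 4 * (4 * \<theta> 1 / g * K) ^ 4 + 8) * (L N ^ 8 / \<tau>)\<^sup>2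
        + (1 + 2 * K\<^sup>2)\<^sup>2 * (5 / N))
      + 4 * F / \<delta>\<^sup>2 * (16 * (2 * ((k * \<theta> 1 + 1) * d) / g)\<^sup>2)"
      unfolding yS using elim d F0 eps_pos[OF N1] \<delta>
      by (intro R.deviation_prob_explicit) (auto simp: L_def n_def \<tau>_def)
    also have "\<dots> = s \<delta> N + c \<delta> d" by (simp add: s_def c_def X_def \<tau>_def distrib_left)
    finally show ?case .
  qed

  have "(\<lambda>N. measure (M N) {\<omega> \<in> space (M N). \<bar>Y N \<omega>\<bar> > \<delta> * \<bar>sqrt (\<epsilon> N)\<bar>}) \<longlonglongrightarrow> 0" if \<delta>: "0 < \<delta>" for \<delta>
  proof (rule LIMSEQ_I)
    fix \<zeta> :: real assume \<zeta>: "0 < \<zeta>"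
    have "((\<lambda>d. c \<delta> d) \<longlongrightarrow> c \<delta> 0) (at_right 0)"
      unfolding c_def using g by (intro tendsto_intros) auto
    then have "\<forall>\<^sub>F d in at_right 0. c \<delta> d < \<zeta> / 2" using \<zeta> by (intro order_tendstoD(2)) (auto simp: c_def)
    moreover have "((\<lambda>d. real k * d) \<longlongrightarrow> real k * 0) (at_right 0)" by (intro tendsto_intros)
    then have "\<forall>\<^sub>F d in at_right 0. real k * d < 1 / 2" by (rule order_tendstoD(2)) simp
    moreover have "((\<lambda>d. (k * \<theta> 1 + 1) * d) \<longlongrightarrow> (k * \<theta> 1 + 1) * 0) (at_right 0)" by (intro tendsto_intros)
    then have "\<forall>\<^sub>F d in at_right 0. (k * \<theta> 1 + 1) * d < g / 4" by (rule order_tendstoD(2)) (use g in simp)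
    moreover have "((\<lambda>d. 2 * d / g) \<longlongrightarrow> 2 * 0 / g) (at_right 0)" using g by (intro tendsto_intros) auto
    then have "\<forall>\<^sub>F d in at_right 0. 2 * d / g < exp (- 1)" by (rule order_tendstoD(2)) simp
    ultimately have "\<forall>\<^sub>F d in at_right 0. 0 < d \<and> c \<delta> d < \<zeta> / 2 \<and> real k * d < 1 / 2 \<and> (k * \<theta> 1 + 1) * d < g / 4 \<and> 2 * d / g < exp (- 1)"
      using eventually_at_right_less[of 0] by eventually_elim auto
    then obtain d where d: "0 < d" "c \<delta> d < \<zeta> / 2" "real k * d < 1 / 2" "(k * \<theta> 1 + 1) * d < g / 4" "2 * d / g < exp (- 1)"
      using eventually_happens'[OF trivial_limit_at_right_real] by blast
    have inv0: "(\<lambda>N. 5 / real N) \<longlonglongrightarrow> 0" by (rule lim_const_over_n)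
    have "s \<delta> \<longlonglongrightarrow> 0 + 4 * F / \<delta>\<^sup>2 * (128 / g\<^sup>2 * (640 * real k ^ 4 * (4 * \<theta> 1 / g * K) ^ 4 + 8) * 0\<^sup>2 + (1 + 2 * K\<^sup>2)\<^sup>2 * 0)"
      unfolding s_def by (intro tendsto_add tendsto_mult tendsto_power tendsto_const X0 inv0)
    then have "\<forall>\<^sub>F N in sequentially. s \<delta> N < \<zeta> / 2" using \<zeta> by (intro order_tendstoD) auto
    moreover have "\<forall>\<^sub>F N in sequentially. measure (M N) {\<omega> \<in> space (M N). \<bar>Y N \<omega>\<bar> > \<delta> * \<bar>sqrt (\<epsilon> N)\<bar>} \<le> s \<delta> N + c \<delta> d"
      using d by (intro bound \<delta>) auto
    ultimately have "\<forall>\<^sub>F N in sequentially. norm (measure (M N) {\<omega> \<in> space (M N). \<bar>Y N \<omega>\<bar> > \<delta> * \<bar>sqrt (\<epsilon> N)\<bar>} - 0) < \<zeta>"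
    proof eventually_elim
      case (elim N)
      have "measure (M N) {\<omega> \<in> space (M N). \<bar>Y N \<omega>\<bar> > \<delta> * \<bar>sqrt (\<epsilon> N)\<bar>} < \<zeta>"
        using elim d(2) by linarith
      then show ?case by simp
    qed
    then show "\<exists>no. \<forall>N\<ge>no. norm (measure (M N) {\<omega> \<in> space (M N). \<bar>Y N \<omega>\<bar> > \<delta> * \<bar>sqrt (\<epsilon> N)\<bar>} - 0) < \<zeta>"
      by (simp only: eventually_sequentially)
  qed
  then show ?thesis unfolding little_op_def Y_def by blast
qed

end
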